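(* Let $n\ge1$ and let $\alpha_1,\alpha_2,\alpha_3,\beta_1,\beta_2,\beta_3$ be $n$-th roots of unity with $\alpha_1\alpha_2\alpha_3=1=\beta_1\beta_2\beta_3$. Let $\mathcal{A}$ be the multiset $\{\alpha_1,\alpha_2,\alpha_3,\bar\alpha_1,\bar\alpha_2,\bar\alpha_3\}$ and $\mathcal{B}$ the multiset $\{\beta_1,\beta_2,\beta_3,\bar\beta_1,\bar\beta_2,\bar\beta_3\}$. Suppose the multisets $\{\sum_{\phi\in\mathcal{A}}\phi^r:1\le r\le n\}$ and $\{\sum_{\psi\in\mathcal{B}}\psi^r:1\le r\le n\}$ are identical. Then there is an integer $u$ coprime to $n$ such that $\mathcal{A}=\{\psi^u:\psi\in\mathcal{B}\}$ as multisets.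
   Context: Bars denote complex conjugation. *)

theory Defs
  imports Complex_Main "HOL-Library.Multiset"
begin

end

(* Write A(r) for the sum of the r-th powers of A.  The value 6 is taken exactly when A^r is trivial,
   so A and B generate the same group of roots of unity, and we may take n to be its order.  As A(1)
   occurs among the values of B, there is u with A(1) = B(u), an additive relation between twelve roots
   of unity.  Galois conjugation over the field of n/p-th roots of unity, for a prime p dividing n,
   splits this relation along the classes phi^(n/p).  If 4, 9, p^2 or a prime p >= 7 divides n, the
   classes are so small that A = B^u, up to one sporadic family with n = 42 and the degenerate cases
   where -1 or an opposite pair occurs in {alpha1, alpha2, alpha3}; in the latter cases A is
   determined by a single primitive n-th root of unity.  The remaining n divide 30: there the power
   moments of the sums count closed walks in Z/30, and these numbers separate the finitely many classes. *)

theory Submission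
  imports Defs "HOL-Number_Theory.Number_Theory" "HOL-Computational_Algebra.Polynomial_Factorial"
    "HOL-Computational_Algebra.Squarefree"
begin

section \<open>Irreducibility of cyclotomic polynomials: integer relations persist under coprime
  powers\<close>

section \<open>Conjugates of roots of unity\<close>

text \<open>Put n = p * k. The sum over a class of k-th powers is a Fourier sum of power sums with
  exponents 1 + k * t, t < p. If p divides k, all these exponents are coprime to n, so the class
  sums of the two sextuples agree. Otherwise exactly one exponent is not coprime to n, and suitably
  twisted differences of class sums all equal one constant S. An empty class forces S = 0. If all p
  classes were met, so would be the trivial one, and then the two sextuples meet at most 6 + 3 = 9
  classes: hence p >= 11 is harmless, p = 7 leaves a short list of patterns with S not 0, and simple
  factors 2, 3, 5 are too small for the method, whence the modulus 30. Degenerate triples are set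
  apart because one sum says too little about them: every triple containing -1 gives the sum -2, and
  an opposite pair cancels. The u with A(1) = B(u) need not be known to be coprime to n; coprimality
  follows once A = B^u, since A and B generate the same group.\<close>

definition ipoly :: "int poly \<Rightarrow> complex \<Rightarrow> complex" where
  "ipoly p z = poly (map_poly of_int p) z"

lemma ipoly_pCons [simp]: "ipoly (pCons a p) z = of_int a + z * ipoly p z"
  by (simp add: ipoly_def map_poly_pCons)

lemma ipoly_0 [simp]: "ipoly 0 z = 0"
  by (simp add: ipoly_def)

lemma ipoly_1 [simp]: "ipoly 1 z = 1"
  by (simp add: ipoly_def)

lemma ipoly_add [simp]: "ipoly (p + q) z = ipoly p z + ipoly q z"
  by (induction p q rule: poly_induct2) (simp_all add: algebra_simps)

lemma ipoly_smult [simp]: "ipoly (smult a p) z = of_int a * ipoly p z"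
  by (induction p) (simp_all add: algebra_simps)

lemma ipoly_mult [simp]: "ipoly (p * q) z = ipoly p z * ipoly q z"
  by (induction p) (simp_all add: algebra_simps)

lemma ipoly_minus [simp]: "ipoly (- p) z = - ipoly p z"
  using ipoly_add[of p "- p" z] by (simp add: add_eq_0_iff)

lemma ipoly_diff [simp]: "ipoly (p - q) z = ipoly p z - ipoly q z"
  using ipoly_add[of p "- q" z] by simp

lemma ipoly_power [simp]: "ipoly (p ^ k) z = ipoly p z ^ k"
  by (induction k) simp_all

lemma ipoly_monom [simp]: "ipoly (monom a k) z = of_int a * z ^ k"
  by (simp add: ipoly_def map_poly_monom poly_monom)

lemma ipoly_pcompose [simp]: "ipoly (pcompose p q) z = ipoly p (ipoly q z)"
  by (induction p) (simp_all add: pcompose_pCons)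

text \<open>The inner binomial coefficients are divisible by q. A general commutative ring is used
  because the integers and the integer polynomials are both needed.\<close>

lemma freshmans_dream_dvd:
  fixes a b :: "'a :: comm_ring_1"
  assumes "prime q"
  shows "of_nat q dvd (a + b) ^ q - (a ^ q + b ^ q)"
proof -
  have q: "q > 0" using assms prime_gt_0_nat by blast
  have "(a + b) ^ q = (\<Sum>k\<le>q. of_nat (q choose k) * a ^ k * b ^ (q - k))"
    by (rule binomial_ring)
  also have "{..q} = insert 0 (insert q {0<..<q})" using q by auto
  also have "(\<Sum>k\<in>\<dots>. of_nat (q choose k) * a ^ k * b ^ (q - k)) =
      b ^ q + a ^ q + (\<Sum>k\<in>{0<..<q}. of_nat (q choose k) * a ^ k * b ^ (q - k))"
    using q by simp
  finally have "(a + b) ^ q - (a ^ q + b ^ q) =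
      (\<Sum>k\<in>{0<..<q}. of_nat (q choose k) * a ^ k * b ^ (q - k))" by simp
  moreover have "of_nat q dvd (of_nat (q choose k) * a ^ k * b ^ (q - k) :: 'a)" if "k \<in> {0<..<q}" for k
  proof -
    have "q dvd q choose k" using that assms by (intro dvd_choose_prime) auto
    then show ?thesis by (metis dvd_def dvd_mult2 of_nat_mult)
  qed
  ultimately show ?thesis by (metis (no_types, lifting) dvd_sum)
qed

lemma fermat_int_dvd:
  assumes "prime q"
  shows "int q dvd a ^ q - a"
proof -
  have nat: "int q dvd int b ^ q - int b" for b
  proof (induction b)
    case 0
    then show ?case using assms prime_gt_0_nat by (simp add: power_0_left)
  next
    case (Suc b)
    have "int q dvd (int b + 1) ^ q - (int b ^ q + 1 ^ q)"
      using freshmans_dream_dvd[OF assms, of "int b" 1] by simp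
    then have "int q dvd ((int b + 1) ^ q - (int b ^ q + 1)) + (int b ^ q - int b)"
      using Suc by (intro dvd_add) simp_all
    then show ?case by (simp add: algebra_simps)
  qed
  show ?thesis
  proof -
    have b: "[a = int (nat (a mod int q))] (mod int q)"
      using prime_gt_0_nat[OF assms] by (simp add: cong_def)
    define b where "b = nat (a mod int q)"
    note b = b[folded b_def]
    have "[a ^ q - a = int b ^ q - int b] (mod int q)"
      by (intro cong_diff cong_pow b)
    then show ?thesis using nat[of b] cong_dvd_iff by blast
  qed
qed

text \<open>Modulo q, the q-th power is additive and, by Fermat, fixes constants; writing
  \<open>pCons a p\<close> as a + X * p gives the induction step.\<close>

lemma poly_frobenius_dvd:
  fixes p :: "int poly"
  assumes "prime q"
  shows "[:int q:] dvd p ^ q - pcompose p (monom 1 q)"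
proof (induction p)
  case 0
  then show ?case using assms prime_gt_0_nat by (simp add: power_0_left)
next
  case (pCons a p)
  have q: "of_nat q = [:int q:]" by (simp add: of_nat_poly)
  have *: "pCons a p = [:a:] + monom 1 1 * p"
    by (simp add: monom_altdef)
  have "[:int q:] dvd (pCons a p) ^ q - ([:a:] ^ q + (monom 1 1 * p) ^ q)"
    using freshmans_dream_dvd[OF assms, of "[:a:]" "monom 1 1 * p"] * q by simp
  moreover have "[:int q:] dvd [:a:] ^ q - [:a:]"
    using fermat_int_dvd[OF assms, of a]
    by (simp add: poly_const_pow const_poly_dvd_const_poly_iff)
  moreover have "[:int q:] dvd monom 1 q * (p ^ q - pcompose p (monom 1 q))"
    using pCons by simp
  ultimately have "[:int q:] dvd ((pCons a p) ^ q - ([:a:] ^ q + (monom 1 1 * p) ^ q))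
      + ([:a:] ^ q - [:a:]) + monom 1 q * (p ^ q - pcompose p (monom 1 q))"
    by (intro dvd_add)
  also have "\<dots> = pCons a p ^ q - pcompose (pCons a p) (monom 1 q)"
    by (simp add: pcompose_pCons power_mult_distrib monom_power right_diff_distrib)
  finally show ?case .
qed

lemma ipoly_pderiv_mult:
  "ipoly (pderiv (p * q)) z = ipoly (pderiv p) z * ipoly q z + ipoly p z * ipoly (pderiv q) z"
  by (simp add: pderiv_mult algebra_simps)

text \<open>An integral minimal polynomial, obtained by Gauss's lemma. Pseudo-division keeps the
  argument over the integers, and dividing X^n - 1 forces the leading coefficient to be 1 or
  -1.\<close>

lemma ipoly_minimal:
  assumes "n > 0" "z ^ n = 1"
  obtains m where "ipoly m z = 0" "lead_coeff m = 1" "degree m > 0"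
    "\<And>h. ipoly h z = 0 \<Longrightarrow> m dvd h"
proof -
  let ?X = "monom 1 n - 1 :: int poly"
  have X: "ipoly ?X z = 0" using assms by simp
  have cX: "coeff ?X n = 1" using assms by simp
  then have X0: "?X \<noteq> 0" by (metis coeff_0 zero_neq_one)
  have "degree ?X \<le> n" by (intro degree_diff_le) (simp_all add: degree_monom_le)
  moreover have "degree ?X \<ge> n" using cX by (intro le_degree) simp
  ultimately have lX: "lead_coeff ?X = 1" using cX by simp
  define P where "P m \<longleftrightarrow> m \<noteq> 0 \<and> ipoly m z = 0" for m
  obtain m0 where m0: "P m0" and min: "\<And>h. P h \<Longrightarrow> degree m0 \<le> degree h"
    using ex_has_least_nat[of P ?X degree] X X0 unfolding P_def by blast
  define m1 where "m1 = primitive_part m0"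
  have m1: "content m1 = 1" "m1 \<noteq> 0" "degree m1 = degree m0"
    using m0 by (simp_all add: m1_def P_def)
  have "of_int (content m0) * ipoly m1 z = ipoly m0 z"
    unfolding m1_def by (metis content_times_primitive_part ipoly_smult)
  then have m1z: "ipoly m1 z = 0" using m0 by (auto simp: P_def)
  have dvd: "m1 dvd h" if h: "ipoly h z = 0" for h
  proof -
    obtain a q where a: "a \<noteq> 0" and aq: "smult a h = m1 * q + pseudo_mod h m1"
      using pseudo_mod(1)[OF m1(2)] by blast
    have "ipoly (pseudo_mod h m1) z = 0"
      using arg_cong[OF aq, of "\<lambda>p. ipoly p z"] h m1z by simp
    then have "pseudo_mod h m1 = 0"
      using pseudo_mod(2)[OF m1(2), of h] min[of "pseudo_mod h m1"] m1(3)
      unfolding P_def by force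
    with aq have eq: "smult a h = m1 * q" by simp
    \<comment> \<open>As m1 is primitive, the factor a introduced by pseudo-division divides the
      content of q and can be cancelled.\<close>
    have "normalize a * content h = content q"
      using arg_cong[OF eq, of content] m1(1) by (simp add: content_mult)
    then have "a dvd content q" by (metis dvd_triv_left normalize_dvd_iff)
    then obtain q' where "q = [:a:] * q'"
      using const_poly_dvd_iff_dvd_content by (metis dvdE)
    then have "smult a h = smult a (m1 * q')" using eq by simp
    then have "h = m1 * q'" using a by (simp add: poly_eq_iff)
    then show ?thesis by simp
  qed
  obtain k where "?X = m1 * k" using dvd[OF X] by auto
  then have "lead_coeff m1 * lead_coeff k = 1" using lX by (metis lead_coeff_mult)
  then have l: "lead_coeff m1 = 1 \<or> lead_coeff m1 = - 1"
    using zmult_eq_1_iff by blast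
  define m where "m = (if lead_coeff m1 = 1 then m1 else - m1)"
  have m: "lead_coeff m = 1" "ipoly m z = 0" "\<And>h. ipoly h z = 0 \<Longrightarrow> m dvd h"
    using l m1z dvd by (auto simp: m_def)
  have "degree m > 0"
  proof (rule ccontr)
    assume "\<not> degree m > 0"
    then have "m = 1" using m(1) by (metis degree_eq_zeroE gr0I lead_coeff_pCons(2) one_pCons pCons_eq_iff coeff_pCons_0)
    with m(2) show False by simp
  qed
  with m that show ?thesis by blast
qed

text \<open>A variant of Dedekind's argument. With X^n - 1 = m * k, if z ^ q were not a root of m it
  would be one of k, and Frobenius would make k(z)^q divisible by q. The derivative then yields q
  dvd n ^ q.\<close>

lemma ipoly_root_power_prime:
  assumes "n > 0" "z ^ n = 1" "prime q" "\<not> q dvd n" "ipoly h z = 0"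
  shows "ipoly h (z ^ q) = 0"
proof -
  obtain m where m: "ipoly m z = 0" "lead_coeff m = 1" "degree m > 0"
    and dvd: "\<And>h. ipoly h z = 0 \<Longrightarrow> m dvd h"
    using ipoly_minimal[OF assms(1,2)] by blast
  have "ipoly m (z ^ q) = 0"
  proof (rule ccontr)
    assume nz: "ipoly m (z ^ q) \<noteq> 0"
    have "m dvd monom 1 n - 1" using assms by (intro dvd) simp
    then obtain k where k: "monom 1 n - 1 = m * k" by auto
    have "ipoly (monom 1 n - 1) (z ^ q) = 0"
      using assms by (simp add: power_mult[symmetric] mult.commute[of q]) (simp add: power_mult)
    then have kq: "ipoly k (z ^ q) = 0" using nz k by simp
    obtain t where t: "k ^ q - pcompose k (monom 1 q) = [:int q:] * t"
      using poly_frobenius_dvd[OF assms(3), of k] by auto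
    have kt: "ipoly k z ^ q = of_nat q * ipoly t z"
      using arg_cong[OF t, of "\<lambda>p. ipoly p z"] kq by simp
    \<comment> \<open>Differentiating X^n - 1 = m * k at the root z of m ties n to k(z); this
      replaces separability modulo q.\<close>
    have "ipoly (pderiv (monom 1 n - 1)) z = ipoly (pderiv m) z * ipoly k z"
      unfolding k ipoly_pderiv_mult using m(1) by simp
    moreover have "ipoly (pderiv (monom 1 n - 1)) z = of_nat n * z ^ (n - 1)"
      by (simp add: pderiv_diff pderiv_monom)
    ultimately have "of_nat n * z ^ (n - 1) = ipoly (pderiv m) z * ipoly k z" by simp
    then have "z * (of_nat n * z ^ (n - 1)) = z * (ipoly (pderiv m) z * ipoly k z)" by (rule arg_cong)
    moreover have "z * (of_nat n * z ^ (n - 1)) = of_nat n * z ^ n"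
      using assms(1) by (cases n) auto
    ultimately have "of_nat n = z * ipoly (pderiv m) z * ipoly k z"
      using assms(2) by (metis mult.assoc mult.right_neutral)
    then have "of_nat n ^ q = (z * ipoly (pderiv m) z) ^ q * (of_nat q * ipoly t z)"
      by (metis kt power_mult_distrib)
    also have "\<dots> = ipoly ([:int q:] * ((monom 1 1 * pderiv m) ^ q * t)) z"
      by (simp add: power_mult_distrib)
    finally have w: "ipoly ([:int q:] * ((monom 1 1 * pderiv m) ^ q * t)) z = of_nat n ^ q" ..
    \<comment> \<open>The number n ^ q is q times the value of w at z. Reducing w modulo the monic m
      leaves w2 of smaller degree, so q * w2 - n ^ q vanishes at z and hence identically.\<close>
    define w where "w = (monom 1 1 * pderiv m) ^ q * t"
    have "m \<noteq> 0" using m(3) by auto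
    obtain w1 w2 where pd: "pseudo_divmod w m = (w1, w2)" by (metis surj_pair)
    have w12: "w = m * w1 + w2" "w2 = 0 \<or> degree w2 < degree m"
      using pseudo_divmod[OF \<open>m \<noteq> 0\<close> pd] m(2) by simp_all
    have "ipoly ([:int q:] * w2 - [:int n ^ q:]) z = 0"
      using w m(1) unfolding w_def[symmetric] w12(1) by simp
    then have "m dvd [:int q:] * w2 - [:int n ^ q:]" by (rule dvd)
    moreover have "degree ([:int q:] * w2 - [:int n ^ q:]) < degree m"
      using w12(2) m(3) by (intro degree_diff_less) auto
    ultimately have "[:int q:] * w2 - [:int n ^ q:] = 0"
      by (meson dvd_imp_degree_le leD)
    then have "[:int q:] * w2 = [:int n ^ q:]" by simp
    then have "[:int q:] dvd [:int n ^ q:]" by (metis dvd_triv_left)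
    then have "int q dvd int n ^ q" by (simp add: const_poly_dvd_const_poly_iff)
    then have "q dvd n ^ q" by (metis of_nat_dvd_iff of_nat_power)
    then show False using assms(3,4) prime_dvd_power by blast
  qed
  moreover obtain g where "h = m * g" using dvd[OF assms(5)] by auto
  ultimately show ?thesis by simp
qed

lemma ipoly_root_power:
  assumes "n > 0" "z ^ n = 1" "coprime r n" "r > 0" "ipoly h z = 0"
  shows "ipoly h (z ^ r) = 0"
  using assms(3,4)
proof (induction r rule: prime_divisors_induct)
  case (factor p x)
  then have x: "coprime x n" "x > 0" "\<not> p dvd n" "prime p"
    using prime_gt_1_nat by (auto simp: coprime_commute coprime_absorb_left)
  have "(z ^ x) ^ n = 1" using assms(2) by (metis mult.commute power_mult power_one)
  then show ?case
    using ipoly_root_power_prime[OF assms(1) _ x(4,3)] factor.IH x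
    by (metis mult.commute power_mult)
qed (use assms in auto)

section \<open>Galois conjugation and Fourier inversion on classes of k-th powers\<close>

section \<open>Splitting a relation along classes\<close>

lemma ipoly_sum_mset [simp]: "ipoly (\<Sum>i\<in>#M. p i) z = (\<Sum>i\<in>#M. ipoly (p i) z)"
  by (induction M) simp_all

lemma root_unity_cis_power:
  assumes "n > 0" "z ^ n = 1"
  shows "\<exists>k. z = cis (2 * pi / real n) ^ k"
proof -
  obtain k where "z = cis (2 * pi * real k / real n)"
    using bij_betw_roots_unity[OF assms(1)] assms(2) unfolding bij_betw_def by blast
  then show ?thesis by (intro exI[of _ k]) (simp add: DeMoivre mult_ac)
qed

text \<open>All terms are powers of \<open>cis (2 * pi / n)\<close>, so the relation is an integer
  polynomial vanishing there, and \<open>ipoly_root_power\<close> transports it.\<close>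

lemma galois_sum_mset:
  fixes A B :: "complex multiset"
  assumes n: "n > 0" and A: "\<And>z. z \<in># A \<Longrightarrow> z ^ n = 1" and B: "\<And>z. z \<in># B \<Longrightarrow> z ^ n = 1"
    and eq: "(\<Sum>z\<in>#A. z) = (\<Sum>z\<in>#B. z)" and r: "coprime r n" "r > 0"
  shows "(\<Sum>z\<in>#A. z ^ r) = (\<Sum>z\<in>#B. z ^ r)"
proof -
  define w where "w = cis (2 * pi / real n)"
  have w: "w ^ n = 1" using n by (simp add: w_def DeMoivre)
  define e where "e z = (SOME k. z = w ^ k)" for z
  have e: "w ^ e z = z" if "z ^ n = 1" for z
    using someI_ex[OF root_unity_cis_power[OF n that]] unfolding e_def w_def by simp
  define P where "P = (\<Sum>z\<in>#A. monom (1::int) (e z)) - (\<Sum>z\<in>#B. monom (1::int) (e z))"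
  have P: "ipoly P (w ^ k) = (\<Sum>z\<in>#A. z ^ k) - (\<Sum>z\<in>#B. z ^ k)" for k
  proof -
    have "(w ^ k) ^ e z = z ^ k" if "z ^ n = 1" for z
      using e[OF that] by (metis mult.commute power_mult)
    then have "image_mset (\<lambda>z. (w ^ k) ^ e z) A = image_mset (\<lambda>z. z ^ k) A"
      and "image_mset (\<lambda>z. (w ^ k) ^ e z) B = image_mset (\<lambda>z. z ^ k) B"
      using A B by (auto intro!: image_mset_cong)
    then show ?thesis unfolding P_def by simp
  qed
  have "ipoly P w = 0" using P[of 1] eq by simp
  then have "ipoly P (w ^ r) = 0" by (rule ipoly_root_power[OF n w r])
  then show ?thesis using P by simp
qed

lemma sum_powers_root_unity:
  fixes w :: complex
  assumes "w ^ p = 1"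
  shows "(\<Sum>t<p. w ^ t) = (if w = 1 then of_nat p else 0)"
  using assms by (auto simp: sum_gp_strict)

text \<open>For n = p * k the classes of n-th roots of unity are the cosets of the k-th roots of
  unity, labelled by the p-th roots of unity c.\<close>

definition csum :: "nat \<Rightarrow> complex \<Rightarrow> complex multiset \<Rightarrow> complex" where
  "csum k c A = (\<Sum>z\<in>#A. if z ^ k = c then z else 0)"

text \<open>Orthogonality of characters, applied to the p-th root of unity
  \<open>z ^ k / c\<close>.\<close>

lemma csum_fourier:
  assumes "\<And>z. z \<in># A \<Longrightarrow> (z ^ k) ^ p = 1" "c ^ p = 1" "p > 0"
  shows "of_nat p * csum k c A = (\<Sum>t<p. inverse c ^ t * (\<Sum>z\<in>#A. z ^ (1 + k * t)))"
  using assms(1)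
proof (induction A)
  case empty
  then show ?case by (simp add: csum_def)
next
  case (add z A)
  have c: "c \<noteq> 0" using assms by (auto simp: power_0_left)
  have "(\<Sum>t<p. inverse c ^ t * z ^ (1 + k * t)) = z * (\<Sum>t<p. (z ^ k / c) ^ t)"
  proof -
    have "inverse c ^ t * z ^ (1 + k * t) = z * (z ^ k / c) ^ t" for t
      by (simp add: power_mult power_mult_distrib divide_inverse)
    then show ?thesis unfolding sum_distrib_left by (intro sum.cong refl)
  qed
  also have "\<dots> = of_nat p * (if z ^ k = c then z else 0)"
    using c add.prems[of z] assms(2) sum_powers_root_unity[of "z ^ k / c" p]
    by (simp add: power_divide)
  finally show ?case
    using add by (simp add: csum_def distrib_left sum.distrib)
qed

text \<open>A prime factor of n other than p divides k and therefore not 1 + k * t.\<close>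

lemma coprime_one_plus_multiple:
  fixes n p k t :: nat
  assumes "n = p * k" "prime p" "\<not> p dvd 1 + k * t"
  shows "coprime (1 + k * t) n"
proof (rule ccontr)
  assume "\<not> coprime (1 + k * t) n"
  then have "gcd (1 + k * t) n \<noteq> 1" by (simp only: coprime_iff_gcd_eq_1 not_False_eq_True)
  from prime_factor_nat[OF this] obtain q where "prime q" "q dvd gcd (1 + k * t) n" by auto
  then have q: "prime q" "q dvd 1 + k * t" "q dvd n" by auto
  have "q \<noteq> p" using q(2) assms(3) by auto
  then have "\<not> q dvd p" using primes_dvd_imp_eq[of q p] q(1) assms(2) by auto
  then have "q dvd k" using prime_dvd_mult_iff[of q p k] q(1,3) assms(1) by simp
  then have "q dvd k * t" by simp
  with q(2) have "q dvd 1" by (simp only: dvd_add_left_iff)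
  then show False using q(1) by simp
qed

text \<open>When p divides k, every exponent 1 + k * t is coprime to n, so the Fourier expansions
  agree term by term.\<close>

lemma csum_eq_of_square_dvd:
  assumes n: "n = p * k" "n > 0" and p: "prime p" "p dvd k"
    and A: "\<And>z. z \<in># A \<Longrightarrow> z ^ n = 1" and B: "\<And>z. z \<in># B \<Longrightarrow> z ^ n = 1"
    and eq: "(\<Sum>z\<in>#A. z) = (\<Sum>z\<in>#B. z)" and c: "c ^ p = 1"
  shows "csum k c A = csum k c B"
proof -
  have p0: "p > 0" by (rule prime_gt_0_nat[OF p(1)])
  have cop: "coprime (1 + k * t) n" for t
  proof (rule coprime_one_plus_multiple[OF n(1) p(1)])
    show "\<not> p dvd 1 + k * t"
    proof
      assume "p dvd 1 + k * t"
      moreover have "p dvd k * t" using p(2) by simp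
      ultimately have "p dvd 1" by (simp only: dvd_add_left_iff)
      then show False using p(1) by simp
    qed
  qed
  have "(\<Sum>z\<in>#A. z ^ (1 + k * t)) = (\<Sum>z\<in>#B. z ^ (1 + k * t))" for t
    by (rule galois_sum_mset[OF n(2) A B eq cop]) auto
  moreover have "(z ^ k) ^ p = 1" if "z ^ n = 1" for z :: complex
    using that n(1) by (metis mult.commute power_mult)
  ultimately have "of_nat p * csum k c A = of_nat p * csum k c B"
    using A B c p0 by (simp add: csum_fourier)
  then show ?thesis using p0 by simp
qed

text \<open>Only one exponent \<open>1 + k * t\<close> with \<open>t < p\<close> is not coprime to \<open>n\<close>; by Fourier inversion
  it alone contributes to the class sums.\<close>

lemma csum_power_diff_const:
  assumes n: "n = p * k" "n > 0" and p: "prime p" "\<not> p dvd k"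
    and A: "\<And>z. z \<in># A \<Longrightarrow> z ^ n = 1" and B: "\<And>z. z \<in># B \<Longrightarrow> z ^ n = 1"
    and eq: "(\<Sum>z\<in>#A. z) = (\<Sum>z\<in>#B. z)"
  shows "\<exists>t S. p dvd 1 + k * t \<and>
    (\<forall>c. c ^ p = 1 \<longrightarrow> c ^ t * csum k c A - c ^ t * csum k c B = S)"
proof -
  have p0: "p > 0" by (rule prime_gt_0_nat[OF p(1)])
  have "coprime k p" using p prime_imp_coprime[of p k] by (simp add: coprime_commute)
  from cong_solve_coprime_nat[OF this] obtain y where "[k * y = 1] (mod p)" by auto
  \<comment> \<open>With y an inverse of k modulo p, x = (p - 1) * y solves k * x = -1 modulo p and
    locates the one exponent divisible by p.\<close>
  then have "[(p - 1) * (k * y) = (p - 1) * 1] (mod p)" by (rule cong_scalar_left)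
  moreover define x where "x = (p - 1) * y"
  ultimately have x: "[k * x = p - 1] (mod p)" by (simp add: mult_ac)
  have "[k * (x mod p) = k * x] (mod p)" by (simp add: cong_def mod_mult_right_eq)
  then have "[k * (x mod p) = p - 1] (mod p)" using x by (rule cong_trans)
  then have "[1 + k * (x mod p) = 1 + (p - 1)] (mod p)" by (simp only: cong_add_lcancel_nat)
  from cong_dvd_iff[OF this] have t: "p dvd 1 + k * (x mod p)" "x mod p < p" 
    using p0 by simp_all
  define t where "t = x mod p"
  note t = t[folded t_def]
  have kp: "(z ^ k) ^ p = 1" if "z ^ n = 1" for z :: complex
    using that n(1) by (metis mult.commute power_mult)
  have eqs: "(\<Sum>z\<in>#A. z ^ (1 + k * s)) = (\<Sum>z\<in>#B. z ^ (1 + k * s))" if "s < p" "s \<noteq> t" for s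
  proof (rule galois_sum_mset[OF n(2) A B eq])
    have "\<not> p dvd 1 + k * s"
    proof
      assume "p dvd 1 + k * s"
      then have "[1 + k * s = 0] (mod p)" "[1 + k * t = 0] (mod p)"
        using t(1) by (simp_all only: cong_0_iff)
      then have "[1 + k * s = 1 + k * t] (mod p)" by (metis cong_sym cong_trans)
      then have "[k * s = k * t] (mod p)" by (simp only: cong_add_lcancel_nat)
      then have "[s = t] (mod p)" using \<open>coprime k p\<close> by (simp add: cong_mult_lcancel_nat)
      then show False using that t(2) by (simp add: cong_def)
    qed
    then show "coprime (1 + k * s) n" using n(1) p by (intro coprime_one_plus_multiple) auto
  qed auto
  define T where "T = (\<Sum>z\<in>#A. z ^ (1 + k * t)) - (\<Sum>z\<in>#B. z ^ (1 + k * t))"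
  have "c ^ t * csum k c A - c ^ t * csum k c B = T / of_nat p" if c: "c ^ p = 1" for c
  proof -
    have c0: "c \<noteq> 0" using c p0 by (auto simp: power_0_left)
    have "of_nat p * csum k c A - of_nat p * csum k c B =
      (\<Sum>s<p. inverse c ^ s * ((\<Sum>z\<in>#A. z ^ (1 + k * s)) - (\<Sum>z\<in>#B. z ^ (1 + k * s))))"
      using A B kp c p0 by (simp add: csum_fourier sum_subtractf right_diff_distrib)
    also have "\<dots> = (\<Sum>s<p. if s = t then inverse c ^ t * T else 0)"
      using eqs by (intro sum.cong) (auto simp: T_def)
    also have "\<dots> = inverse c ^ t * T" using t(2) by simp
    finally have "c ^ t * (of_nat p * csum k c A - of_nat p * csum k c B) = c ^ t * (inverse c ^ t * T)"
      by (rule arg_cong)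
    also have "\<dots> = T" using c0 by (simp add: power_inverse)
    finally have "of_nat p * (c ^ t * csum k c A - c ^ t * csum k c B) = T"
      by (simp add: algebra_simps)
    then show ?thesis using p0 by (simp add: field_simps)
  qed
  with t(1) show ?thesis by blast
qed

text \<open>At the unoccupied class e both sums are 0, so the constant of
  \<open>csum_power_diff_const\<close> is 0.\<close>

lemma csum_eq_of_empty_class:
  assumes n: "n = p * k" "n > 0" and p: "prime p"
    and A: "\<And>z. z \<in># A \<Longrightarrow> z ^ n = 1" and B: "\<And>z. z \<in># B \<Longrightarrow> z ^ n = 1"
    and eq: "(\<Sum>z\<in>#A. z) = (\<Sum>z\<in>#B. z)" and c: "c ^ p = 1"
    and e: "e ^ p = 1" "e \<notin># image_mset (\<lambda>z. z ^ k) (A + B)"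
  shows "csum k c A = csum k c B"
proof (cases "p dvd k")
  case True
  then show ?thesis using csum_eq_of_square_dvd[OF n p _ A B eq c] by blast
next
  case False
  obtain t S where S: "\<forall>c. c ^ p = 1 \<longrightarrow> c ^ t * csum k c A - c ^ t * csum k c B = S"
    using csum_power_diff_const[OF n p False A B eq] by auto
  have "csum k e M = 0" if "e \<notin># image_mset (\<lambda>z. z ^ k) M" for M
    using that by (induction M) (auto simp: csum_def)
  then have "S = 0" using S[rule_format, OF e(1)] e(2) by auto
  moreover have "c \<noteq> 0" using c prime_gt_0_nat[OF p] by (auto simp: power_0_left)
  ultimately show ?thesis using S[rule_format, OF c] by simp
qed

section \<open>Symmetries of a sextuple and the sums that determine it\<close>

section \<open>Sextuples of roots of unity closed under conjugation\<close>

definition six :: "complex \<Rightarrow> complex \<Rightarrow> complex \<Rightarrow> complex multiset" where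
  "six x y z = {#x, y, z, cnj x, cnj y, cnj z#}"

lemma six_swap12: "six x y z = six y x z"
  and six_swap23: "six x y z = six x z y"
  and six_swap13: "six x y z = six z y x"
  and six_cnj: "six (cnj x) (cnj y) (cnj z) = six x y z"
  by (simp_all add: six_def)

definition unit_triple :: "complex \<Rightarrow> complex \<Rightarrow> complex \<Rightarrow> bool" where
  "unit_triple x y z \<longleftrightarrow> x * cnj x = 1 \<and> y * cnj y = 1 \<and> z * cnj z = 1 \<and> x * y * z = 1"

lemma tri_swap12: "unit_triple x y z \<Longrightarrow> unit_triple y x z"
  and tri_swap23: "unit_triple x y z \<Longrightarrow> unit_triple x z y"
  and tri_swap13: "unit_triple x y z \<Longrightarrow> unit_triple z y x"
  by (simp_all add: unit_triple_def mult_ac)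

lemma tri_cnj: "unit_triple x y z \<Longrightarrow> unit_triple (cnj x) (cnj y) (cnj z)"
  unfolding unit_triple_def by (metis complex_cnj_cnj complex_cnj_mult complex_cnj_one mult.commute)

text \<open>When s = x + y is nonzero, the product is s / cnj s, so the sum alone determines a pair
  on the unit circle.\<close>

lemma unit_sum_prod:
  assumes "x * cnj x = 1" "y * cnj y = 1"
  shows "x * y * cnj (x + y) = x + y"
proof -
  have "x * y * cnj (x + y) = (x * cnj x) * y + (y * cnj y) * x" by (simp add: algebra_simps)
  then show ?thesis using assms by (simp add: add.commute)
qed

lemma pair_eqI:
  fixes x y x' y' :: "'a :: idom"
  assumes "x + y = x' + y'" "x * y = x' * y'"
  shows "{#x, y#} = {#x', y'#}"
proof -
  have "(x - x') * (x - y') = x * (x + y - (x' + y')) + (x' * y' - x * y)"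
    by (simp add: algebra_simps)
  then have "x = x' \<or> x = y'" using assms by auto
  then show ?thesis using assms(1) by (auto simp: add_mset_commute)
qed

lemma unit_pair_eqI:
  assumes "x * cnj x = 1" "y * cnj y = 1" "x' * cnj x' = 1" "y' * cnj y' = 1"
    and eq: "x + y = x' + y'" and "x + y \<noteq> 0"
  shows "{#x, y#} = {#x', y'#}"
proof (rule pair_eqI[OF eq])
  have "x * y * cnj (x + y) = x' * y' * cnj (x + y)"
    using unit_sum_prod[of x y] unit_sum_prod[of x' y'] assms by simp
  moreover have "cnj (x + y) \<noteq> 0" using assms(6) by (metis complex_cnj_zero_iff)
  ultimately show "x * y = x' * y'" by simp
qed

lemma cnj_pair_eqI:
  assumes "x * cnj x = 1" "x' * cnj x' = 1" "x + cnj x = x' + cnj x'"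
  shows "{#x, cnj x#} = {#x', cnj x'#}"
  using assms by (intro pair_eqI) simp_all

text \<open>The second symmetric function is the conjugate of the sum and the product is 1, so both
  triples are the roots of the same cubic.\<close>

lemma unit_triple_eqI:
  assumes t: "unit_triple x y z" "unit_triple x' y' z'" and eq: "x + y + z = x' + y' + z'"
  shows "{#x, y, z#} = {#x', y', z'#}"
proof -
  have e2: "x * y + y * z + x * z = cnj (x + y + z)" if "unit_triple x y z" for x y z
  proof -
    have u: "x * cnj x = 1" "y * cnj y = 1" "z * cnj z = 1" and p: "x * y * z = 1"
      using that by (auto simp: unit_triple_def)
    have "cnj x = (x * y * z) * cnj x" "cnj y = (x * y * z) * cnj y" "cnj z = (x * y * z) * cnj z"
      using p by simp_all
    then have "cnj x = (x * cnj x) * (y * z)" "cnj y = (y * cnj y) * (x * z)" "cnj z = (z * cnj z) * (x * y)"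
      by (simp_all only: mult_ac)
    then show ?thesis using u by simp
  qed
  define s where "s = x + y + z"
  have rt: "w ^ 3 - s * w ^ 2 + cnj s * w - 1 = (w - x) * (w - y) * (w - z)" for w
  proof -
    have "(w - x) * (w - y) * (w - z) = w ^ 3 - (x + y + z) * w ^ 2 + (x * y + y * z + x * z) * w - x * y * z"
      by (simp add: algebra_simps power2_eq_square power3_eq_cube)
    then show ?thesis using e2[OF t(1)] t(1) by (simp add: s_def unit_triple_def)
  qed
  have rt': "w ^ 3 - s * w ^ 2 + cnj s * w - 1 = (w - x') * (w - y') * (w - z')" for w
  proof -
    have "(w - x') * (w - y') * (w - z') = w ^ 3 - (x' + y' + z') * w ^ 2 + (x' * y' + y' * z' + x' * z') * w - x' * y' * z'"
      by (simp add: algebra_simps power2_eq_square power3_eq_cube)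
    then show ?thesis using e2[OF t(2)] t(2) eq by (simp add: s_def unit_triple_def)
  qed
  have "(x' - x) * (x' - y) * (x' - z) = 0" using rt[of x'] rt'[of x'] by simp
  then have "x' = x \<or> x' = y \<or> x' = z" by auto
  moreover have "{#x, y, z#} = {#x', y', z'#}" if "x = x'" "unit_triple x y z" "x + y + z = x' + y' + z'" for x y z
  proof -
    have "y + z = y' + z'" using that by simp
    moreover have "x * (y * z) = x * (y' * z')" "x \<noteq> 0"
      using that(1,2) t(2) by (auto simp: unit_triple_def mult.assoc)
    then have "y * z = y' * z'" by simp
    ultimately show ?thesis using that(1) pair_eqI[of y z y' z'] by simp
  qed
  note * = this
  ultimately show ?thesis
  proof (elim disjE)
    assume "x' = x"
    then show ?thesis using *[of x y z] t(1) eq by simp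
  next
    assume "x' = y"
    then have "{#y, x, z#} = {#x', y', z'#}"
      using *[of y x z] tri_swap12[OF t(1)] eq by (simp add: add_ac)
    then show ?thesis by (metis add_mset_commute)
  next
    assume "x' = z"
    then have "{#z, y, x#} = {#x', y', z'#}"
      using *[of z y x] tri_swap13[OF t(1)] eq by (simp add: add_ac)
    then show ?thesis by (metis add_mset_commute)
  qed
qed

lemma six_eq_of_triple_eq:
  assumes "{#x, y, z#} = {#x', y', z'#}"
  shows "six x y z = six x' y' z'"
proof -
  have "six x y z = {#x, y, z#} + image_mset cnj {#x, y, z#}" for x y z
    by (simp add: six_def)
  then show ?thesis by (simp only: assms)
qed

text \<open>This grouping is the one seen by class sums when x lies in the trivial class: y and cnj
  z then share a class.\<close>

lemma six_eq_of_pairs_eq: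
  assumes "{#x, cnj x#} = {#x', cnj x'#}" "{#y, cnj z#} = {#y', cnj z'#}"
  shows "six x y z = six x' y' z'"
proof -
  have "six x y z = {#x, cnj x#} + {#y, cnj z#} + image_mset cnj {#y, cnj z#}" for x y z
    by (simp add: six_def)
  then show ?thesis by (simp only: assms)
qed

text \<open>Excluded are the triples whose sextuple has sum \<open>-2\<close> or a sum of only two terms.\<close>

definition generic :: "complex \<Rightarrow> complex \<Rightarrow> complex \<Rightarrow> bool" where
  "generic x y z \<longleftrightarrow> x \<noteq> -1 \<and> y \<noteq> -1 \<and> z \<noteq> -1 \<and> x + y \<noteq> 0 \<and> y + z \<noteq> 0 \<and> x + z \<noteq> 0"

lemma generic_swap12: "generic x y z \<Longrightarrow> generic y x z"
  and generic_swap23: "generic x y z \<Longrightarrow> generic x z y"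
  and generic_swap13: "generic x y z \<Longrightarrow> generic z y x"
  by (auto simp: generic_def add_ac)

text \<open>Since cnj z = x * y. The left side occurs as a class sum, and it can vanish only for x =
  -1.\<close>

lemma tri_add_cnj:
  assumes "unit_triple x y z"
  shows "y + cnj z = y * (1 + x)"
proof -
  have "cnj z = (x * y * z) * cnj z" using assms by (simp add: unit_triple_def)
  also have "\<dots> = x * y * (z * cnj z)" by (simp add: mult_ac)
  also have "\<dots> = x * y" using assms by (simp add: unit_triple_def)
  finally have "cnj z = x * y" .
  then show ?thesis using assms by (simp add: unit_triple_def algebra_simps)
qed

lemma generic_add_cnj:
  assumes "unit_triple x y z" "generic x y z"
  shows "y + cnj z \<noteq> 0"
  using assms tri_add_cnj[OF assms(1)]
  by (auto simp: generic_def unit_triple_def add_eq_0_iff)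

lemma unit_power_cnj:
  assumes "x * cnj x = 1"
  shows "cnj x ^ k = inverse (x ^ k)"
proof -
  have "x ^ k * cnj x ^ k = 1" using assms by (metis power_mult_distrib power_one)
  then show ?thesis by (metis inverse_unique)
qed

lemma csum_six:
  assumes "unit_triple x y z"
  shows "csum k c (six x y z) =
    (if x ^ k = c then x else 0) + (if y ^ k = c then y else 0) + (if z ^ k = c then z else 0) +
    (if inverse (x ^ k) = c then cnj x else 0) + (if inverse (y ^ k) = c then cnj y else 0) +
    (if inverse (z ^ k) = c then cnj z else 0)"
  using assms by (simp add: csum_def six_def unit_triple_def unit_power_cnj add_ac)

lemma csum_six_nonzero:
  assumes "unit_triple x y z" "csum k c (six x y z) \<noteq> 0"
  shows "x ^ k = c \<or> y ^ k = c \<or> z ^ k = c \<or> inverse (x ^ k) = c \<or> inverse (y ^ k) = c \<or> inverse (z ^ k) = c"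
  using assms by (auto simp: csum_six split: if_splits)

text \<open>Permutations and simultaneous conjugation preserve the sextuple and bring any of its six
  elements to the first place.\<close>

lemma six_class_wlog:
  assumes "unit_triple x y z" "csum k c (six x y z) \<noteq> 0"
  obtains x' y' z' where "unit_triple x' y' z'" "six x' y' z' = six x y z" "x' ^ k = c"
proof -
  have t: "unit_triple x y z" "unit_triple y x z" "unit_triple z y x" "unit_triple (cnj x) (cnj y) (cnj z)"
    "unit_triple (cnj y) (cnj x) (cnj z)" "unit_triple (cnj z) (cnj y) (cnj x)"
    using assms(1) by (auto intro: tri_cnj tri_swap12 tri_swap13)
  have s: "six y x z = six x y z" "six z y x = six x y z" "six (cnj x) (cnj y) (cnj z) = six x y z"
    "six (cnj y) (cnj x) (cnj z) = six x y z" "six (cnj z) (cnj y) (cnj x) = six x y z"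
    by (simp_all add: six_def)
  have c: "cnj x ^ k = inverse (x ^ k)" "cnj y ^ k = inverse (y ^ k)" "cnj z ^ k = inverse (z ^ k)"
    using assms(1) by (simp_all add: unit_triple_def unit_power_cnj)
  from csum_six_nonzero[OF assms] show ?thesis
  proof (elim disjE)
    assume "x ^ k = c" then show ?thesis by (rule that[OF t(1) refl])
  next
    assume "y ^ k = c" then show ?thesis by (rule that[OF t(2) s(1)])
  next
    assume "z ^ k = c" then show ?thesis by (rule that[OF t(3) s(2)])
  next
    assume "inverse (x ^ k) = c" then show ?thesis using that[OF t(4) s(3)] c by simp
  next
    assume "inverse (y ^ k) = c" then show ?thesis using that[OF t(5) s(4)] c by simp
  next
    assume "inverse (z ^ k) = c" then show ?thesis using that[OF t(6) s(5)] c by simp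
  qed
qed

section \<open>Equal class sums force equal sextuples: primes p >= 5\<close>

section \<open>Classes modulo a prime at least 5\<close>

lemma tri_class: "unit_triple x y z \<Longrightarrow> x ^ k * y ^ k * z ^ k = 1"
  unfolding unit_triple_def by (metis power_mult_distrib power_one)

lemma prod_one_inverse_ne:
  fixes a b c :: complex
  assumes "a * b * c = 1" "c \<noteq> 1"
  shows "inverse a \<noteq> b" "a \<noteq> inverse b"
proof -
  have "a \<noteq> 0" "b \<noteq> 0" using assms(1) by auto
  then show "inverse a \<noteq> b" "a \<noteq> inverse b" using assms by auto
qed

lemma root_unity_coprime:
  fixes w :: complex
  assumes "w ^ p = 1" "w ^ j = 1" "coprime p j" "p > 0"
  shows "w = 1"
proof -
  obtain a b where "p * a = j * b + 1"
    using bezout_nat[of p j] assms(3,4) by (auto simp: coprime_iff_gcd_eq_1[symmetric])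
  then have "w ^ (p * a) = w ^ (j * b) * w" by simp
  then show ?thesis using assms by (simp add: power_mult)
qed

text \<open>With the orders 1 to 4 excluded, 1, e, e^2 and their inverses are pairwise distinct.
  Both orientations are listed so that the conditions in \<open>csum_six\<close> can be decided
  however they are written.\<close>

lemma distinct_powers:
  fixes e :: complex
  assumes "e \<noteq> 0" "e \<noteq> 1" "e ^ 2 \<noteq> 1" "e ^ 3 \<noteq> 1" "e ^ 4 \<noteq> 1"
  shows "1 \<noteq> e" "inverse e \<noteq> 1" "1 \<noteq> inverse e" "inverse e \<noteq> e" "e \<noteq> inverse e"
    "1 \<noteq> e ^ 2" "inverse (e ^ 2) \<noteq> 1" "1 \<noteq> inverse (e ^ 2)"
    "e ^ 2 \<noteq> e" "e \<noteq> e ^ 2" "e ^ 2 \<noteq> inverse e" "inverse e \<noteq> e ^ 2"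
    "inverse (e ^ 2) \<noteq> e" "e \<noteq> inverse (e ^ 2)" "inverse (e ^ 2) \<noteq> inverse e" "inverse e \<noteq> inverse (e ^ 2)"
    "inverse (e ^ 2) \<noteq> e ^ 2" "e ^ 2 \<noteq> inverse (e ^ 2)"
proof -
  have "inverse e = e \<Longrightarrow> e ^ 2 = 1" "inverse (e ^ 2) = e ^ 2 \<Longrightarrow> e ^ 4 = 1"
    "e ^ 2 = e \<Longrightarrow> e = 1" "e ^ 2 = inverse e \<Longrightarrow> e ^ 3 = 1" "inverse e = e ^ 2 \<Longrightarrow> e ^ 3 = 1"
    "inverse (e ^ 2) = e \<Longrightarrow> e ^ 3 = 1" "e = inverse (e ^ 2) \<Longrightarrow> e ^ 3 = 1"
    using assms(1) by (auto simp: field_simps eval_nat_numeral)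
  then show "1 \<noteq> e" "inverse e \<noteq> 1" "1 \<noteq> inverse e" "inverse e \<noteq> e" "e \<noteq> inverse e"
    "1 \<noteq> e ^ 2" "inverse (e ^ 2) \<noteq> 1" "1 \<noteq> inverse (e ^ 2)"
    "e ^ 2 \<noteq> e" "e \<noteq> e ^ 2" "e ^ 2 \<noteq> inverse e" "inverse e \<noteq> e ^ 2"
    "inverse (e ^ 2) \<noteq> e" "e \<noteq> inverse (e ^ 2)" "inverse (e ^ 2) \<noteq> inverse e" "inverse e \<noteq> inverse (e ^ 2)"
    "inverse (e ^ 2) \<noteq> e ^ 2" "e ^ 2 \<noteq> inverse (e ^ 2)"
    using assms by (auto simp: eq_commute[of 1] inverse_eq_1_iff)
qed

text \<open>Class 1 contributes x + cnj x and class b contributes y + cnj z. The first sum always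
  determines its pair; the second does because it is nonzero for a generic triple.\<close>

lemma six_eq_split_pattern:
  assumes t: "unit_triple x y z" "unit_triple x' y' z'" and g: "generic x y z"
    and S: "\<And>c. csum k c (six x y z) = csum k c (six x' y' z')"
    and cl: "x ^ k = 1" "y ^ k = b" "x' ^ k = 1" "y' ^ k = b" and b: "b \<noteq> 1" "b ^ 2 \<noteq> 1"
  shows "six x y z = six x' y' z'"
proof -
  have b0: "b \<noteq> 0" using t(1) cl by (auto simp: unit_triple_def)
  have z: "z ^ k = inverse b" "z' ^ k = inverse b"
    using tri_class[OF t(1), of k] tri_class[OF t(2), of k] cl b0 by (auto simp: field_simps)
  have ne: "inverse b \<noteq> b" "b \<noteq> inverse b" "1 \<noteq> b" "inverse b \<noteq> 1" "1 \<noteq> inverse b"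
    using b b0 by (auto simp: field_simps power2_eq_square)
  have "x + cnj x = x' + cnj x'" using S[of 1] t cl z ne b by (simp add: csum_six)
  moreover have "y + cnj z = y' + cnj z'" using S[of b] t cl z ne b by (simp add: csum_six)
  ultimately show ?thesis using t generic_add_cnj[OF t(1) g]
    by (intro six_eq_of_pairs_eq cnj_pair_eqI unit_pair_eqI) (auto simp: unit_triple_def mult.commute)
qed

text \<open>\<open>p5\<close> reflects 25 dividing n in the case p = 5; it excludes a coincidence
  met in \<open>six_eq_D\<close>. Only the left triple is generic, since the right one will be an
  arbitrary power of a given triple.\<close>

locale class_sums5 =
  fixes p k :: nat and x y z x' y' z' :: complex
  assumes t: "unit_triple x y z" and t': "unit_triple x' y' z'" and g: "generic x y z"
    and S: "\<And>c. csum k c (six x y z) = csum k c (six x' y' z')"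
    and p: "prime p" "p \<ge> 5"
    and p5: "\<And>w::complex. w ^ 5 = 1 \<Longrightarrow> p = 5 \<Longrightarrow> w ^ k = 1"
    and roots: "\<And>w. w \<in># six x y z + six x' y' z' \<Longrightarrow> (w ^ k) ^ p = 1"
begin

lemma root_ne_1:
  fixes w :: complex
  assumes "w ^ p = 1" "w \<noteq> 1"
  shows "w \<noteq> 0" "w ^ 2 \<noteq> 1" "w ^ 3 \<noteq> 1" "w ^ 4 \<noteq> 1" "w ^ 6 \<noteq> 1"
proof -
  have p0: "p > 0" using p by simp
  then show "w \<noteq> 0" using assms by (auto simp: power_0_left)
  have c2: "coprime p 2" and c3: "coprime p 3"
    using p primes_coprime[OF p(1), of 2] primes_coprime[OF p(1), of 3] by auto
  then have "coprime p (2 ^ 2)" "coprime p (2 * 3)"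
    by (simp_all only: coprime_power_right_iff coprime_mult_right_iff simp_thms)
  then have "coprime p 4" "coprime p 6" by simp_all
  then show "w ^ 2 \<noteq> 1" "w ^ 3 \<noteq> 1" "w ^ 4 \<noteq> 1" "w ^ 6 \<noteq> 1"
    using root_unity_coprime[OF assms(1) _ _ p0] assms(2) c2 c3 by blast+
qed

lemma class_roots:
  "(x ^ k) ^ p = 1" "(y ^ k) ^ p = 1" "(z ^ k) ^ p = 1"
  "(x' ^ k) ^ p = 1" "(y' ^ k) ^ p = 1" "(z' ^ k) ^ p = 1"
  by (rule roots, simp add: six_def)+

lemma change_right:
  assumes "unit_triple u v w" "six u v w = six x' y' z'"
  shows "class_sums5 p k x y z u v w"
proof
  show "(s ^ k) ^ p = 1" if "s \<in># six x y z + six u v w" for s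
    using roots[of s] that assms(2) by simp
  show "csum k c (six x y z) = csum k c (six u v w)" for c using S assms(2) by simp
qed (use assms t g p p5 in auto)

lemma change_left:
  assumes "unit_triple u v w" "six u v w = six x y z" "generic u v w"
  shows "class_sums5 p k u v w x' y' z'"
proof
  show "(s ^ k) ^ p = 1" if "s \<in># six u v w + six x' y' z'" for s
    using roots[of s] that assms(2) by simp
  show "csum k c (six u v w) = csum k c (six x' y' z')" for c using S assms(2) by simp
qed (use assms t' p p5 in auto)

text \<open>The left classes are 1, b, 1/b and the right ones e, b, f with e * b * f = 1. Unless e
  or f is 1, some class sum equates a lone element of modulus 1 with 0 or with a number of modulus
  sqrt 2.\<close>

lemma six_eq_Z:
  assumes cl: "x ^ k = 1" "y ^ k \<noteq> 1" "y' ^ k = y ^ k"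
  shows "six x y z = six x' y' z'"
proof -
  define b where "b = y ^ k"
  have b: "b \<noteq> 1" "b \<noteq> 0" "b ^ 2 \<noteq> 1" "b ^ 3 \<noteq> 1" "b ^ 4 \<noteq> 1"
    using root_ne_1[OF class_roots(2) cl(2)] cl(2) by (simp_all add: b_def)
  define e f where "e = x' ^ k" and "f = z' ^ k"
  have efb: "e * b * f = 1" using tri_class[OF t', of k] cl by (simp add: e_def f_def b_def)
  have zb: "z ^ k = inverse b"
    using tri_class[OF t, of k] cl b by (auto simp: field_simps b_def)
  have e0: "e \<noteq> 0" "f \<noteq> 0" using efb by auto
  have cl': "x ^ k = 1" "y ^ k = b" "z ^ k = inverse b" "x' ^ k = e" "y' ^ k = b" "z' ^ k = f"
    using cl zb by (simp_all add: b_def e_def f_def)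
  note ne = distinct_powers[OF b(2,1,3-5)]
  consider "e = 1" | "f = 1" | "e = f" "e \<noteq> 1" | "e \<noteq> f" "e \<noteq> 1" "f \<noteq> 1" by auto
  then show ?thesis
  proof cases
    case 1
    then show ?thesis using six_eq_split_pattern[OF t t' g S, of b] cl' b by simp
  next
    case 2
    then show ?thesis
      using six_eq_split_pattern[OF t tri_swap13[OF t'] g, of k b] S cl' b
      by (simp add: six_swap13[of z' y' x'])
  next
    case 3
    have ee: "e \<noteq> 1" "e \<noteq> 0" "e ^ 2 \<noteq> 1" "e ^ 3 \<noteq> 1" "e ^ 4 \<noteq> 1"
      using root_ne_1[of e] class_roots(4) 3 e0 by (simp_all add: e_def)
    note ne' = distinct_powers[OF ee(2,1,3-5)]
    have be: "b = inverse (e ^ 2)" using efb 3 e0 by (auto simp: field_simps power2_eq_square)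
    have "x' + z' = 0" using S[of e] 3 cl' ne' be ee by (simp add: csum_six[OF t] csum_six[OF t'])
    have "x + cnj x = 0" using S[of 1] 3 cl' ne ne' b ee be by (simp add: csum_six[OF t] csum_six[OF t'])
    have yz: "y + cnj z = y'"
      using S[of b] 3 cl' ne ne' b ee be by (simp add: csum_six[OF t] csum_six[OF t'])
    \<comment> \<open>The trivial class is empty on the right, so x + cnj x = 0 and y + cnj z = y *
      (1 + x) has squared modulus 2, whereas y' has modulus 1.\<close>
    have "(y * (1 + x)) * cnj (y * (1 + x)) = (y * cnj y) * (1 + (x + cnj x) + x * cnj x)"
      by (simp add: algebra_simps)
    also have "\<dots> = 2" using t \<open>x + cnj x = 0\<close> by (simp add: unit_triple_def)
    finally have "(y + cnj z) * cnj (y + cnj z) = 2" by (simp only: tri_add_cnj[OF t])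
    then have "y' * cnj y' = 2" by (simp only: yz)
    then show ?thesis using t' by (simp add: unit_triple_def)
  next
    case 4
    have nb: "e \<noteq> inverse b" "f \<noteq> inverse b"
      using prod_one_inverse_ne[of e b f] prod_one_inverse_ne[of f b e] efb 4 by (auto simp: mult_ac)
    have ee: "e ^ 2 \<noteq> 1" "f ^ 2 \<noteq> 1"
      using root_ne_1[of e] root_ne_1[of f] class_roots(4,6) 4 by (simp_all add: e_def f_def)
    have ne': "inverse e \<noteq> e" "inverse f \<noteq> f" using ee e0 by (auto simp: field_simps power2_eq_square)
    have nf: "inverse f \<noteq> e" "inverse e \<noteq> f" using efb b e0 by (auto simp: field_simps)
    \<comment> \<open>If e differs from b, class e is empty on the left and holds only x' on the
      right; likewise f and z'. As e and f differ, one of them differs from b.\<close>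
    have "x' = 0" if "e \<noteq> b"
      using S[of e] 4 cl' nb ne' nf that by (auto simp: csum_six[OF t] csum_six[OF t'])
    moreover have "z' = 0" if "f \<noteq> b"
      using S[of f] 4 cl' nb ne' nf that by (auto simp: csum_six[OF t] csum_six[OF t'])
    moreover have "x' \<noteq> 0" "z' \<noteq> 0" using t' by (auto simp: unit_triple_def)
    ultimately show ?thesis using 4(1) by blast
  qed
qed

text \<open>The left classes are a, a, a^-2. If y' has class a^-2, then z' has class a and the sums
  suffice. If y' has class a^2, then z' has class a^-3, alone there unless a^5 = 1; in that case p =
  5 and the sums force z^5 = 1, so by \<open>p5\<close> the class of z would be trivial.\<close>

lemma six_eq_D:
  assumes cl: "x ^ k \<noteq> 1" "y ^ k = x ^ k" "x' ^ k = x ^ k" "y' ^ k = z ^ k \<or> y' ^ k = inverse (z ^ k)"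
  shows "six x y z = six x' y' z'"
proof -
  define a where "a = x ^ k"
  have a: "a \<noteq> 1" "a \<noteq> 0" "a ^ 2 \<noteq> 1" "a ^ 3 \<noteq> 1" "a ^ 4 \<noteq> 1" "a ^ 6 \<noteq> 1"
    using root_ne_1[OF class_roots(1) cl(1)] cl(1) by (simp_all add: a_def)
  note ne = distinct_powers[OF a(2,1,3-5)]
  have z: "z ^ k = inverse (a ^ 2)"
    using tri_class[OF t, of k] cl a by (auto simp: field_simps a_def power2_eq_square)
  from cl(4) show ?thesis
  proof
    assume "y' ^ k = z ^ k"
    then have y': "y' ^ k = inverse (a ^ 2)" using z by simp
    then have z': "z' ^ k = a"
      using tri_class[OF t', of k] cl a by (auto simp: field_simps a_def power2_eq_square)
    have cl': "x ^ k = a" "y ^ k = a" "x' ^ k = a" using cl by (simp_all add: a_def)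
    have s1: "x + y = x' + z'"
      using S[of a] cl' y' z' z ne by (simp add: csum_six[OF t] csum_six[OF t'])
    have s2: "z = y'"
      using S[of "inverse (a ^ 2)"] cl' y' z' z ne by (simp add: csum_six[OF t] csum_six[OF t'])
    have "{#x, y#} = {#x', z'#}"
      using t t' s1 g by (intro unit_pair_eqI) (auto simp: unit_triple_def generic_def)
    moreover have "{#x, y, z#} = {#x, y#} + {#z#}" "{#x', z', y'#} = {#x', z'#} + {#y'#}" by simp_all
    ultimately have "{#x, y, z#} = {#x', z', y'#}" using s2 by (simp only:)
    then have "six x y z = six x' z' y'" by (rule six_eq_of_triple_eq)
    then show ?thesis by (simp only: six_swap23[of x' z' y'])
  next
    assume "y' ^ k = inverse (z ^ k)"
    then have y': "y' ^ k = a ^ 2" using z by simp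
    then have z': "z' ^ k = inverse (a ^ 3)"
      using tri_class[OF t', of k] cl a by (auto simp: field_simps a_def eval_nat_numeral)
    have cl': "x ^ k = a" "y ^ k = a" "x' ^ k = a" using cl by (simp_all add: a_def)
    show ?thesis
    proof (cases "a ^ 5 = 1")
      case True
      have "p = 5"
      proof (rule ccontr)
        assume "p \<noteq> 5"
        then have "coprime p 5" using primes_coprime[OF p(1), of 5] by simp
        then show False using root_unity_coprime[OF class_roots(1), of 5] True a(1) p(2)
          by (simp add: a_def)
      qed
      have "inverse (a ^ 3) = a ^ 2" using True a(2) by (simp add: field_simps eval_nat_numeral)
      then have z': "z' ^ k = a ^ 2" using z' by simp
      have s1: "x + y = x'"
        using S[of a] cl' y' z' z ne by (simp add: csum_six[OF t] csum_six[OF t'])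
      have s2: "cnj z = y' + z'"
        using S[of "a ^ 2"] cl' y' z' z ne by (simp add: csum_six[OF t] csum_six[OF t'])
      \<comment> \<open>\<open>unit_sum_prod\<close> turns x + y = x' and cnj z = y' + z' into
        product relations; with both products equal to 1 they give x' * z * x' = 1 and z * z =
        x'.\<close>
      have xy: "x * y * cnj x' = x'" using unit_sum_prod[of x y] t s1 by (simp add: unit_triple_def)
      have yz: "y' * z' * z = cnj z" using unit_sum_prod[of y' z'] t' s2[symmetric] by (simp add: unit_triple_def)
      have u: "x * y * z = 1" "z * cnj z = 1" "x' * y' * z' = 1" "x' * cnj x' = 1"
        using t t' by (auto simp: unit_triple_def)
      have "x' * z * x' = 1"
      proof -
        have "x' * z * x' = (x * y * cnj x') * z * x'" using xy by simp
        also have "\<dots> = (x * y * z) * (x' * cnj x')" by (simp only: mult_ac)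
        finally show ?thesis using u by simp
      qed
      moreover have "z * z = x'"
      proof -
        have "z * z = z * z * (x' * y' * z')" using u by simp
        also have "\<dots> = z * x' * (y' * z' * z)" by (simp only: mult_ac)
        also have "\<dots> = x' * (z * cnj z)" using yz by (simp add: mult_ac)
        finally show ?thesis using u by simp
      qed
      ultimately have "(z * z) * z * (z * z) = 1" by simp
      then have "z ^ 5 = 1" by (simp add: eval_nat_numeral mult.assoc)
      then have "z ^ k = 1" using p5 \<open>p = 5\<close> by blast
      then show ?thesis using z ne by simp
    next
      case False
      have "inverse (a ^ 3) \<noteq> a" "inverse (a ^ 3) \<noteq> inverse a" "inverse (a ^ 3) \<noteq> a ^ 2"
        "inverse (a ^ 3) \<noteq> inverse (a ^ 2)" "a ^ 3 \<noteq> inverse (a ^ 3)"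
      proof -
        have "inverse (a ^ 3) = a \<Longrightarrow> a ^ 4 = 1" "inverse (a ^ 3) = inverse a \<Longrightarrow> a ^ 2 = 1"
          "inverse (a ^ 3) = a ^ 2 \<Longrightarrow> a ^ 5 = 1" "inverse (a ^ 3) = inverse (a ^ 2) \<Longrightarrow> a = 1"
          "a ^ 3 = inverse (a ^ 3) \<Longrightarrow> a ^ 6 = 1"
          using a(2) by (auto simp: field_simps eval_nat_numeral)
        then show "inverse (a ^ 3) \<noteq> a" "inverse (a ^ 3) \<noteq> inverse a" "inverse (a ^ 3) \<noteq> a ^ 2"
          "inverse (a ^ 3) \<noteq> inverse (a ^ 2)" "a ^ 3 \<noteq> inverse (a ^ 3)"
          using a False by metis+
      qed
      note ne3 = this this[symmetric]
      have "z' = 0"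
        using S[of "inverse (a ^ 3)"] cl' y' z' z ne3 by (simp add: csum_six[OF t] csum_six[OF t'])
      then show ?thesis using t' by (simp add: unit_triple_def)
    qed
  qed
qed

text \<open>The classes of x, y, z and their inverses are six distinct ones, so each class sum is a
  single element and identifies its counterpart up to conjugation.\<close>

lemma six_eq_distinct:
  assumes cl: "x ^ k \<noteq> 1" "y ^ k \<noteq> 1" "z ^ k \<noteq> 1" "x ^ k \<noteq> y ^ k" "x ^ k \<noteq> z ^ k" "y ^ k \<noteq> z ^ k"
    and cl': "x' ^ k = x ^ k" "y' ^ k = y ^ k \<or> inverse (y' ^ k) = y ^ k"
      "z' ^ k = z ^ k \<or> inverse (z' ^ k) = z ^ k"
  shows "six x y z = six x' y' z'"
proof -
  define a b c where "a = x ^ k" and "b = y ^ k" and "c = z ^ k"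
  have n: "a \<noteq> 0" "b \<noteq> 0" "c \<noteq> 0" "a \<noteq> inverse a" "b \<noteq> inverse b" "c \<noteq> inverse c"
    using root_ne_1[OF class_roots(1) cl(1)] root_ne_1[OF class_roots(2) cl(2)]
      root_ne_1[OF class_roots(3) cl(3)]
    by (auto simp: a_def b_def c_def field_simps power2_eq_square)
  have abc: "a * b * c = 1" using tri_class[OF t, of k] by (simp add: a_def b_def c_def)
  have m: "inverse a \<noteq> b" "inverse a \<noteq> c" "inverse b \<noteq> c" "a \<noteq> inverse b" "a \<noteq> inverse c" "b \<noteq> inverse c"
    using prod_one_inverse_ne[of a b c] prod_one_inverse_ne[of a c b] prod_one_inverse_ne[of b c a] abc cl
    by (simp_all add: a_def b_def c_def mult_ac)
  have d: "a \<noteq> b" "a \<noteq> c" "b \<noteq> c" using cl by (simp_all add: a_def b_def c_def)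
  have cla: "x ^ k = a" "y ^ k = b" "z ^ k = c" by (simp_all add: a_def b_def c_def)
  note ne = n m d n[symmetric] m[symmetric] d[symmetric]
  have c1: "x' ^ k = a" "y' ^ k = b \<or> y' ^ k = inverse b" "z' ^ k = c \<or> z' ^ k = inverse c"
    using cl' cla by (metis inverse_inverse_eq)+
  note S' = S[of a, unfolded csum_six[OF t] csum_six[OF t']]
    S[of b, unfolded csum_six[OF t] csum_six[OF t']] S[of c, unfolded csum_six[OF t] csum_six[OF t']]
  have "x = x' \<and> (y = y' \<or> y = cnj y') \<and> (z = z' \<or> z = cnj z')"
    using c1(2,3)
  proof (elim disjE)
    assume h: "y' ^ k = b" "z' ^ k = c"
    have "x = x'" using S'(1) by (simp add: cla c1(1) h ne)
    moreover have "y = y' \<or> y = cnj y'" using S'(2) by (simp add: cla c1(1) h ne)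
    moreover have "z = z' \<or> z = cnj z'" using S'(3) by (simp add: cla c1(1) h ne)
    ultimately show ?thesis by blast
  next
    assume h: "y' ^ k = b" "z' ^ k = inverse c"
    have "x = x'" using S'(1) by (simp add: cla c1(1) h ne)
    moreover have "y = y' \<or> y = cnj y'" using S'(2) by (simp add: cla c1(1) h ne)
    moreover have "z = z' \<or> z = cnj z'" using S'(3) by (simp add: cla c1(1) h ne)
    ultimately show ?thesis by blast
  next
    assume h: "y' ^ k = inverse b" "z' ^ k = c"
    have "x = x'" using S'(1) by (simp add: cla c1(1) h ne)
    moreover have "y = y' \<or> y = cnj y'" using S'(2) by (simp add: cla c1(1) h ne)
    moreover have "z = z' \<or> z = cnj z'" using S'(3) by (simp add: cla c1(1) h ne)
    ultimately show ?thesis by blast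
  next
    assume h: "y' ^ k = inverse b" "z' ^ k = inverse c"
    have "x = x'" using S'(1) by (simp add: cla c1(1) h ne)
    moreover have "y = y' \<or> y = cnj y'" using S'(2) by (simp add: cla c1(1) h ne)
    moreover have "z = z' \<or> z = cnj z'" using S'(3) by (simp add: cla c1(1) h ne)
    ultimately show ?thesis by blast
  qed
  then show ?thesis by (auto simp: six_def)
qed

text \<open>The class of y has the nonzero sum y + cnj z, so the right sextuple meets it, and
  relabelling gives the hypothesis of \<open>six_eq_Z\<close>.\<close>

lemma six_eq_one:
  assumes "x ^ k = 1" "y ^ k \<noteq> 1"
  shows "six x y z = six x' y' z'"
proof -
  have b: "(y ^ k) ^ 2 \<noteq> 1" "y ^ k \<noteq> 0"
    using root_ne_1[OF class_roots(2) assms(2)] by auto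
  have z: "z ^ k = inverse (y ^ k)"
    using tri_class[OF t, of k] assms b by (auto simp: field_simps)
  have "inverse (y ^ k) \<noteq> y ^ k" using b by (auto simp: field_simps power2_eq_square)
  then have "csum k (y ^ k) (six x y z) = y + cnj z"
    using assms z by (simp add: csum_six[OF t] eq_commute[of 1])
  then have "csum k (y ^ k) (six x' y' z') \<noteq> 0" using S generic_add_cnj[OF t g] by simp
  then obtain u v w where u: "unit_triple u v w" "six u v w = six x' y' z'" "u ^ k = y ^ k"
    using six_class_wlog[OF t'] by blast
  interpret r: class_sums5 p k x y z v u w
    using u by (intro change_right) (auto intro: tri_swap12 simp: six_swap12[of v u])
  show ?thesis using r.six_eq_Z[OF assms u(3)] u(2) by (simp add: six_swap12[of v u])
qed

text \<open>Classes a and a^-2 have nonzero sums on the left, so the right sextuple meets both;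
  relabelling leads to \<open>six_eq_D\<close>.\<close>

lemma six_eq_two:
  assumes "x ^ k \<noteq> 1" "y ^ k = x ^ k"
  shows "six x y z = six x' y' z'"
proof -
  define a where "a = x ^ k"
  have a: "a \<noteq> 1" "a \<noteq> 0" "a ^ 2 \<noteq> 1" "a ^ 3 \<noteq> 1" "a ^ 4 \<noteq> 1"
    using root_ne_1[OF class_roots(1) assms(1)] assms(1) by (simp_all add: a_def)
  note ne = distinct_powers[OF a(2,1,3-5)]
  have cl: "x ^ k = a" "y ^ k = a" "z ^ k = inverse (a ^ 2)"
    using tri_class[OF t, of k] assms a by (auto simp: field_simps a_def power2_eq_square)
  have "csum k a (six x' y' z') = x + y" "csum k (inverse (a ^ 2)) (six x' y' z') = z"
    using cl ne by (simp_all add: S[symmetric] csum_six[OF t])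
  then have nz: "csum k a (six x' y' z') \<noteq> 0" "csum k (inverse (a ^ 2)) (six x' y' z') \<noteq> 0"
    using g t by (auto simp: generic_def unit_triple_def)
  then obtain u v w where u: "unit_triple u v w" "six u v w = six x' y' z'" "u ^ k = a"
    using six_class_wlog[OF t'] by blast
  interpret r: class_sums5 p k x y z u v w using u by (intro change_right)
  interpret r': class_sums5 p k x y z u w v
    using u by (intro change_right) (auto intro: tri_swap23 simp: six_swap23[of u w])
  have "inverse (u ^ k) \<noteq> inverse (a ^ 2)" "u ^ k \<noteq> inverse (a ^ 2)" using u(3) ne by auto
  then have "(v ^ k = inverse (a ^ 2) \<or> inverse (v ^ k) = inverse (a ^ 2)) \<or>
      (w ^ k = inverse (a ^ 2) \<or> inverse (w ^ k) = inverse (a ^ 2))"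
    using csum_six_nonzero[OF u(1), of k "inverse (a ^ 2)"] nz(2) u(2) by auto
  then show ?thesis
  proof
    assume "v ^ k = inverse (a ^ 2) \<or> inverse (v ^ k) = inverse (a ^ 2)"
    then show ?thesis using r.six_eq_D assms u cl by auto
  next
    assume "w ^ k = inverse (a ^ 2) \<or> inverse (w ^ k) = inverse (a ^ 2)"
    then show ?thesis using r'.six_eq_D assms u cl by (auto simp: six_swap23[of u w])
  qed
qed

lemma six_eq_three:
  assumes cl: "x ^ k \<noteq> 1" "y ^ k \<noteq> 1" "z ^ k \<noteq> 1" "x ^ k \<noteq> y ^ k" "x ^ k \<noteq> z ^ k" "y ^ k \<noteq> z ^ k"
  shows "six x y z = six x' y' z'"
proof -
  define a b c where "a = x ^ k" and "b = y ^ k" and "c = z ^ k"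
  have n: "a \<noteq> 0" "b \<noteq> 0" "c \<noteq> 0" "a \<noteq> inverse a" "b \<noteq> inverse b" "c \<noteq> inverse c"
    using root_ne_1[OF class_roots(1) cl(1)] root_ne_1[OF class_roots(2) cl(2)]
      root_ne_1[OF class_roots(3) cl(3)]
    by (auto simp: a_def b_def c_def field_simps power2_eq_square)
  have abc: "a * b * c = 1" using tri_class[OF t, of k] by (simp add: a_def b_def c_def)
  have m: "inverse a \<noteq> b" "inverse a \<noteq> c" "inverse b \<noteq> c" "a \<noteq> inverse b" "a \<noteq> inverse c" "b \<noteq> inverse c"
    using prod_one_inverse_ne[of a b c] prod_one_inverse_ne[of a c b] prod_one_inverse_ne[of b c a] abc cl
    by (simp_all add: a_def b_def c_def mult_ac)
  have d: "a \<noteq> b" "a \<noteq> c" "b \<noteq> c" using cl by (simp_all add: a_def b_def c_def)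
  have cla: "x ^ k = a" "y ^ k = b" "z ^ k = c" by (simp_all add: a_def b_def c_def)
  note ne = n m d n[symmetric] m[symmetric] d[symmetric]
  have "csum k a (six x' y' z') = x" "csum k b (six x' y' z') = y" "csum k c (six x' y' z') = z"
    using cla ne by (simp_all add: S[symmetric] csum_six[OF t])
  then have nz: "csum k a (six x' y' z') \<noteq> 0" "csum k b (six x' y' z') \<noteq> 0" "csum k c (six x' y' z') \<noteq> 0"
    using t by (auto simp: unit_triple_def)
  then obtain u v w where u: "unit_triple u v w" "six u v w = six x' y' z'" "u ^ k = a"
    using six_class_wlog[OF t'] by blast
  interpret r: class_sums5 p k x y z u v w using u by (intro change_right)
  interpret r': class_sums5 p k x y z u w v
    using u by (intro change_right) (auto intro: tri_swap23 simp: six_swap23[of u w])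
  have vw: "v ^ k = s \<or> inverse (v ^ k) = s \<or> w ^ k = s \<or> inverse (w ^ k) = s" if "s = b \<or> s = c" for s
    using csum_six_nonzero[OF u(1), of k s] nz u ne that by auto
  have "(v ^ k = b \<or> inverse (v ^ k) = b) \<and> (w ^ k = c \<or> inverse (w ^ k) = c) \<or>
    (w ^ k = b \<or> inverse (w ^ k) = b) \<and> (v ^ k = c \<or> inverse (v ^ k) = c)"
    using vw[of b] vw[of c] ne by auto
  then show ?thesis
  proof
    assume "(v ^ k = b \<or> inverse (v ^ k) = b) \<and> (w ^ k = c \<or> inverse (w ^ k) = c)"
    then show ?thesis using r.six_eq_distinct[OF cl] u cla by auto
  next
    assume "(w ^ k = b \<or> inverse (w ^ k) = b) \<and> (v ^ k = c \<or> inverse (v ^ k) = c)"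
    then show ?thesis using r'.six_eq_distinct[OF cl] u cla by (auto simp: six_swap23[of u w])
  qed
qed

lemma six_eq:
  assumes "\<not> (x ^ k = 1 \<and> y ^ k = 1 \<and> z ^ k = 1)"
  shows "six x y z = six x' y' z'"
proof -
  interpret s12: class_sums5 p k y x z x' y' z'
    by (rule change_left) (use t g in \<open>auto intro: tri_swap12 generic_swap12 simp: six_swap12[of y x]\<close>)
  interpret s23: class_sums5 p k x z y x' y' z'
    by (rule change_left) (use t g in \<open>auto intro: tri_swap23 generic_swap23 simp: six_swap23[of x z]\<close>)
  interpret s13: class_sums5 p k z y x x' y' z'
    by (rule change_left) (use t g in \<open>auto intro: tri_swap13 generic_swap13 simp: six_swap13[of z y]\<close>)
  have one: "x ^ k = 1 \<Longrightarrow> y ^ k \<noteq> 1" "y ^ k = 1 \<Longrightarrow> x ^ k \<noteq> 1" "z ^ k = 1 \<Longrightarrow> y ^ k \<noteq> 1"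
    using tri_class[OF t, of k] assms by auto
  note sw = six_swap12[of y x z] six_swap23[of x z y] six_swap13[of z y x]
  consider "x ^ k = 1" | "y ^ k = 1" | "z ^ k = 1"
    | "x ^ k \<noteq> 1" "y ^ k = x ^ k" | "x ^ k \<noteq> 1" "z ^ k = x ^ k" | "z ^ k \<noteq> 1" "y ^ k = z ^ k"
    | "x ^ k \<noteq> 1" "y ^ k \<noteq> 1" "z ^ k \<noteq> 1" "x ^ k \<noteq> y ^ k" "x ^ k \<noteq> z ^ k" "y ^ k \<noteq> z ^ k"
    by metis
  then show ?thesis
  proof cases
    case 1
    then show ?thesis using six_eq_one one by blast
  next
    case 2
    then have "six y x z = six x' y' z'" using s12.six_eq_one one by blast
    then show ?thesis by (simp only: sw)
  next
    case 3
    then have "six z y x = six x' y' z'" using s13.six_eq_one one by blast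
    then show ?thesis by (simp only: sw)
  next
    case 4
    then show ?thesis by (rule six_eq_two)
  next
    case 5
    then have "six x z y = six x' y' z'" by (rule s23.six_eq_two)
    then show ?thesis by (simp only: sw)
  next
    case 6
    then have "six z y x = six x' y' z'" by (rule s13.six_eq_two)
    then show ?thesis by (simp only: sw)
  next
    case 7
    then show ?thesis by (rule six_eq_three)
  qed
qed

end

section \<open>Equal class sums force equal sextuples: 4 or 9 divides n\<close>

section \<open>Classes modulo 2 and 3\<close>

lemma tri_cnj_eq:
  assumes "unit_triple x y z"
  shows "cnj x = y * z" "cnj y = x * z" "cnj z = x * y"
proof -
  have u: "x * cnj x = 1" "y * cnj y = 1" "z * cnj z = 1" and p: "x * y * z = 1"
    using assms by (auto simp: unit_triple_def)
  have "cnj x = (x * y * z) * cnj x" "cnj y = (x * y * z) * cnj y" "cnj z = (x * y * z) * cnj z"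
    using p by simp_all
  then have h: "cnj x = (x * cnj x) * (y * z)" "cnj y = (y * cnj y) * (x * z)" "cnj z = (z * cnj z) * (x * y)"
    by (simp_all only: mult_ac)
  from h[unfolded u] show "cnj x = y * z" "cnj y = x * z" "cnj z = x * y" by simp_all
qed

text \<open>Exactly two of the classes are -1, say those of x and y. The class sums are then z + cnj
  z and (x + y) * (1 + z): the first gives z up to conjugation, the second gives x + y, and x * y =
  cnj z.\<close>

lemma six_eq_mod_2:
  assumes t: "unit_triple x y z" and t': "unit_triple x' y' z'" and g: "generic x y z"
    and S: "\<And>c. csum k c (six x y z) = csum k c (six x' y' z')"
    and roots: "\<And>w. w \<in># six x y z + six x' y' z' \<Longrightarrow> (w ^ k) ^ 2 = 1"
    and nt: "\<not> (x ^ k = 1 \<and> y ^ k = 1 \<and> z ^ k = 1)"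
  shows "six x y z = six x' y' z'"
proof -
  have main: "six x y z = six x' y' z'"
    if t: "unit_triple x y z" and g: "generic x y z" and cl: "x ^ k = -1" "y ^ k = -1" "z ^ k = 1"
      and S: "\<And>c. csum k c (six x y z) = csum k c (six x' y' z')" for x y z
  proof -
    have sum: "x + y + cnj x + cnj y = (x + y) * (1 + z)" if "unit_triple x y z" for x y z
      using tri_cnj_eq[OF that] by (simp add: algebra_simps)
    have nz: "x + y \<noteq> 0" "1 + z \<noteq> 0" using g by (auto simp: generic_def add_eq_0_iff)
    have "csum k (-1) (six x y z) = x + y + cnj x + cnj y"
      using cl by (simp add: csum_six[OF t])
    then have "csum k (-1) (six x' y' z') \<noteq> 0" using S sum[OF t] nz by simp
    then obtain u v w where u: "unit_triple u v w" "six u v w = six x' y' z'" "u ^ k = -1"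
      using six_class_wlog[OF t'] by blast
    have "v \<in># six u v w" "w \<in># six u v w" by (simp_all add: six_def)
    then have sq: "(v ^ k) ^ 2 = 1" "(w ^ k) ^ 2 = 1" using roots by (simp_all add: u(2))
    have fin: "six x y z = six u v w" if u: "unit_triple u v w" "u ^ k = -1" "v ^ k = -1" "w ^ k = 1"
      and S: "\<And>c. csum k c (six x y z) = csum k c (six u v w)" for u v w
    proof -
      have "z + cnj z = w + cnj w"
        using S[of 1] cl u(2-) by (simp add: csum_six[OF t] csum_six[OF u(1)])
      then have zw: "{#z, cnj z#} = {#w, cnj w#}"
        using t u(1) by (intro cnj_pair_eqI) (auto simp: unit_triple_def)
      have fin: "six x y z = six u v w" if u: "unit_triple u v w" "u ^ k = -1" "v ^ k = -1" "w = z"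
        and S: "\<And>c. csum k c (six x y z) = csum k c (six u v w)" for u v w
      proof -
        have "x + y + cnj x + cnj y = u + v + cnj u + cnj v"
          using S[of "-1", unfolded csum_six[OF t] csum_six[OF u(1)]] cl u(2-) by simp
        then have "x + y = u + v" using sum[OF t] sum[OF u(1)] nz u(4) by simp
        moreover have "x * y = u * v" using tri_cnj_eq(3)[OF t] tri_cnj_eq(3)[OF u(1)] u(4) by simp
        ultimately have "{#x, y#} = {#u, v#}" by (rule pair_eqI)
        moreover have "{#x, y, z#} = {#x, y#} + {#z#}" "{#u, v, w#} = {#u, v#} + {#w#}" by simp_all
        ultimately show ?thesis using u(4) by (intro six_eq_of_triple_eq) (simp only:)
      qed
      have "z \<in># {#w, cnj w#}" by (simp flip: zw)
      then consider "w = z" | "cnj w = z" by auto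
      then show ?thesis
      proof cases
        case 1
        then show ?thesis using fin[OF u(1-3)] S by blast
      next
        case 2
        have "six x y z = six (cnj u) (cnj v) (cnj w)"
        proof (rule fin)
          show "cnj u ^ k = -1" "cnj v ^ k = -1"
            using u by (simp_all add: unit_triple_def unit_power_cnj)
          show "csum k c (six x y z) = csum k c (six (cnj u) (cnj v) (cnj w))" for c
            using S six_cnj by simp
        qed (use tri_cnj[OF u(1)] 2 in auto)
        then show ?thesis by (simp only: six_cnj)
      qed
    qed
    from sq have "v ^ k = 1 \<or> v ^ k = -1" by (simp add: power2_eq_1_iff)
    then show ?thesis
    proof
      assume v: "v ^ k = 1"
      then have "- (w ^ k) = 1" using tri_class[OF u(1), of k] u(3) by simp
      then have w: "w ^ k = -1" by (metis minus_minus)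
      have "six x y z = six u w v"
        using fin[OF tri_swap23[OF u(1)] u(3) w v] S u(2) by (simp add: six_swap23[of u w])
      then show ?thesis using u(2) by (simp add: six_swap23[of u w])
    next
      assume v: "v ^ k = -1"
      then have w: "w ^ k = 1" using tri_class[OF u(1), of k] u(3) by simp
      show ?thesis using fin[OF u(1,3) v w] S u(2) by simp
    qed
  qed
  have "(x ^ k) ^ 2 = 1" "(y ^ k) ^ 2 = 1" "(z ^ k) ^ 2 = 1" by (rule roots, simp add: six_def)+
  then have sg: "x ^ k = 1 \<or> x ^ k = -1" "y ^ k = 1 \<or> y ^ k = -1" "z ^ k = 1 \<or> z ^ k = -1"
    by (simp_all add: power2_eq_1_iff)
  then consider "x ^ k = -1" "y ^ k = -1" "z ^ k = 1" | "x ^ k = -1" "z ^ k = -1" "y ^ k = 1"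
    | "z ^ k = -1" "y ^ k = -1" "x ^ k = 1"
    using nt tri_class[OF t, of k] by force
  then show ?thesis
  proof cases
    case 1
    then show ?thesis using main[OF t g] S by blast
  next
    case 2
    have "six x z y = six x' y' z'"
      using main[OF tri_swap23[OF t] generic_swap23[OF g] 2] S by (simp add: six_swap23[of x z])
    then show ?thesis by (simp add: six_swap23[of x z])
  next
    case 3
    have "six z y x = six x' y' z'"
      using main[OF tri_swap13[OF t] generic_swap13[OF g] 3] S by (simp add: six_swap13[of z y])
    then show ?thesis by (simp add: six_swap13[of z y])
  qed
qed

lemma cube_root_cases:
  fixes c w :: complex
  assumes "c ^ 3 = 1" "c \<noteq> 1" "w ^ 3 = 1"
  shows "w = 1 \<or> w = c \<or> w = inverse c"
proof -
  have c0: "c \<noteq> 0" using assms(1) by auto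
  have c2: "inverse c = c ^ 2" using assms(1) c0 by (simp add: field_simps eval_nat_numeral)
  have "(c - 1) * (c ^ 2 + c + 1) = 0" using assms(1) by (simp add: algebra_simps eval_nat_numeral)
  then have h: "c ^ 2 + c + 1 = 0" using assms(2) by simp
  have "c ^ 2 = (c ^ 2 + c + 1) - c - 1" by simp
  then have s: "c ^ 2 = - c - 1" unfolding h by simp
  have "(w - 1) * (w - c) * (w - c ^ 2) = w ^ 3 - (1 + c + c ^ 2) * w ^ 2 + (c + c ^ 2 + c ^ 3) * w - c ^ 3"
    by (simp add: algebra_simps eval_nat_numeral)
  also have "\<dots> = 0" using assms s by simp
  finally show ?thesis using c2 by auto
qed

text \<open>\<open>ni\<close> excludes elements of order 4, so that no w + cnj w vanishes;
  \<open>k3\<close> reflects 3 dividing k and puts the cube roots of unity into the trivial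
  class.\<close>

locale class_sums3 =
  fixes k :: nat and x y z x' y' z' :: complex
  assumes t: "unit_triple x y z" and t': "unit_triple x' y' z'" and g: "generic x y z"
    and S: "\<And>c. csum k c (six x y z) = csum k c (six x' y' z')"
    and roots: "\<And>w. w \<in># six x y z + six x' y' z' \<Longrightarrow> (w ^ k) ^ 3 = 1"
    and ni: "\<And>w. w \<in># six x y z + six x' y' z' \<Longrightarrow> w ^ 2 \<noteq> -1"
    and k3: "\<And>w::complex. w ^ 3 = 1 \<Longrightarrow> w ^ k = 1"
begin

lemma add_cnj_ne_0:
  assumes "w \<in># six x y z + six x' y' z'" "w * cnj w = 1"
  shows "w + cnj w \<noteq> 0"
proof
  assume "w + cnj w = 0"
  then have "cnj w = - w" by (simp add: add_eq_0_iff)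
  then have "w ^ 2 = -1" using assms(2) by (simp add: power2_eq_square minus_equation_iff)
  then show False using ni assms(1) by blast
qed

lemma cube_root_ne:
  fixes c :: complex
  assumes "c ^ 3 = 1" "c \<noteq> 1"
  shows "c \<noteq> 0" "inverse c \<noteq> c" "c \<noteq> inverse c" "c ^ 2 \<noteq> 1" "inverse c \<noteq> 1" "1 \<noteq> inverse c" "1 \<noteq> c"
    "inverse c * inverse c = c"
proof -
  show c0: "c \<noteq> 0" using assms by auto
  have c3: "c * (c * c) = 1" using assms(1) by (simp add: eval_nat_numeral)
  show "c ^ 2 \<noteq> 1" using c3 assms(2) by (auto simp: power2_eq_square)
  then show "inverse c \<noteq> c" "c \<noteq> inverse c" using c0 by (auto simp: field_simps power2_eq_square)
  show "inverse c \<noteq> 1" "1 \<noteq> inverse c" "1 \<noteq> c" using assms(2) by auto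
  show "inverse c * inverse c = c" using c3 c0 by (auto simp: field_simps)
qed

lemma change_left3:
  assumes "unit_triple u v w" "six u v w = six x y z" "generic u v w"
  shows "class_sums3 k u v w x' y' z'"
proof
  show "(s ^ k) ^ 3 = 1" if "s \<in># six u v w + six x' y' z'" for s
    using roots[of s] that assms(2) by simp
  show "s ^ 2 \<noteq> -1" if "s \<in># six u v w + six x' y' z'" for s
    using ni[of s] that assms(2) by simp
  show "csum k c (six u v w) = csum k c (six x' y' z')" for c using S assms(2) by simp
qed (use assms t' k3 in auto)

text \<open>New against larger primes: since b ^ 3 = 1, all three right classes could be b. The
  trivial class would then be empty on the right, against x + cnj x being nonzero.\<close>

lemma six_eq_one3:
  assumes cl: "x ^ k = 1" "y ^ k \<noteq> 1"
  shows "six x y z = six x' y' z'"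
proof -
  define b where "b = y ^ k"
  have b3: "b ^ 3 = 1" "b \<noteq> 1" using roots[of y] cl by (simp_all add: six_def b_def)
  note b = cube_root_ne[OF b3]
  have z: "z ^ k = inverse b" using tri_class[OF t, of k] cl b(1) by (auto simp: b_def field_simps)
  have xy: "x ^ k = 1" "y ^ k = b" using cl by (simp_all add: b_def)
  have "csum k b (six x y z) = y + cnj z"
    using xy z b b3 by (simp add: csum_six[OF t])
  then have "csum k b (six x' y' z') \<noteq> 0" using S generic_add_cnj[OF t g] by simp
  then obtain u v w where u: "unit_triple u v w" "six u v w = six x' y' z'" "u ^ k = b"
    using six_class_wlog[OF t'] by blast
  have "v \<in># six u v w" by (simp add: six_def)
  then have "(v ^ k) ^ 3 = 1" using roots by (simp add: u(2))
  then consider "v ^ k = 1" | "v ^ k = b" | "v ^ k = inverse b"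
    using cube_root_cases[OF b3] by blast
  then show ?thesis
  proof cases
    case 1
    have "six x y z = six v u w"
      using S u xy b b3 1
      by (intro six_eq_split_pattern[OF t tri_swap12[OF u(1)] g, of k b]) (simp_all add: six_swap12[of v u])
    then show ?thesis using u by (simp add: six_swap12[of v u])
  next
    case 2
    have "w ^ k = inverse b * inverse b" using tri_class[OF u(1), of k] u(3) 2 b(1) by (simp add: field_simps)
    then have w: "w ^ k = b" using b by simp
    have "csum k 1 (six u v w) = 0" using u(3) 2 w b b3 by (simp add: csum_six[OF u(1)])
    moreover have "csum k 1 (six x y z) = x + cnj x" using xy z b b3 by (simp add: csum_six[OF t])
    ultimately have "x + cnj x = 0" using S[of 1] u(2) by simp
    then show ?thesis using add_cnj_ne_0[of x] t by (simp add: six_def unit_triple_def)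
  next
    case 3
    then have w: "w ^ k = 1" using tri_class[OF u(1), of k] u(3) b by simp
    have tw: "unit_triple w u v" using tri_swap23[OF u(1)] tri_swap12 by blast
    have sw: "six w u v = six x' y' z'" using u(2) by (metis six_swap12 six_swap23)
    show ?thesis
      using six_eq_split_pattern[OF t tw g, of k b] S u(3) w xy b b3 sw by simp
  qed
qed

lemma six_eq_all3:
  assumes cl: "x ^ k \<noteq> 1" "y ^ k = x ^ k" "z ^ k = x ^ k"
  shows "six x y z = six x' y' z'"
proof -
  define c where "c = x ^ k"
  have c3: "c ^ 3 = 1" "c \<noteq> 1" using roots[of x] cl by (simp_all add: six_def c_def)
  note c = cube_root_ne[OF c3]
  have cl': "x ^ k = c" "y ^ k = c" "z ^ k = c" using cl by (simp_all add: c_def)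
  \<comment> \<open>If the sum vanished, so would the second symmetric function, its conjugate; then
    x ^ 3 = 1 and x would lie in the trivial class.\<close>
  have "x + y + z \<noteq> 0"
  proof
    assume s0: "x + y + z = 0"
    have "x * y + y * z + x * z = cnj x + cnj y + cnj z" using tri_cnj_eq[OF t] by simp
    also have "\<dots> = cnj (x + y + z)" by simp
    finally have e2: "x * y + y * z + x * z = 0" using s0 by simp
    have "x ^ 3 = x ^ 2 * (x + y + z) - x * (x * y + y * z + x * z) + x * y * z"
      by (simp add: algebra_simps eval_nat_numeral)
    then have "x ^ 3 = 1" using s0 e2 t by (simp add: unit_triple_def)
    then show False using k3 cl by blast
  qed
  moreover have sA: "csum k c (six x y z) = x + y + z" using cl' c c3 by (simp add: csum_six[OF t])
  ultimately have "csum k c (six x' y' z') \<noteq> 0" using S by simp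
  then obtain u v w where u: "unit_triple u v w" "six u v w = six x' y' z'" "u ^ k = c"
    using six_class_wlog[OF t'] by blast
  have "v \<in># six u v w" "w \<in># six u v w" by (simp_all add: six_def)
  then have m: "v \<in># six x' y' z'" "w \<in># six x' y' z'" by (simp_all only: u(2))
  have s1: "csum k 1 (six u v w) = 0" using S[of 1] u(2) cl' c c3 by (simp add: csum_six[OF t])
  have "(v ^ k) ^ 3 = 1" using roots m by simp
  then consider "v ^ k = 1" | "v ^ k = c" | "v ^ k = inverse c"
    using cube_root_cases[OF c3] by blast
  then show ?thesis
  proof cases
    case 1
    then have w: "w ^ k = inverse c" using tri_class[OF u(1), of k] u(3) c(1) by (auto simp: field_simps)
    have "v + cnj v = 0" using s1 u(3) 1 w c c3 by (simp add: csum_six[OF u(1)])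
    then show ?thesis using add_cnj_ne_0[of v] m u(1) by (simp add: unit_triple_def)
  next
    case 2
    have "w ^ k = inverse c * inverse c" using tri_class[OF u(1), of k] u(3) 2 c(1) by (simp add: field_simps)
    then have w: "w ^ k = c" using c by simp
    have "csum k c (six u v w) = u + v + w" using u(3) 2 w c c3 by (simp add: csum_six[OF u(1)])
    then have "x + y + z = u + v + w" using S[of c] sA u(2) by simp
    then show ?thesis using six_eq_of_triple_eq[OF unit_triple_eqI[OF t u(1)]] u(2) by simp
  next
    case 3
    then have w: "w ^ k = 1" using tri_class[OF u(1), of k] u(3) c by simp
    have "w + cnj w = 0" using s1 u(3) 3 w c c3 by (simp add: csum_six[OF u(1)])
    then show ?thesis using add_cnj_ne_0[of w] m u(1) by (simp add: unit_triple_def)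
  qed
qed

lemma six_eq3:
  assumes "\<not> (x ^ k = 1 \<and> y ^ k = 1 \<and> z ^ k = 1)"
  shows "six x y z = six x' y' z'"
proof -
  interpret s12: class_sums3 k y x z x' y' z'
    by (rule change_left3) (use t g in \<open>auto intro: tri_swap12 generic_swap12 simp: six_swap12[of y x]\<close>)
  interpret s13: class_sums3 k z y x x' y' z'
    by (rule change_left3) (use t g in \<open>auto intro: tri_swap13 generic_swap13 simp: six_swap13[of z y]\<close>)
  have one: "x ^ k = 1 \<Longrightarrow> y ^ k \<noteq> 1" "y ^ k = 1 \<Longrightarrow> x ^ k \<noteq> 1" "z ^ k = 1 \<Longrightarrow> y ^ k \<noteq> 1"
    using tri_class[OF t, of k] assms by auto
  note sw = six_swap12[of y x z] six_swap13[of z y x]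
  consider "x ^ k = 1" | "y ^ k = 1" | "z ^ k = 1" | "x ^ k \<noteq> 1" "y ^ k \<noteq> 1" "z ^ k \<noteq> 1" by blast
  then show ?thesis
  proof cases
    case 1
    then show ?thesis using six_eq_one3 one by blast
  next
    case 2
    then have "six y x z = six x' y' z'" using s12.six_eq_one3 one by blast
    then show ?thesis by (simp only: sw)
  next
    case 3
    then have "six z y x = six x' y' z'" using s13.six_eq_one3 one by blast
    then show ?thesis by (simp only: sw)
  next
    case 4
    have r: "(x ^ k) ^ 3 = 1" "(y ^ k) ^ 3 = 1" by (rule roots, simp add: six_def)+
    note c = cube_root_ne[OF r(1) 4(1)]
    from cube_root_cases[OF r(1) 4(1) r(2)] 4 have "y ^ k = x ^ k \<or> y ^ k = inverse (x ^ k)" by blast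
    moreover have "y ^ k \<noteq> inverse (x ^ k)"
    proof
      assume "y ^ k = inverse (x ^ k)"
      then have "z ^ k = 1" using tri_class[OF t, of k] c by simp
      then show False using 4 by simp
    qed
    ultimately have y: "y ^ k = x ^ k" by blast
    then have "z ^ k = inverse (x ^ k) * inverse (x ^ k)"
      using tri_class[OF t, of k] c(1) by (simp add: field_simps)
    then show ?thesis using six_eq_all3 4(1) y c by simp
  qed
qed

end

section \<open>The prime 7 with a nonzero discrepancy S between class sums\<close>

section \<open>Classes modulo 7\<close>

text \<open>Rewrite rules that decide equality of classes by comparing exponents modulo 7.\<close>

lemma seventh_root_powers:
  fixes a :: complex
  assumes "a ^ 7 = 1" "a \<noteq> 1"
  shows "a \<noteq> 0" "inverse a = a ^ 6" "inverse (a ^ 2) = a ^ 5" "inverse (a ^ 3) = a ^ 4"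
    "inverse (a ^ 4) = a ^ 3" "inverse (a ^ 5) = a ^ 2" "inverse (a ^ 6) = a"
    "\<And>i. a ^ i = 1 \<longleftrightarrow> i mod 7 = 0" "\<And>i. 1 = a ^ i \<longleftrightarrow> i mod 7 = 0"
    "\<And>i. a ^ i = a \<longleftrightarrow> i mod 7 = 1" "\<And>i. a = a ^ i \<longleftrightarrow> i mod 7 = 1"
    "\<And>i j. a ^ i = a ^ j \<longleftrightarrow> i mod 7 = j mod 7" "1 \<noteq> a"
proof -
  show a0: "a \<noteq> 0" using assms by auto
  have "a * a ^ 6 = 1" "a ^ 2 * a ^ 5 = 1" "a ^ 3 * a ^ 4 = 1"
    using assms(1) by (simp_all flip: power_add power_Suc)
  then show "inverse a = a ^ 6" "inverse (a ^ 2) = a ^ 5" "inverse (a ^ 3) = a ^ 4"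
    "inverse (a ^ 4) = a ^ 3" "inverse (a ^ 5) = a ^ 2" "inverse (a ^ 6) = a"
    by (auto intro!: inverse_unique simp: mult.commute)
  show one: "a ^ i = 1 \<longleftrightarrow> i mod 7 = 0" for i
  proof
    assume "a ^ i = 1"
    show "i mod 7 = 0"
    proof (rule ccontr)
      assume "i mod 7 \<noteq> 0"
      moreover have "prime (7::nat)" by simp
      ultimately have "coprime 7 i" using prime_imp_coprime[of 7 i] by (simp add: dvd_eq_mod_eq_0)
      then show False using root_unity_coprime[OF assms(1) \<open>a ^ i = 1\<close>] assms(2) by simp
    qed
  next
    assume "i mod 7 = 0"
    then show "a ^ i = 1" using assms(1) by (auto simp: power_mult elim!: dvdE simp flip: dvd_eq_mod_eq_0)
  qed
  then show "1 = a ^ i \<longleftrightarrow> i mod 7 = 0" for i by metis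
  show eq: "a ^ i = a ^ j \<longleftrightarrow> i mod 7 = j mod 7" for i j
  proof -
    have le: "a ^ i = a ^ j \<longleftrightarrow> i mod 7 = j mod 7" if "i \<le> j" for i j
    proof -
      have "a ^ j = a ^ i * a ^ (j - i)" using that by (simp flip: power_add)
      then have "a ^ i = a ^ j \<longleftrightarrow> (j - i) mod 7 = 0" using a0 one by auto
      also have "\<dots> \<longleftrightarrow> i mod 7 = j mod 7"
        using that by (metis mod_eq_dvd_iff_nat dvd_eq_mod_eq_0)
      finally show ?thesis .
    qed
    show ?thesis using le[of i j] le[of j i] by (metis linear)
  qed
  show "a ^ i = a \<longleftrightarrow> i mod 7 = 1" "a = a ^ i \<longleftrightarrow> i mod 7 = 1" for i
    using eq[of i 1] by auto
  show "1 \<noteq> a" using assms(2) by simp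
qed

lemma power_cancel:
  fixes a w :: complex
  assumes "a ^ n = 1" "a ^ i * w = 1" "i + j = n"
  shows "w = a ^ j"
proof -
  have "w = a ^ (j + i) * w" using assms(1,3) by (simp add: add.commute)
  also have "\<dots> = a ^ j * (a ^ i * w)" by (simp add: power_add mult.assoc)
  finally show ?thesis using assms(2) by simp
qed

text \<open>The sporadic coincidence for \<open>n = 42\<close>: in terms of a primitive seventh root of unity \<open>s\<close> and a
  primitive cube root of unity \<open>c\<close>, the triples \<open>(- c * s, - c\<^sup>2 * s, s ^ 5)\<close> and
  \<open>(c, c * s ^ 3, c * s ^ 4)\<close> have the same sum of their sextuples.\<close>

definition exceptional :: "nat \<Rightarrow> complex multiset \<Rightarrow> complex multiset \<Rightarrow> bool" where
  "exceptional k A B \<longleftrightarrow> (\<exists>w. A = six w (w ^ 29) (w ^ 12) \<and> w ^ 42 = 1) \<and>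
    (\<exists>\<beta> \<gamma>. \<beta> \<in># B \<and> \<gamma> \<in># B \<and> \<beta> ^ k = 1 \<and> \<beta> ^ 2 + \<beta> + 1 = 0 \<and> \<gamma> ^ k \<noteq> 1)"

text \<open>S is the common twisted difference of the class sums. Since it is nonzero, each of the
  seven classes is met by at least one sextuple. \<open>gen\<close> says that the left triple
  generates no group of order smaller than 7 * k.\<close>

locale class_sums7 =
  fixes k t :: nat and x y z x' y' z' S :: complex
  assumes t: "unit_triple x y z" and t': "unit_triple x' y' z'" and g: "generic x y z"
    and S: "\<And>c. c ^ 7 = 1 \<Longrightarrow> c ^ t * csum k c (six x y z) - c ^ t * csum k c (six x' y' z') = S"
    and S0: "S \<noteq> 0" and t7: "7 dvd 1 + k * t"
    and roots: "\<And>w. w \<in># six x y z + six x' y' z' \<Longrightarrow> w ^ (7 * k) = 1"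
    and gen: "\<And>d. x ^ d = 1 \<Longrightarrow> y ^ d = 1 \<Longrightarrow> z ^ d = 1 \<Longrightarrow> 7 * k dvd d"
    and k0: "k > 0"
begin

text \<open>\<open>N\<close> removes the part of order 7 from a root of unity.\<close>

definition N :: "complex \<Rightarrow> complex" where "N w = w ^ (1 + k * t)"

lemma tri_N: "unit_triple u v w \<Longrightarrow> unit_triple (N u) (N v) (N w)"
  unfolding unit_triple_def N_def by (metis complex_cnj_power power_mult_distrib power_one)

lemma N_eq: "w ^ k = c \<Longrightarrow> c ^ t * w = N w"
  by (auto simp: N_def power_mult mult.commute)

lemma N_class_1: "w ^ k = 1 \<Longrightarrow> N w = w"
  by (simp add: N_def power_mult)

lemma N_cnj: "w * cnj w = 1 \<Longrightarrow> inverse (w ^ k) = c \<Longrightarrow> c ^ t * cnj w = cnj (N w)"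
  using N_eq[of "cnj w" c] by (simp add: unit_power_cnj N_def)

text \<open>The twist by c ^ t turns an element w of class c into N w, so the equations between
  different classes compare sums of values of \<open>N\<close>.\<close>

lemma nsum_six:
  assumes "unit_triple u v w"
  shows "c ^ t * csum k c (six u v w) =
    (if u ^ k = c then N u else 0) + (if v ^ k = c then N v else 0) + (if w ^ k = c then N w else 0) +
    (if inverse (u ^ k) = c then cnj (N u) else 0) + (if inverse (v ^ k) = c then cnj (N v) else 0) +
    (if inverse (w ^ k) = c then cnj (N w) else 0)"
proof -
  have "u * cnj u = 1" "v * cnj v = 1" "w * cnj w = 1" using assms by (auto simp: unit_triple_def)
  note c = this[THEN N_cnj]
  have if_mult: "a * (if P then b else 0) = (if P then a * b else 0)" for a b :: complex and P by simp
  show ?thesis unfolding csum_six[OF assms] distrib_left if_mult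
    by (simp add: N_eq c cong: if_cong)
qed

lemma change_right7:
  assumes "unit_triple u v w" "six u v w = six x' y' z'"
  shows "class_sums7 k t x y z u v w S"
proof
  show "s ^ (7 * k) = 1" if "s \<in># six x y z + six u v w" for s
    using roots[of s] that assms(2) by simp
  show "c ^ t * csum k c (six x y z) - c ^ t * csum k c (six u v w) = S" if "c ^ 7 = 1" for c
    using S that assms(2) by simp
qed (use assms t g S0 t7 gen k0 in auto)

lemma change_left7:
  assumes "unit_triple u v w" "six u v w = six x y z" "generic u v w"
    and "\<And>d. u ^ d = 1 \<Longrightarrow> v ^ d = 1 \<Longrightarrow> w ^ d = 1 \<Longrightarrow> 7 * k dvd d"
  shows "class_sums7 k t u v w x' y' z' S"
proof
  show "s ^ (7 * k) = 1" if "s \<in># six u v w + six x' y' z'" for s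
    using roots[of s] that assms(2) by simp
  show "c ^ t * csum k c (six u v w) - c ^ t * csum k c (six x' y' z') = S" if "c ^ 7 = 1" for c
    using S that assms(2) by simp
qed (use assms t' S0 t7 k0 in auto)

lemma class_root7: "w \<in># six x y z + six x' y' z' \<Longrightarrow> (w ^ k) ^ 7 = 1"
  using roots by (simp add: power_mult mult.commute flip: power_mult)

lemma class_7:
  "(x ^ k) ^ 7 = 1" "(y ^ k) ^ 7 = 1" "(z ^ k) ^ 7 = 1" "(x' ^ k) ^ 7 = 1" "(y' ^ k) ^ 7 = 1" "(z' ^ k) ^ 7 = 1"
  by (rule class_root7, simp add: six_def)+

lemma nsum: "c ^ 7 = 1 \<Longrightarrow>
    (if x ^ k = c then N x else 0) + (if y ^ k = c then N y else 0) + (if z ^ k = c then N z else 0) +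
    (if inverse (x ^ k) = c then cnj (N x) else 0) + (if inverse (y ^ k) = c then cnj (N y) else 0) +
    (if inverse (z ^ k) = c then cnj (N z) else 0) -
    ((if x' ^ k = c then N x' else 0) + (if y' ^ k = c then N y' else 0) + (if z' ^ k = c then N z' else 0) +
    (if inverse (x' ^ k) = c then cnj (N x') else 0) + (if inverse (y' ^ k) = c then cnj (N y') else 0) +
    (if inverse (z' ^ k) = c then cnj (N z') else 0)) = S"
  using S[of c] unfolding nsum_six[OF t] nsum_six[OF t'] .

text \<open>Otherwise class c would contribute 0 on both sides and S would be 0.\<close>

lemma right_nonzero:
  assumes "c ^ 7 = 1" "x ^ k \<noteq> c" "y ^ k \<noteq> c" "z ^ k \<noteq> c" "inverse (x ^ k) \<noteq> c" "inverse (y ^ k) \<noteq> c" "inverse (z ^ k) \<noteq> c"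
  shows "csum k c (six x' y' z') \<noteq> 0"
  using S[OF assms(1)] S0 assms by (auto simp: csum_six[OF t])

lemma unit_N:
  "N x * cnj (N x) = 1" "N y * cnj (N y) = 1" "N z * cnj (N z) = 1" "N x * N y * N z = 1"
  "N x' * cnj (N x') = 1" "N y' * cnj (N y') = 1" "N z' * cnj (N z') = 1" "N x' * N y' * N z' = 1"
  using tri_N[OF t] tri_N[OF t'] by (auto simp: unit_triple_def)

lemma N_power_root: "w ^ (7 * k) = 1 \<Longrightarrow> N w ^ k = 1"
proof -
  assume w: "w ^ (7 * k) = 1"
  obtain j where j: "1 + k * t = 7 * j" using t7 by auto
  have "N w ^ k = (w ^ (7 * k)) ^ j" unfolding N_def j by (simp add: mult_ac flip: power_mult)
  then show ?thesis using w by simp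
qed

text \<open>The class equations make S real with S^2 = 1, and N z' = 1. Computing the squared
  modulus of N y + cnj (N z) = S + 1 in two ways gives 2 + S = 2 + 2 * S.\<close>

lemma pattern_one_a:
  assumes cl: "x ^ k = 1" "y ^ k = a" "a \<noteq> 1" "x' ^ k = a ^ 2" "y' ^ k = inverse (a ^ 3)"
  shows False
proof -
  have a7: "a ^ 7 = 1" using class_7(2) cl by simp
  note a = seventh_root_powers[OF a7 cl(3)]
  have z: "z ^ k = a ^ 6" using tri_class[OF t, of k] cl a(1) by (auto simp: a(2) field_simps simp flip: a(2))
  have z': "z' ^ k = a"
    using tri_class[OF t', of k] cl a(1) by (simp add: field_simps eval_nat_numeral)
  have y': "y' ^ k = a ^ 4" using cl a by simp
  have ai: "(a ^ i) ^ 7 = 1" for i using a7 by (metis mult.commute power_mult power_one)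
  have e1: "x + cnj x = S" using nsum[of 1] cl(1-4) z y' z' by (simp add: a N_class_1)
  have e2: "- N x' = S" using nsum[of "a ^ 2"] ai cl(1-4) z y' z' by (simp add: a)
  have e5: "- cnj (N x') = S" using nsum[of "a ^ 5"] ai cl(1-4) z y' z' by (simp add: a)
  have e4: "- N y' = S" using nsum[of "a ^ 4"] ai cl(1-4) z y' z' by (simp add: a)
  have ea: "N y + cnj (N z) - N z' = S" using nsum[of a] a7 cl(1-4) z y' z' by (simp add: a)
  have SS: "S * S = 1" using unit_N(5) e2 e5 by (metis minus_mult_minus)
  have "N z' = 1" using unit_N(8) e2 e4 SS by (metis minus_mult_minus mult_1)
  then have s: "N y + cnj (N z) = S + 1" using ea by (simp add: algebra_simps)
  have "N y + cnj (N z) = N y * (1 + x)" using tri_add_cnj[OF tri_N[OF t]] cl(1) by (simp add: N_class_1)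
  then have "(N y * (1 + x)) * cnj (N y * (1 + x)) = (S + 1) * cnj (S + 1)" using s by simp
  moreover have "(N y * (1 + x)) * cnj (N y * (1 + x)) = (N y * cnj (N y)) * (1 + (x + cnj x) + x * cnj x)"
    by (simp add: algebra_simps)
  moreover have "cnj S = S" using e1 by (metis add.commute complex_cnj_add complex_cnj_cnj)
  ultimately have "2 + S = (S + 1) * (S + 1)" using unit_N(2) e1 t by (simp add: unit_triple_def)
  then have "S = 0" using SS by (simp add: algebra_simps)
  then show False using S0 by simp
qed

text \<open>The equations give S = -1, so x is a primitive cube root of unity and N y = N z = x;
  then \<open>gen\<close> forces k to divide 3. But N x' is a k-th root of unity with cube
  -1.\<close>

lemma pattern_one_b:
  assumes cl: "x ^ k = 1" "y ^ k = a" "a \<noteq> 1" "x' ^ k = a ^ 2" "y' ^ k = a ^ 3"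
  shows False
proof -
  have a7: "a ^ 7 = 1" using class_7(2) cl by simp
  note a = seventh_root_powers[OF a7 cl(3)]
  have z: "z ^ k = a ^ 6" using tri_class[OF t, of k] cl a(1) by (auto simp: a(2) field_simps simp flip: a(2))
  have "a ^ 5 * z' ^ k = 1"
    using tri_class[OF t', of k] cl by (simp flip: power_add)
  then have z': "z' ^ k = a ^ 2" by (rule power_cancel[OF a7]) simp
  have ai: "(a ^ i) ^ 7 = 1" for i using a7 by (metis mult.commute power_mult power_one)
  have e1: "x + cnj x = S" using nsum[of 1] cl z z' by (simp add: a N_class_1)
  have e2: "- (N x' + N z') = S" using nsum[of "a ^ 2"] ai cl z z' by (simp add: a)
  have e3: "- N y' = S" using nsum[of "a ^ 3"] ai cl z z' by (simp add: a)
  have e4: "- cnj (N y') = S" using nsum[of "a ^ 4"] ai cl z z' by (simp add: a)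
  have ea: "N y + cnj (N z) = S" using nsum[of a] a7 cl z z' by (simp add: a)
  have SS: "S * S = 1" using unit_N(6) e3 e4 by (metis minus_mult_minus)
  have cS: "cnj S = S" using e1 by (metis add.commute complex_cnj_add complex_cnj_cnj)
  have s: "N x' + N z' = - S" and y': "N y' = - S" using e2 e3 by (metis minus_minus)+
  have "N x' * N z' * cnj (- S) = - S" using unit_sum_prod[OF unit_N(5,7)] unfolding s .
  then have xz: "N x' * N z' = 1" using cS S0 by simp
  have "N x' * N z' * N y' = 1" using unit_N(8) by (simp add: mult_ac)
  then have S1: "S = -1" using xz y' by (metis minus_minus mult_1)
  have "x * (x + cnj x) = x * x + x * cnj x" by (simp add: distrib_left)
  then have x2: "x * x + x + 1 = 0" using e1 S1 t by (simp add: unit_triple_def add_eq_0_iff)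
  have "x ^ 3 - 1 = (x - 1) * (x * x + x + 1)" by (simp add: algebra_simps eval_nat_numeral)
  then have x3: "x ^ 3 = 1" using x2 by simp
  have "N y + cnj (N z) = N y * (1 + x)" using tri_add_cnj[OF tri_N[OF t]] cl(1) by (simp add: N_class_1)
  then have "N y * (1 + x) = -1" using ea S1 by simp
  moreover have "1 + x = - (x * x)" using x2 by (simp add: eq_neg_iff_add_eq_0 add_ac)
  ultimately have h: "N y * (x * x) = 1" by simp
  have "N y = N y * x ^ 3" using x3 by simp
  also have "\<dots> = N y * (x * x) * x" by (simp add: eval_nat_numeral mult.assoc)
  finally have Ny: "N y = x" using h by simp
  have "x * x * N z = x * x * x" using unit_N(4) Ny cl(1) x3 by (simp add: N_class_1 eval_nat_numeral mult.assoc)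
  moreover have "x \<noteq> 0" using t by (auto simp: unit_triple_def)
  ultimately have Nz: "N z = x" by simp
  have N3: "w ^ ((1 + k * t) * 3) = N w ^ 3" for w by (simp only: N_def power_mult)
  have "7 * k dvd (1 + k * t) * 3"
    using gen[of "(1 + k * t) * 3"] unfolding N3 Ny Nz N_class_1[OF cl(1)] x3 by simp
  then have "k dvd 3 + k * (t * 3)" by (auto simp: algebra_simps dest: dvd_mult_right)
  then have "k dvd 3" by (metis dvd_add_left_iff dvd_triv_left)
  then obtain j where j: "3 = k * j" unfolding dvd_def by blast
  have "N x' ^ k = 1" by (rule N_power_root, rule roots) (simp add: six_def)
  then have "N x' ^ 3 = 1" unfolding j power_mult by simp
  moreover have "N x' ^ 3 = - 1"
  proof -
    have "N z' = 1 - N x'" using s S1 by (simp add: algebra_simps)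
    then have q: "N x' * (1 - N x') = 1" using xz by simp
    have "N x' ^ 3 = - 1 + (N x' + 1) * (1 - N x' * (1 - N x'))"
      by (simp add: algebra_simps eval_nat_numeral)
    then show ?thesis unfolding q by simp
  qed
  ultimately show False by simp
qed

text \<open>Here S = 1, N z = 1 and N x + N y = N x * N y = 1, so N x and N y are the primitive
  sixth roots of unity, while x' + cnj x' = -1 makes x' a primitive cube root of unity. No
  contradiction arises: this is the sporadic family.\<close>

lemma pattern_two:
  assumes cl: "x ^ k = a" "y ^ k = a" "a \<noteq> 1" "x' ^ k = 1" "y' ^ k = a ^ 3"
  shows "exceptional k (six x y z) (six x' y' z')"
proof -
  have a7: "a ^ 7 = 1" using class_7(2) cl by simp
  note a = seventh_root_powers[OF a7 cl(3)]
  have "a ^ 2 * z ^ k = 1" "a ^ 3 * z' ^ k = 1"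
    using tri_class[OF t, of k] tri_class[OF t', of k] cl by (simp_all add: power2_eq_square)
  then have z: "z ^ k = a ^ 5" and z': "z' ^ k = a ^ 4" by (auto intro: power_cancel[OF a7])
  have ai: "(a ^ i) ^ 7 = 1" for i using a7 by (metis mult.commute power_mult power_one)
  have e1: "- (x' + cnj x') = S" using nsum[of 1] cl z z' by (simp add: a N_class_1)
  have e5: "N z = S" using nsum[of "a ^ 5"] ai cl z z' by (simp add: a)
  have e2: "cnj (N z) = S" using nsum[of "a ^ 2"] ai cl z z' by (simp add: a)
  have ea: "N x + N y = S" using nsum[of a] a7 cl z z' by (simp add: a)
  have SS: "S * S = 1" using unit_N(3) e5 e2 by simp
  have cS: "cnj S = S" using e5 e2 by simp
  have "N x * N y * S = S * S" using unit_N(4) e5 SS by simp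
  then have xy: "N x * N y = S" using S0 by simp
  have "N x * N y * cnj S = S" using unit_sum_prod[OF unit_N(1,2)] unfolding ea .
  then have S1: "S = 1" using xy cS SS by simp
  have Ny: "N y = 1 - N x" using ea S1 by (simp add: algebra_simps)
  then have q: "N x * (1 - N x) = 1" using xy S1 by simp
  have X3: "N x ^ 3 = - 1"
  proof -
    have "N x ^ 3 = - 1 + (N x + 1) * (1 - N x * (1 - N x))"
      by (simp add: algebra_simps eval_nat_numeral)
    then show ?thesis unfolding q by simp
  qed
  have X6: "N x ^ 6 = 1"
  proof -
    have "N x ^ 6 = (N x ^ 3) ^ 2" by (simp flip: power_mult)
    then show ?thesis using X3 by simp
  qed
  have X5: "N x ^ 5 = N y"
  proof -
    have "N x * N x ^ 5 = N x * N y" using X6 xy S1 by (simp flip: power_Suc)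
    moreover have "N x \<noteq> 0" using X6 by auto
    ultimately show ?thesis by simp
  qed
  have Nx: "a ^ t * x = N x" and Ny': "a ^ t * y = N y" and Nz: "(a ^ 5) ^ t * z = N z"
    using N_eq cl z by blast+
  have p: "N x ^ i = (a ^ t) ^ i * x ^ i" for i unfolding Nx[symmetric] by (rule power_mult_distrib)
  have at7: "(a ^ t) ^ 7 = 1" by (rule ai)
  \<comment> \<open>The exponents come from the Chinese remainder theorem: 29 is -1 modulo 6 and 1
    modulo 7, and 12 is 0 modulo 6 and 5 modulo 7. So x ^ 29 and x ^ 12 have the 6-parts and 7-parts
    of y and z.\<close>
  have pw: "b ^ 42 = (b ^ 6) ^ 7" "b ^ 42 = (b ^ 7) ^ 6" "b ^ 29 = (b ^ 6) ^ 4 * b ^ 5" "b ^ 29 = (b ^ 7) ^ 4 * b"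
    "b ^ 12 = (b ^ 6) ^ 2" "b ^ 12 = b ^ 7 * b ^ 5" for b :: complex
    by (simp_all flip: power_mult power_add power_Suc2)
  have "N x ^ 42 = (N x ^ 6) ^ 7" "(a ^ t) ^ 42 = ((a ^ t) ^ 7) ^ 6" by (rule pw)+
  then have x42: "x ^ 42 = 1" using p[of 42] X6 at7 by simp
  have "N x ^ 29 = (N x ^ 6) ^ 4 * N x ^ 5" "(a ^ t) ^ 29 = ((a ^ t) ^ 7) ^ 4 * a ^ t"
    by (rule pw)+
  then have "a ^ t * x ^ 29 = a ^ t * y" using p[of 29] X6 X5 at7 Ny' by simp
  then have x29: "x ^ 29 = y" using a(1) by simp
  have "N x ^ 12 = (N x ^ 6) ^ 2" "(a ^ t) ^ 12 = (a ^ t) ^ 7 * (a ^ t) ^ 5" by (rule pw)+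
  moreover have "(a ^ 5) ^ t = (a ^ t) ^ 5" by (simp add: mult.commute flip: power_mult)
  ultimately have "(a ^ t) ^ 5 * x ^ 12 = (a ^ t) ^ 5 * z" using p[of 12] X6 at7 Nz e5 S1 by simp
  then have x12: "x ^ 12 = z" using a(1) by simp
  have "x' * (x' + cnj x') = x' * x' + x' * cnj x'" by (simp add: distrib_left)
  moreover have "x' + cnj x' = -1" using e1 S1 by (metis minus_minus)
  ultimately have "x' ^ 2 + x' + 1 = 0" using t' by (simp add: unit_triple_def power2_eq_square add_eq_0_iff)
  moreover have "y' ^ k \<noteq> 1" using cl a by simp
  moreover have "x' \<in># six x' y' z'" "y' \<in># six x' y' z'" by (simp_all add: six_def)
  ultimately show ?thesis unfolding exceptional_def using x42 x29 x12 cl(4) by metis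
qed

text \<open>The left sextuple fills the six nontrivial classes. If y' shares the class of x, moduli
  give S = 0 as in \<open>pattern_one_a\<close>. If y' meets none of them, N x = N y = N z = S = 1,
  so k = 1 by \<open>gen\<close>, and the trivial class gives S = -6 or S = -2.\<close>

lemma pattern_three:
  assumes cl: "x ^ k \<noteq> 1" "y ^ k \<noteq> 1" "z ^ k \<noteq> 1" "x ^ k \<noteq> y ^ k" "x ^ k \<noteq> z ^ k" "y ^ k \<noteq> z ^ k"
    and cl': "x' ^ k = 1"
      "y' ^ k = x ^ k \<or> (\<forall>s\<in>{x ^ k, y ^ k, z ^ k}. y' ^ k \<noteq> s \<and> y' ^ k \<noteq> inverse s)"
  shows False
proof -
  define a b c d where "a = x ^ k" and "b = y ^ k" and "c = z ^ k" and "d = y' ^ k"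
  have abc: "a * b * c = 1" using tri_class[OF t, of k] by (simp add: a_def b_def c_def)
  have r7: "a ^ 7 = 1" "b ^ 7 = 1" "c ^ 7 = 1" using class_7 by (simp_all add: a_def b_def c_def)
  have s7: "w \<noteq> 0 \<and> w \<noteq> inverse w" if "w ^ 7 = 1" "w \<noteq> 1" for w :: complex
    using seventh_root_powers(1,2,11)[OF that] by simp
  have o: "a \<noteq> 1" "b \<noteq> 1" "c \<noteq> 1" using cl by (simp_all add: a_def b_def c_def)
  have n: "a \<noteq> 0" "b \<noteq> 0" "c \<noteq> 0" "a \<noteq> inverse a" "b \<noteq> inverse b" "c \<noteq> inverse c"
    using s7 r7 o by blast+
  have m: "inverse a \<noteq> b" "inverse a \<noteq> c" "inverse b \<noteq> c" "a \<noteq> inverse b" "a \<noteq> inverse c" "b \<noteq> inverse c"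
    using prod_one_inverse_ne[of a b c] prod_one_inverse_ne[of a c b] prod_one_inverse_ne[of b c a] abc o
    by (simp_all add: mult_ac)
  have dd: "a \<noteq> b" "a \<noteq> c" "b \<noteq> c" using cl by (simp_all add: a_def b_def c_def)
  have cla: "x ^ k = a" "y ^ k = b" "z ^ k = c" "y' ^ k = d" by (simp_all add: a_def b_def c_def d_def)
  note ne = n m dd o n[symmetric] m[symmetric] dd[symmetric] o[symmetric]
  have d0: "d \<noteq> 0" using t' by (auto simp: d_def unit_triple_def)
  have z': "z' ^ k = inverse d" using tri_class[OF t', of k] cl' d0 by (auto simp: d_def field_simps)
  have i7: "(inverse w) ^ 7 = 1" if "w ^ 7 = 1" for w :: complex using that by (simp add: power_inverse)
  from cl'(2) show False
  proof
    assume "y' ^ k = x ^ k"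
    then have d: "d = a" by (simp add: a_def d_def)
    have eb: "N y = S" using nsum[of b] r7 by (simp add: cla z' cl'(1) d ne)
    have eb': "cnj (N y) = S" using nsum[of "inverse b"] r7 i7 by (simp add: cla z' cl'(1) d ne)
    have ec: "N z = S" using nsum[of c] r7 by (simp add: cla z' cl'(1) d ne)
    have ea: "N x - (N y' + cnj (N z')) = S" using nsum[of a] r7 by (simp add: cla z' cl'(1) d ne)
    have e1: "- (x' + cnj x') = S" using nsum[of 1] by (simp add: cla z' cl'(1) d ne N_class_1)
    have SS: "S * S = 1" using unit_N(2) eb eb' by simp
    have "N x * (S * S) = 1" using unit_N(4) eb ec by (simp add: mult_ac)
    then have Nx: "N x = 1" using SS by simp
    have cS: "cnj S = S" using eb eb' by simp
    have "N y' + cnj (N z') = 1 - S" using ea Nx by (simp add: algebra_simps)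
    then have "N y' * (1 + x') = 1 - S"
      using tri_add_cnj[OF tri_N[OF t']] cl'(1) by (simp add: N_class_1)
    then have "(N y' * (1 + x')) * cnj (N y' * (1 + x')) = (1 - S) * (1 - S)" using cS by simp
    moreover have "(N y' * (1 + x')) * cnj (N y' * (1 + x')) = (N y' * cnj (N y')) * (1 + (x' + cnj x') + x' * cnj x')"
      by (simp add: algebra_simps)
    moreover have "x' + cnj x' = - S" using e1 by (metis minus_minus)
    ultimately have "2 - S = (1 - S) * (1 - S)" using unit_N(6) t' by (simp add: unit_triple_def)
    then have "S = 0" using SS by (simp add: algebra_simps)
    then show False using S0 by simp
  next
    assume "\<forall>s\<in>{x ^ k, y ^ k, z ^ k}. y' ^ k \<noteq> s \<and> y' ^ k \<noteq> inverse s"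
    then have d: "d \<noteq> a" "d \<noteq> b" "d \<noteq> c" "d \<noteq> inverse a" "d \<noteq> inverse b" "d \<noteq> inverse c"
      by (simp_all add: cla)
    then have di: "inverse d \<noteq> a" "inverse d \<noteq> b" "inverse d \<noteq> c" by auto
    have eb: "N y = S" using nsum[of b] r7 by (simp add: cla z' cl'(1) d di ne)
    have eb': "cnj (N y) = S" using nsum[of "inverse b"] r7 i7 by (simp add: cla z' cl'(1) d di ne)
    have ec: "N z = S" using nsum[of c] r7 by (simp add: cla z' cl'(1) d di ne)
    have ea: "N x = S" using nsum[of a] r7 by (simp add: cla z' cl'(1) d di ne)
    have "S * S = 1" using unit_N(2) eb eb' by simp
    then have S1: "S = 1" using unit_N(4) eb ec ea by simp
    have "7 * k dvd 1 + k * t" using gen[of "1 + k * t"] ea eb ec S1 by (simp add: N_def)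
    then have "k dvd 1 + k * t" by (rule dvd_mult_right)
    then have k1: "k = 1" by (metis dvd_add_left_iff dvd_triv_left nat_dvd_1_iff_1)
    then have x'1: "x' = 1" using cl'(1) by simp
    show False
    proof (cases "d = 1")
      case True
      then have "y' = 1" "z' = 1" using k1 cla z' by simp_all
      then show False using nsum[of 1] S1 x'1 by (simp add: cla ne N_def)
    next
      case False
      then show False using nsum[of 1] S1 x'1 by (simp add: cla ne N_def z')
    qed
  qed
qed

text \<open>The left sextuple meets only the classes 1, a, a^6, so the right one must meet a^2 and
  a^3.\<close>

lemma not_pattern_one:
  assumes cl: "x ^ k = 1" "y ^ k \<noteq> 1"
  shows False
proof -
  define a where "a = y ^ k"
  have a7: "a ^ 7 = 1" "a \<noteq> 1" using class_7(2) cl by (simp_all add: a_def)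
  note a = seventh_root_powers[OF a7]
  have y: "y ^ k = a" by (simp add: a_def)
  have z: "z ^ k = a ^ 6" using tri_class[OF t, of k] cl(1) y by (intro power_cancel[OF a7(1), of 1]) auto
  have ai: "(a ^ i) ^ 7 = 1" for i using a7 by (metis mult.commute power_mult power_one)
  have "csum k (a ^ 2) (six x' y' z') \<noteq> 0"
    using cl(1) y z by (intro right_nonzero ai) (simp_all add: a)
  then obtain u v w where u: "unit_triple u v w" "six u v w = six x' y' z'" "u ^ k = a ^ 2"
    using six_class_wlog[OF t'] by blast
  interpret r: class_sums7 k t x y z u v w S using u by (intro change_right7)
  interpret r': class_sums7 k t x y z u w v S
    using u by (intro change_right7) (auto intro: tri_swap23 simp: six_swap23[of u w])
  have "csum k (a ^ 3) (six u v w) \<noteq> 0"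
    using cl(1) y z by (intro r.right_nonzero ai) (simp_all add: a)
  then have "v ^ k = a ^ 3 \<or> w ^ k = a ^ 3 \<or> inverse (v ^ k) = a ^ 3 \<or> inverse (w ^ k) = a ^ 3"
    using csum_six_nonzero[OF u(1), of k "a ^ 3"] u(3) by (auto simp: a)
  then have "v ^ k = a ^ 3 \<or> w ^ k = a ^ 3 \<or> v ^ k = inverse (a ^ 3) \<or> w ^ k = inverse (a ^ 3)"
    by (metis inverse_inverse_eq)
  then show False
    using r.pattern_one_a[OF cl(1) y a7(2) u(3)] r.pattern_one_b[OF cl(1) y a7(2) u(3)]
      r'.pattern_one_a[OF cl(1) y a7(2) u(3)] r'.pattern_one_b[OF cl(1) y a7(2) u(3)] by blast
qed

text \<open>The left sextuple meets a, a^2, a^5, a^6, so 1, a^3 and a^4 are left to the right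
  one.\<close>

lemma exceptional_two:
  assumes cl: "x ^ k \<noteq> 1" "y ^ k = x ^ k"
  shows "exceptional k (six x y z) (six x' y' z')"
proof -
  define a where "a = x ^ k"
  have a7: "a ^ 7 = 1" "a \<noteq> 1" using class_7(1) cl by (simp_all add: a_def)
  note a = seventh_root_powers[OF a7]
  have xy: "x ^ k = a" "y ^ k = a" using cl by (simp_all add: a_def)
  have z: "z ^ k = a ^ 5"
    using tri_class[OF t, of k] xy by (intro power_cancel[OF a7(1), of 2]) (auto simp: power2_eq_square)
  have ai: "(a ^ i) ^ 7 = 1" for i using a7 by (metis mult.commute power_mult power_one)
  have "csum k 1 (six x' y' z') \<noteq> 0"
    using xy z a7 by (intro right_nonzero) (simp_all add: a)
  then obtain u v w where u: "unit_triple u v w" "six u v w = six x' y' z'" "u ^ k = 1"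
    using six_class_wlog[OF t'] by blast
  interpret r: class_sums7 k t x y z u v w S using u by (intro change_right7)
  interpret r': class_sums7 k t x y z u w v S
    using u by (intro change_right7) (auto intro: tri_swap23 simp: six_swap23[of u w])
  have "csum k (a ^ 3) (six u v w) \<noteq> 0"
    using xy z by (intro r.right_nonzero ai) (simp_all add: a)
  then have "v ^ k = a ^ 3 \<or> w ^ k = a ^ 3 \<or> inverse (v ^ k) = a ^ 3 \<or> inverse (w ^ k) = a ^ 3"
    using csum_six_nonzero[OF u(1), of k "a ^ 3"] u(3) by (auto simp: a)
  moreover have "inverse (v ^ k) = w ^ k" "inverse (w ^ k) = v ^ k"
    using tri_class[OF u(1), of k] u(3) by (auto intro!: inverse_unique simp: mult.commute)
  ultimately have "v ^ k = a ^ 3 \<or> w ^ k = a ^ 3" by auto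
  then show ?thesis
    using r.pattern_two[OF xy a7(2) u(3)] r'.pattern_two[OF xy a7(2) u(3)] u(2)
    by (auto simp: six_swap23[of u w])
qed

lemma not_pattern_three:
  assumes cl: "x ^ k \<noteq> 1" "y ^ k \<noteq> 1" "z ^ k \<noteq> 1" "x ^ k \<noteq> y ^ k" "x ^ k \<noteq> z ^ k" "y ^ k \<noteq> z ^ k"
  shows False
proof -
  have "csum k 1 (six x' y' z') \<noteq> 0" using cl by (intro right_nonzero) auto
  then obtain u v w where u: "unit_triple u v w" "six u v w = six x' y' z'" "u ^ k = 1"
    using six_class_wlog[OF t'] by blast
  have vw: "w ^ k = inverse (v ^ k)" "v ^ k = inverse (w ^ k)"
    using tri_class[OF u(1), of k] u(3) by (auto intro!: inverse_unique[symmetric] simp: mult.commute)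
  have su: "six u w v = six x' y' z'" using u(2) by (simp add: six_swap23[of u w])
  interpret r: class_sums7 k t x y z u v w S using u by (intro change_right7)
  interpret r': class_sums7 k t x y z u w v S
    using tri_swap23[OF u(1)] su by (intro change_right7)
  interpret s: class_sums7 k t y x z u v w S
    by (rule r.change_left7) (use t g gen in \<open>auto intro: tri_swap12 generic_swap12 simp: six_swap12[of y x]\<close>)
  interpret s': class_sums7 k t y x z u w v S
    by (rule r'.change_left7) (use t g gen in \<open>auto intro: tri_swap12 generic_swap12 simp: six_swap12[of y x]\<close>)
  interpret q: class_sums7 k t z y x u v w S
    by (rule r.change_left7) (use t g gen in \<open>auto intro: tri_swap13 generic_swap13 simp: six_swap13[of z y]\<close>)
  interpret q': class_sums7 k t z y x u w v S
    by (rule r'.change_left7) (use t g gen in \<open>auto intro: tri_swap13 generic_swap13 simp: six_swap13[of z y]\<close>)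
  consider "\<forall>s\<in>{x ^ k, y ^ k, z ^ k}. v ^ k \<noteq> s \<and> v ^ k \<noteq> inverse s"
    | "v ^ k = x ^ k" | "v ^ k = y ^ k" | "v ^ k = z ^ k"
    | "w ^ k = x ^ k" | "w ^ k = y ^ k" | "w ^ k = z ^ k"
    using vw by (metis insertE empty_iff inverse_inverse_eq)
  then show False
  proof cases
    case 1
    then show False using r.pattern_three[OF cl u(3)] by blast
  next
    case 2
    then show False using r.pattern_three[OF cl u(3)] by blast
  next
    case 3
    then show False using s.pattern_three cl u(3) by metis
  next
    case 4
    then show False using q.pattern_three cl u(3) by metis
  next
    case 5
    then show False using r'.pattern_three[OF cl u(3)] by blast
  next
    case 6
    then show False using s'.pattern_three cl u(3) by metis
  next
    case 7
    then show False using q'.pattern_three cl u(3) by metis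
  qed
qed

lemma is_exceptional: "exceptional k (six x y z) (six x' y' z')"
proof -
  interpret s12: class_sums7 k t y x z x' y' z' S
    by (rule change_left7) (use t g gen in \<open>auto intro: tri_swap12 generic_swap12 simp: six_swap12[of y x]\<close>)
  interpret s23: class_sums7 k t x z y x' y' z' S
    by (rule change_left7) (use t g gen in \<open>auto intro: tri_swap23 generic_swap23 simp: six_swap23[of x z]\<close>)
  interpret s13: class_sums7 k t z y x x' y' z' S
    by (rule change_left7) (use t g gen in \<open>auto intro: tri_swap13 generic_swap13 simp: six_swap13[of z y]\<close>)
  have "\<not> 7 * k dvd k" using k0 by (auto dest: dvd_imp_le)
  then have "\<not> (x ^ k = 1 \<and> y ^ k = 1 \<and> z ^ k = 1)" using gen by blast
  then have one: "x ^ k = 1 \<Longrightarrow> y ^ k \<noteq> 1" "y ^ k = 1 \<Longrightarrow> x ^ k \<noteq> 1" "z ^ k = 1 \<Longrightarrow> y ^ k \<noteq> 1"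
    using tri_class[OF t, of k] by auto
  have n1: "x ^ k \<noteq> 1" "y ^ k \<noteq> 1" "z ^ k \<noteq> 1"
    using not_pattern_one s12.not_pattern_one s13.not_pattern_one one by blast+
  note sw = six_swap12[of y x z] six_swap23[of x z y] six_swap13[of z y x]
  consider "y ^ k = x ^ k" | "z ^ k = x ^ k" | "y ^ k = z ^ k"
    | "x ^ k \<noteq> y ^ k" "x ^ k \<noteq> z ^ k" "y ^ k \<noteq> z ^ k" by metis
  then show ?thesis
  proof cases
    case 1
    then show ?thesis using exceptional_two n1 by blast
  next
    case 2
    then have "exceptional k (six x z y) (six x' y' z')" using s23.exceptional_two n1 by blast
    then show ?thesis by (simp only: sw)
  next
    case 3
    then have "exceptional k (six z y x) (six x' y' z')" using s13.exceptional_two n1 by blast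
    then show ?thesis by (simp only: sw)
  next
    case 4
    then show ?thesis using not_pattern_three n1 by blast
  qed
qed

end

section \<open>From one equality of sums to equality of sextuples when n does not divide 30\<close>

section \<open>Equal sums\<close>

text \<open>Otherwise n is squarefree with prime factors among 2, 3, 5.\<close>

lemma not_dvd_30_cases:
  fixes n :: nat
  assumes "n > 0" "\<not> n dvd 30"
  shows "4 dvd n \<or> 9 dvd n \<or> (\<exists>p. prime p \<and> p \<ge> 5 \<and> p ^ 2 dvd n) \<or> (\<exists>p. prime p \<and> p \<ge> 7 \<and> p dvd n)"
proof (rule ccontr)
  assume h: "\<not> ?thesis"
  have small: "p \<in> {2, 3, 5}" if "prime p" "p dvd n" for p
  proof -
    have "p < 7" using h that by (meson not_le)
    then have "p \<in> {0, 1, 2, 3, 4, 5, 6}" by auto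
    moreover have "\<not> prime (4::nat)" "\<not> prime (6::nat)" by simp_all
    ultimately show ?thesis using that(1) by auto
  qed
  have "squarefree n"
    unfolding squarefree_def
  proof (intro allI impI)
    fix d assume d: "d\<^sup>2 dvd n"
    show "is_unit d"
    proof (rule ccontr)
      assume "\<not> is_unit d"
      then obtain p where p: "prime p" "p dvd d" using prime_factor_nat[of d] by auto
      then have "p ^ 2 dvd n" using d by (meson dvd_power_same dvd_trans)
      moreover from this have "p dvd n" by (metis dvd_trans dvd_triv_left power2_eq_square)
      then have "p \<in> {2, 3, 5}" using small p by blast
      ultimately show False using h p(1) by auto
    qed
  qed
  then have "\<forall>p\<in>prime_factors n. multiplicity p n = 1"
    using assms(1) squarefree_factorial_semiring'[of n] by simp
  then have "(\<Prod>p\<in>prime_factors n. p ^ multiplicity p n) = \<Prod>(prime_factors n)"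
    by (intro prod.cong) simp_all
  then have "n = \<Prod>(prime_factors n)" using assms(1) prod_prime_factors[of n] by simp
  also have "\<dots> dvd \<Prod>{2, 3, 5::nat}"
    using small by (intro prod_dvd_prod_subset) (auto simp: in_prime_factors_iff)
  finally show False using assms(2) by simp
qed

lemma csum_zero:
  assumes "\<And>z. z \<in># A \<Longrightarrow> (z ^ k) ^ p = 1" "c ^ p \<noteq> 1"
  shows "csum k c A = 0"
  using assms(1) assms(2) by (induction A) (auto simp: csum_def)

lemma class_set_six:
  assumes "unit_triple u v w"
  shows "(\<lambda>z. z ^ k) ` set_mset (six u v w) =
    {u ^ k, v ^ k, w ^ k, inverse (u ^ k), inverse (v ^ k), inverse (w ^ k)}"
  using assms by (simp add: six_def unit_triple_def unit_power_cnj)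

text \<open>If one of the three classes is trivial, the other two are mutually inverse.\<close>

lemma card_class_set_six:
  assumes "unit_triple u v w"
  shows "card ((\<lambda>z. z ^ k) ` set_mset (six u v w)) \<le> 6"
    and "1 \<in> (\<lambda>z. z ^ k) ` set_mset (six u v w) \<Longrightarrow> card ((\<lambda>z. z ^ k) ` set_mset (six u v w)) \<le> 3"
proof -
  let ?C = "(\<lambda>z. z ^ k) ` set_mset (six u v w)"
  have len: "card (set xs) \<le> length xs" for xs :: "complex list" by (rule card_length)
  show "card ?C \<le> 6"
    using len[of "[u ^ k, v ^ k, w ^ k, inverse (u ^ k), inverse (v ^ k), inverse (w ^ k)]"]
    by (simp add: class_set_six[OF assms])
  assume "1 \<in> ?C"
  then have "u ^ k = 1 \<or> v ^ k = 1 \<or> w ^ k = 1"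
    unfolding class_set_six[OF assms] by (auto simp: eq_commute[of 1])
  moreover have "card ((\<lambda>z. z ^ k) ` set_mset (six u v w)) \<le> 3" if "unit_triple u v w" "u ^ k = 1" for u v w
  proof -
    have "inverse (v ^ k) = w ^ k" "inverse (w ^ k) = v ^ k"
      using tri_class[OF that(1), of k] that(2) by (auto intro!: inverse_unique simp: mult.commute)
    then have "(\<lambda>z. z ^ k) ` set_mset (six u v w) = set [1, v ^ k, w ^ k]"
      unfolding class_set_six[OF that(1)] using that(2) by auto
    then show ?thesis using len[of "[1, v ^ k, w ^ k]"] by simp
  qed
  from this[of u v w] this[of v u w] this[of w v u]
  have "u ^ k = 1 \<Longrightarrow> card ?C \<le> 3" "v ^ k = 1 \<Longrightarrow> card ?C \<le> 3" "w ^ k = 1 \<Longrightarrow> card ?C \<le> 3"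
    using assms tri_swap12[OF assms] tri_swap13[OF assms]
    by (simp_all add: six_swap12[of v u] six_swap13[of w v])
  ultimately show "card ?C \<le> 3" by blast
qed

lemma six_eq_or_exceptional:
  assumes n: "n > 0" "\<not> n dvd 30" and t: "unit_triple x y z" and t': "unit_triple x' y' z'" and g: "generic x y z"
    and roots: "\<And>w. w \<in># six x y z + six x' y' z' \<Longrightarrow> w ^ n = 1"
    and gen: "\<And>d. x ^ d = 1 \<Longrightarrow> y ^ d = 1 \<Longrightarrow> z ^ d = 1 \<Longrightarrow> n dvd d"
    and eq: "(\<Sum>w\<in>#six x y z. w) = (\<Sum>w\<in>#six x' y' z'. w)"
  shows "six x y z = six x' y' z' \<or> 7 dvd n \<and> exceptional (n div 7) (six x y z) (six x' y' z')"
proof -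
  have rA: "\<And>w. w \<in># six x y z \<Longrightarrow> w ^ n = 1" and rB: "\<And>w. w \<in># six x' y' z' \<Longrightarrow> w ^ n = 1"
    using roots by auto
  have cl: "(w ^ k) ^ p = 1" if "n = p * k" "w \<in># six x y z + six x' y' z'" for p k w
    using roots[OF that(2)] that(1) by (metis mult.commute power_mult)
  have nt: "\<not> (x ^ k = 1 \<and> y ^ k = 1 \<and> z ^ k = 1)" if "n = p * k" "p > 1" for p k
  proof
    assume "x ^ k = 1 \<and> y ^ k = 1 \<and> z ^ k = 1"
    then have "n dvd k" using gen by blast
    moreover have "k > 0" using n(1) that by (cases k) auto
    ultimately have "p * k \<le> k" using that(1) by (auto dest: dvd_imp_le)
    moreover have "2 * k \<le> p * k" using that(2) by (intro mult_right_mono) auto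
    ultimately show False using \<open>k > 0\<close> by simp
  qed
  have all_c: "csum k c (six x y z) = csum k c (six x' y' z')"
    if "n = p * k" "\<And>c. c ^ p = 1 \<Longrightarrow> csum k c (six x y z) = csum k c (six x' y' z')" for p k c
  proof (cases "c ^ p = 1")
    case False
    then show ?thesis using csum_zero[of "six x y z" k p c] csum_zero[of "six x' y' z'" k p c] cl[OF that(1)]
      by simp
  qed (use that in simp)
  have sq: "csum k c (six x y z) = csum k c (six x' y' z')" if "n = p * k" "prime p" "p dvd k" for p k c
    by (rule all_c[OF that(1)], rule csum_eq_of_square_dvd[OF that(1) n(1) that(2,3) rA rB eq])
  have ge5: "six x y z = six x' y' z'"
    if h: "n = p * k" "prime p" "p \<ge> 5" "p = 5 \<longrightarrow> 5 dvd k"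
      and hS: "\<And>c. csum k c (six x y z) = csum k c (six x' y' z')" for p k
  proof -
    interpret class_sums5 p k x y z x' y' z'
    proof
      fix w :: complex assume w: "w ^ 5 = 1" "p = 5"
      then obtain j where "k = 5 * j" using h(4) by auto
      then show "w ^ k = 1" using w(1) by (simp add: power_mult)
    next
      show "(w ^ k) ^ p = 1" if "w \<in># six x y z + six x' y' z'" for w
        by (rule cl[OF h(1) that])
    qed (fact t t' g hS h(2,3))+
    show ?thesis using six_eq nt[OF h(1)] h(3) by simp
  qed
  consider (a) "4 dvd n" | (b) "\<not> 4 dvd n" "9 dvd n" | (c) p where "prime p" "p \<ge> 5" "p ^ 2 dvd n"
    | (d) p where "prime p" "p \<ge> 7" "p dvd n" "\<not> p ^ 2 dvd n"
  proof -
    have c7: "p \<ge> 5" if "p \<ge> 7" for p :: nat using that by simp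
    from not_dvd_30_cases[OF n] show thesis
      using that c7 by blast
  qed
  then show ?thesis
  proof cases
    case a
    then obtain k where k: "n = 2 * (2 * k)" by auto
    have "six x y z = six x' y' z'"
      by (rule six_eq_mod_2[OF t t' g _ cl[OF k] nt[OF k]], rule sq[OF k]) simp_all
    then show ?thesis ..
  next
    case b
    then obtain k where k: "n = 3 * (3 * k)" by auto
    interpret class_sums3 "3 * k" x y z x' y' z'
    proof
      show "csum (3 * k) c (six x y z) = csum (3 * k) c (six x' y' z')" for c
        by (rule sq[OF k]) simp_all
      fix w assume w: "w \<in># six x y z + six x' y' z'"
      show "(w ^ (3 * k)) ^ 3 = 1" by (rule cl[OF k w])
      \<comment> \<open>Such a w has w ^ 4 = 1, and as 4 does not divide n, each possible remainder
        of n modulo 4 contradicts w ^ n = 1.\<close>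
      show "w ^ 2 \<noteq> -1"
      proof
        assume w2: "w ^ 2 = -1"
        have w4: "w ^ 4 = 1" using w2 by (metis mult_2 numeral_Bit0 power2_eq_square power_add minus_mult_minus mult_1)
        have "w ^ n = w ^ (4 * (n div 4) + n mod 4)" by simp
        also have "\<dots> = w ^ (n mod 4)" by (simp only: power_add power_mult w4 power_one mult_1)
        finally have w1: "w ^ (n mod 4) = 1" using roots[OF w] by simp
        have "n mod 4 \<noteq> 0" using b(1) by (simp add: dvd_eq_mod_eq_0)
        then have "n mod 4 = 1 \<or> n mod 4 = 2 \<or> n mod 4 = 3" by linarith
        then show False
        proof (elim disjE)
          assume "n mod 4 = 1"
          then have "w = 1" using w1 by simp
          then show False using w2 by simp
        next
          assume "n mod 4 = 2"
          then show False using w1 w2 by simp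
        next
          assume m: "n mod 4 = 3"
          have "w ^ 3 = w ^ 2 * w" by (simp add: eval_nat_numeral)
          then have "- w = 1" using w1 w2 m by simp
          then have "w = -1" by (metis minus_minus)
          then show False using w2 by simp
        qed
      qed
    next
      fix w :: complex assume "w ^ 3 = 1"
      then show "w ^ (3 * k) = 1" by (simp add: power_mult)
    qed (fact t t' g)+
    show ?thesis using six_eq3 nt[OF k] by simp
  next
    case c
    then obtain k where k: "n = p * (p * k)" by (auto simp: power2_eq_square mult.assoc)
    have "six x y z = six x' y' z'"
      by (rule ge5[OF k c(1,2)], simp, rule sq[OF k c(1)]) simp
    then show ?thesis ..
  next
    case d
    then obtain k where k: "n = p * k" by auto
    have pk: "\<not> p dvd k" using d(4) k by (auto simp: power2_eq_square)
    have k0: "k > 0" using k n(1) by (cases k) auto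
    have "p \<noteq> 8" "p \<noteq> 9" "p \<noteq> 10" using d(1) by auto
    then have "p = 7 \<or> p \<ge> 11" using d(2) by auto
    then show ?thesis
    proof
      assume p7: "p = 7"
      obtain t0 S where t0: "p dvd 1 + k * t0"
        and S: "\<forall>c. c ^ p = 1 \<longrightarrow> c ^ t0 * csum k c (six x y z) - c ^ t0 * csum k c (six x' y' z') = S"
        using csum_power_diff_const[OF k n(1) d(1) pk rA rB eq] by auto
      show ?thesis
      proof (cases "S = 0")
        case True
        have s: "csum k c (six x y z) = csum k c (six x' y' z')" if "c ^ p = 1" for c
        proof -
          have "c \<noteq> 0" using that p7 by auto
          then show ?thesis using S[rule_format, OF that] True by simp
        qed
        have "six x y z = six x' y' z'"
          by (rule ge5[OF k d(1)], use p7 in simp, use p7 in simp, rule all_c[OF k], rule s)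
        then show ?thesis ..
      next
        case False
        interpret class_sums7 k t0 x y z x' y' z' S
        proof
          show "c ^ t0 * csum k c (six x y z) - c ^ t0 * csum k c (six x' y' z') = S" if "c ^ 7 = 1" for c
            using S that p7 by simp
          show "7 dvd 1 + k * t0" using t0 p7 by simp
          show "w ^ (7 * k) = 1" if "w \<in># six x y z + six x' y' z'" for w
            using roots[OF that] k p7 by simp
          show "7 * k dvd d" if "x ^ d = 1" "y ^ d = 1" "z ^ d = 1" for d
            using gen[OF that] k p7 by simp
        qed (fact t t' g False k0)+
        show ?thesis using is_exceptional k p7 by simp
      qed
    next
      assume p11: "p \<ge> 11"
      let ?C = "\<lambda>M. (\<lambda>z. z ^ k) ` set_mset M"
      \<comment> \<open>If all p classes were met, the trivial one would be among them; one sextuple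
        would then meet at most three classes, and 6 + 3 < p.\<close>
      have "\<exists>e. e ^ p = 1 \<and> e \<notin> ?C (six x y z) \<union> ?C (six x' y' z')"
      proof (rule ccontr)
        assume "\<not> ?thesis"
        then have sub: "{e. e ^ p = 1} \<subseteq> ?C (six x y z) \<union> ?C (six x' y' z')" by blast
        then have "p \<le> card (?C (six x y z) \<union> ?C (six x' y' z'))"
          using card_roots_unity_eq[of p] p11 card_mono[OF _ sub] by simp
        also have "\<dots> \<le> card (?C (six x y z)) + card (?C (six x' y' z'))" by (rule card_Un_le)
        also have "\<dots> \<le> 9"
        proof -
          have "1 \<in> ?C (six x y z) \<or> 1 \<in> ?C (six x' y' z')" proof -
            have "(1::complex) \<in> {e. e ^ p = 1}" by simp
            then show ?thesis using sub by blast
          qed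
          then show ?thesis
            using card_class_set_six[OF t, of k] card_class_set_six[OF t', of k] by linarith
        qed
        finally show False using p11 by simp
      qed
      then obtain e where e: "e ^ p = 1" "e \<notin># image_mset (\<lambda>z. z ^ k) (six x y z + six x' y' z')"
        by auto
      have s: "csum k c (six x y z) = csum k c (six x' y' z')" if "c ^ p = 1" for c
        by (rule csum_eq_of_empty_class[OF k n(1) d(1) rA rB eq that e])
      have "six x y z = six x' y' z'"
        by (rule ge5[OF k d(1)], use p11 in simp, use p11 in simp, rule all_c[OF k], rule s)
      then show ?thesis ..
    qed
  qed
qed

section \<open>Triples containing -1 or an opposite pair, and the sporadic family\<close>

section \<open>Degenerate sextuples\<close>

definition primitive_root :: "nat \<Rightarrow> complex \<Rightarrow> bool" where
  "primitive_root n w \<longleftrightarrow> w ^ n = 1 \<and> (\<forall>d. w ^ d = 1 \<longrightarrow> n dvd d)"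

text \<open>For n > 0, n is the order of the cyclic group generated by A.\<close>

definition generates :: "complex multiset \<Rightarrow> nat \<Rightarrow> bool" where
  "generates A n \<longleftrightarrow> (\<forall>w\<in>#A. w ^ n = 1) \<and> (\<forall>d. (\<forall>w\<in>#A. w ^ d = 1) \<longrightarrow> n dvd d)"

lemma generates_six:
  assumes "unit_triple x y z" "generates (six x y z) n" "x ^ d = 1" "y ^ d = 1" "z ^ d = 1"
  shows "n dvd d"
proof -
  have "\<forall>w\<in>#six x y z. w ^ d = 1"
    using assms(1,3-5) by (auto simp: six_def simp flip: complex_cnj_power)
  then show ?thesis using assms(2) by (auto simp: generates_def)
qed

lemma image_power_six: "image_mset (\<lambda>w. w ^ u) (six x y z) = six (x ^ u) (y ^ u) (z ^ u)"
  by (simp add: six_def)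

lemma tri_power: "unit_triple x y z \<Longrightarrow> unit_triple (x ^ u) (y ^ u) (z ^ u)"
  unfolding unit_triple_def by (metis complex_cnj_power power_mult_distrib power_one)

text \<open>If a prime q divided both u and n = q * b, the u-th powers would already be killed by
  b.\<close>

lemma coprime_of_power:
  assumes "generates (image_mset (\<lambda>w. w ^ u) B) n" "\<forall>w\<in>#B. w ^ n = 1" "n > 0"
  shows "coprime u n"
proof (rule ccontr)
  assume "\<not> coprime u n"
  then have "gcd u n \<noteq> 1" by (simp only: coprime_iff_gcd_eq_1 not_False_eq_True)
  from prime_factor_nat[OF this] obtain q where "prime q" "q dvd gcd u n" by auto
  then have q: "prime q" "q dvd u" "q dvd n" by auto
  then obtain a b where ab: "u = q * a" "n = q * b" by (auto elim!: dvdE)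
  have "(w ^ u) ^ b = 1" if "w \<in># B" for w
  proof -
    have "(w ^ u) ^ b = (w ^ n) ^ a" unfolding ab by (simp add: mult_ac flip: power_mult)
    then show ?thesis using assms(2) that by simp
  qed
  then have "n dvd b" using assms(1) by (auto simp: generates_def)
  moreover have "b > 0" using ab assms(3) by (cases b) auto
  ultimately have "q * b \<le> b" using ab by (auto dest: dvd_imp_le)
  moreover have "2 * b \<le> q * b" using prime_ge_2_nat[OF q(1)] by (rule mult_right_mono) simp
  ultimately show False using \<open>b > 0\<close> by simp
qed

lemma power_inverse_mset:
  assumes "coprime u n" "\<forall>w\<in>#B. w ^ n = (1::complex)" "A = image_mset (\<lambda>w. w ^ u) B"
  shows "\<exists>v. coprime v n \<and> B = image_mset (\<lambda>w. w ^ v) A"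
proof -
  obtain v where v: "[u * v = 1] (mod n)" using cong_solve_coprime_nat[OF assms(1)] by auto
  have "coprime v n"
    using v by (metis coprime_iff_invertible_nat mult.commute One_nat_def)
  moreover have "(w ^ u) ^ v = w" if "w \<in># B" for w
  proof (cases "n = 0")
    case True
    then have "u * v = 1" using v by (simp add: cong_def)
    then show ?thesis by (simp flip: power_mult)
  next
    case False
    have w: "w ^ m = w ^ (m mod n)" for m
    proof -
      have "w ^ m = w ^ (n * (m div n) + m mod n)" by simp
      also have "\<dots> = w ^ (m mod n)" using assms(2) that by (simp only: power_add power_mult) simp
      finally show ?thesis .
    qed
    have "(w ^ u) ^ v = w ^ (u * v)" by (simp add: power_mult)
    also have "\<dots> = w ^ 1" using w[of "u * v"] w[of 1] v by (simp add: cong_def)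
    finally show ?thesis by simp
  qed
  then have "image_mset (\<lambda>w. w ^ v) A = image_mset (\<lambda>w. w) B"
    unfolding assms(3) by (simp add: image_mset.compositionality comp_def cong: image_mset_cong)
  ultimately show ?thesis by auto
qed

text \<open>The first n powers of v are distinct, hence exhaust the n-th roots of unity.\<close>

lemma primitive_root_power:
  assumes "n > 0" "primitive_root n v" "w ^ n = 1"
  shows "\<exists>u. w = v ^ u"
proof -
  have inj: "inj_on (\<lambda>i. v ^ i) {..<n}"
  proof (rule inj_onI)
    have *: "i = j" if "i \<le> j" "j < n" "v ^ i = v ^ j" for i j
    proof -
      have "v \<noteq> 0" using assms(1,2) by (auto simp: primitive_root_def power_0_left)
      moreover have "v ^ j = v ^ i * v ^ (j - i)" using power_add[of v i "j - i"] that(1) by simp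
      ultimately have "v ^ (j - i) = 1" using that(3) by auto
      then have "n dvd j - i" using assms(2) by (auto simp: primitive_root_def)
      then show "i = j" using that by (auto dest: dvd_imp_le)
    qed
    fix i j assume "i \<in> {..<n}" "j \<in> {..<n}" "v ^ i = v ^ j"
    then show "i = j" using *[of i j] *[of j i] by (cases "i \<le> j") auto
  qed
  have "(\<lambda>i. v ^ i) ` {..<n} = {z. z ^ n = 1}"
  proof (rule card_subset_eq)
    show "finite {z::complex. z ^ n = 1}" using assms(1) by (intro finite_roots_unity) auto
    show "(\<lambda>i. v ^ i) ` {..<n} \<subseteq> {z. z ^ n = 1}"
    proof
      fix z assume "z \<in> (\<lambda>i. v ^ i) ` {..<n}"
      then obtain i where "z = v ^ i" by auto
      then have "z ^ n = (v ^ n) ^ i" by (simp add: mult.commute flip: power_mult)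
      then show "z \<in> {z. z ^ n = 1}" using assms(2) by (simp add: primitive_root_def)
    qed
    show "card ((\<lambda>i. v ^ i) ` {..<n}) = card {z::complex. z ^ n = 1}"
      using assms(1) card_roots_unity_eq[of n] card_image[OF inj] by simp
  qed
  then show ?thesis using assms(3) by auto
qed

text \<open>The products of two elements are conjugates of the third. Consequently the sum is -2
  exactly when the triple contains -1, whatever its other elements are.\<close>

lemma two_plus_sum_six:
  assumes "unit_triple x y z"
  shows "2 + (\<Sum>w\<in>#six x y z. w) = (1 + x) * (1 + y) * (1 + z)"
  using tri_cnj_eq[OF assms] assms by (simp add: six_def unit_triple_def algebra_simps)

definition minus_one_six :: "complex \<Rightarrow> complex multiset" where "minus_one_six w = six (-1) w (- cnj w)"

definition opposite_six :: "complex \<Rightarrow> complex multiset" where "opposite_six w = six w (- w) (- (cnj w)\<^sup>2)"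

lemma not_generic_cases:
  assumes t: "unit_triple x y z" and "\<not> generic x y z"
  shows "\<exists>w. w * cnj w = 1 \<and> (six x y z = minus_one_six w \<or> six x y z = opposite_six w)"
proof -
  have one: "six x y z = minus_one_six y" if "unit_triple x y z" "x = -1" for x y z
  proof -
    have "z = - cnj y" using tri_cnj_eq(2)[OF that(1)] that(2) by simp
    then show ?thesis using that(2) by (simp add: minus_one_six_def)
  qed
  have two: "six x y z = opposite_six x" if "unit_triple x y z" "x + y = 0" for x y z
  proof -
    have y: "y = - x" using that(2) by (simp add: eq_neg_iff_add_eq_0 add.commute)
    have "z = cnj (cnj z)" by simp
    also have "\<dots> = - (cnj x)\<^sup>2" using tri_cnj_eq(3)[OF that(1)] y by (simp add: power2_eq_square)
    finally show ?thesis using y by (simp add: opposite_six_def)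
  qed
  have u: "x * cnj x = 1" "y * cnj y = 1" "z * cnj z = 1" using t by (auto simp: unit_triple_def)
  from assms(2) consider "x = -1" | "y = -1" | "z = -1" | "x + y = 0" | "y + z = 0" | "x + z = 0"
    unfolding generic_def by blast
  then show ?thesis
  proof cases
    case 1
    then show ?thesis using one[OF t] u by blast
  next
    case 2
    then show ?thesis using one[OF tri_swap12[OF t]] u six_swap12[of x y z] by metis
  next
    case 3
    then show ?thesis using one[OF tri_swap13[OF t]] u six_swap13[of x y z] by metis
  next
    case 4
    then show ?thesis using two[OF t] u by blast
  next
    case 5
    then have "z + y = 0" by (simp add: add.commute)
    then show ?thesis using two[OF tri_swap13[OF t]] u six_swap13[of x y z] by metis
  next
    case 6
    then show ?thesis using two[OF tri_swap23[OF t]] u six_swap23[of x y z] by metis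
  qed
qed

text \<open>By \<open>even\<close>, an exponent that kills w but is not a multiple of n is odd. If
  w' fails too, there is an odd e with w ^ e = -1, and w ^ (e * d) would be both 1 and -1.\<close>

lemma primitive_or_minus:
  assumes g: "generates A n" and w: "w * cnj w = 1"
    and mem: "w \<in># A" "w' \<in># A" "w' = - w \<or> w' = - cnj w"
    and even: "\<And>d. even d \<Longrightarrow> w ^ d = 1 \<Longrightarrow> \<forall>v\<in>#A. v ^ d = 1"
  shows "primitive_root n w \<or> primitive_root n w'"
proof (rule ccontr)
  assume h: "\<not> ?thesis"
  have n: "w ^ n = 1" "w' ^ n = 1" using g mem by (auto simp: generates_def)
  from h n obtain d e where d: "w ^ d = 1" "\<not> n dvd d" and e: "w' ^ e = 1" "\<not> n dvd e"
    unfolding primitive_root_def by blast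
  have "(- w) ^ e = 1 \<or> (- cnj w) ^ e = 1" using e(1) mem(3) by auto
  then have we: "(if even e then w ^ e else - (w ^ e)) = 1"
    by (auto simp: power_minus_odd complex_cnj_power[symmetric] complex_cnj_minus[symmetric]
        simp del: complex_cnj_power complex_cnj_minus)
  have odd: "odd d" using even[of d] d g by (auto simp: generates_def)
  have "odd e"
  proof
    assume "even e"
    then have "\<forall>v\<in>#A. v ^ e = 1" using even we by simp
    then show False using g e(2) by (simp add: generates_def)
  qed
  then have "- (w ^ e) = 1" using we by simp
  then have "w ^ e = -1" by (metis minus_minus)
  then have "w ^ (e * d) = -1" using odd by (simp add: power_mult)
  moreover have "w ^ (e * d) = 1" using d(1) by (metis mult.commute power_mult power_one)
  ultimately show False by simp
qed

lemma minus_one_six_primitive: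
  assumes "generates (minus_one_six w) n" "w * cnj w = 1"
  shows "\<exists>v. v * cnj v = 1 \<and> primitive_root n v \<and> minus_one_six w = minus_one_six v"
proof -
  have "minus_one_six w = minus_one_six (- cnj w)" by (simp add: minus_one_six_def six_swap23[of "-1" w])
  moreover have "primitive_root n w \<or> primitive_root n (- cnj w)"
  proof (rule primitive_or_minus[OF assms])
    fix d :: nat assume "even d" "w ^ d = 1"
    then show "\<forall>v\<in>#minus_one_six w. v ^ d = 1"
      by (auto simp: minus_one_six_def six_def simp flip: complex_cnj_power)
  qed (auto simp: minus_one_six_def six_def)
  moreover have "- cnj w * cnj (- cnj w) = 1" using assms(2) by (simp add: mult.commute)
  ultimately show ?thesis using assms(2) by blast
qed

lemma opposite_six_primitive:
  assumes "generates (opposite_six w) n" "w * cnj w = 1"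
  shows "\<exists>v. v * cnj v = 1 \<and> primitive_root n v \<and> opposite_six w = opposite_six v"
proof -
  have "opposite_six w = opposite_six (- w)" by (simp add: opposite_six_def six_swap12[of w "- w"])
  moreover have "primitive_root n w \<or> primitive_root n (- w)"
  proof (rule primitive_or_minus[OF assms])
    fix d :: nat assume d: "even d" "w ^ d = 1"
    have "((cnj w)\<^sup>2) ^ d = (cnj (w ^ d)) ^ 2" by (simp add: mult.commute flip: power_mult)
    then have "((cnj w)\<^sup>2) ^ d = 1" using d(2) by simp
    moreover have "(w\<^sup>2) ^ d = 1" using d(2) by (metis mult.commute power_mult power_one)
    ultimately show "\<forall>v\<in>#opposite_six w. v ^ d = 1"
      using d by (auto simp: opposite_six_def six_def simp flip: complex_cnj_power)
  qed (auto simp: opposite_six_def six_def)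
  moreover have "- w * cnj (- w) = 1" using assms(2) by simp
  ultimately show ?thesis using assms(2) by blast
qed

lemma even_of_minus_one_power:
  assumes "(-1::complex) ^ n = 1"
  shows "even n"
  using assms by (cases "even n") auto

lemma minus_one_six_even: "generates (minus_one_six w) n \<Longrightarrow> even n"
  by (rule even_of_minus_one_power) (simp add: generates_def minus_one_six_def six_def)

lemma opposite_six_even:
  assumes "generates (opposite_six w) n" shows "even n"
proof (rule even_of_minus_one_power)
  have "w ^ n = 1" "(- w) ^ n = 1" using assms by (auto simp: generates_def opposite_six_def six_def)
  then show "(-1::complex) ^ n = 1" by (metis mult.right_neutral power_minus)
qed

lemma minus_one_six_power: "odd u \<Longrightarrow> image_mset (\<lambda>w. w ^ u) (minus_one_six v) = minus_one_six (v ^ u)"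
  unfolding minus_one_six_def image_power_six by (simp add: power_minus_odd)

lemma opposite_six_power: "odd u \<Longrightarrow> image_mset (\<lambda>w. w ^ u) (opposite_six v) = opposite_six (v ^ u)"
  unfolding opposite_six_def image_power_six by (simp add: power_minus_odd mult.commute flip: power_mult)

text \<open>As n is even, an even power of v has order at most n / 2. Oddness matters because odd
  powers respect the signs in \<open>minus_one_six\<close> and \<open>opposite_six\<close>.\<close>

lemma primitive_root_power_odd:
  assumes "n > 0" "even n" "primitive_root n v" "primitive_root n w"
  shows "\<exists>u. odd u \<and> w = v ^ u"
proof -
  obtain u where u: "w = v ^ u"
    using primitive_root_power[OF assms(1,3)] assms(4) by (auto simp: primitive_root_def)
  have "odd u"
  proof
    assume "even u"
    then obtain a where a: "u = 2 * a" by auto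
    obtain b where b: "n = 2 * b" using assms(2) by auto
    have "w ^ b = (v ^ n) ^ a" unfolding u a b by (simp add: mult_ac flip: power_mult)
    then have "w ^ b = 1" using assms(3) by (simp add: primitive_root_def)
    then have "n dvd b" using assms(4) by (simp add: primitive_root_def)
    then show False using assms(1) b by (auto dest: dvd_imp_le)
  qed
  with u show ?thesis by blast
qed

lemma minus_one_six_equiv:
  assumes "n > 0" "generates (minus_one_six w) n" "w * cnj w = 1" "generates (minus_one_six w') n" "w' * cnj w' = 1"
  shows "\<exists>u. minus_one_six w = image_mset (\<lambda>w. w ^ u) (minus_one_six w')"
proof -
  obtain v v' where v: "primitive_root n v" "minus_one_six w = minus_one_six v" "primitive_root n v'" "minus_one_six w' = minus_one_six v'"
    using minus_one_six_primitive[OF assms(2,3)] minus_one_six_primitive[OF assms(4,5)] by blast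
  obtain u where "odd u" "v = v' ^ u"
    using primitive_root_power_odd[OF assms(1) minus_one_six_even[OF assms(2)] v(3,1)] by blast
  then have "minus_one_six w = image_mset (\<lambda>w. w ^ u) (minus_one_six w')" by (simp add: v minus_one_six_power)
  then show ?thesis by blast
qed

lemma opposite_six_equiv:
  assumes "n > 0" "generates (opposite_six w) n" "w * cnj w = 1" "generates (opposite_six w') n" "w' * cnj w' = 1"
  shows "\<exists>u. opposite_six w = image_mset (\<lambda>w. w ^ u) (opposite_six w')"
proof -
  obtain v v' where v: "primitive_root n v" "opposite_six w = opposite_six v" "primitive_root n v'" "opposite_six w' = opposite_six v'"
    using opposite_six_primitive[OF assms(2,3)] opposite_six_primitive[OF assms(4,5)] by blast
  obtain u where "odd u" "v = v' ^ u"
    using primitive_root_power_odd[OF assms(1) opposite_six_even[OF assms(2)] v(3,1)] by blast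
  then have "opposite_six w = image_mset (\<lambda>w. w ^ u) (opposite_six w')" by (simp add: v opposite_six_power)
  then show ?thesis by blast
qed

text \<open>All elements are powers of w or of its conjugate, so w is a primitive n-th root of
  unity, and so is w'. A power taking w' to w takes B to A.\<close>

lemma exceptional_pair:
  assumes "n > 0" "generates A n" "generates B n"
    and "A = six w (w ^ 29) (w ^ 12)" "B = six w' (w' ^ 29) (w' ^ 12)" "w * cnj w = 1" "w' * cnj w' = 1"
  shows "\<exists>u. A = image_mset (\<lambda>w. w ^ u) B"
proof -
  have prim: "primitive_root n w" if g: "generates A n" and A: "A = six w (w ^ 29) (w ^ 12)" "w * cnj w = 1" for w A
  proof -
    have "v ^ d = 1" if "v \<in># A" "w ^ d = 1" for v d
    proof -
      have "(w ^ j) ^ d = 1" for j using that(2) by (metis mult.commute power_mult power_one)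
      moreover have "cnj w ^ d = 1" using that(2) by (metis complex_cnj_one complex_cnj_power)
      then have "(cnj w ^ j) ^ d = 1" for j by (metis mult.commute power_mult power_one)
      ultimately show ?thesis using that A(1) by (auto simp: six_def \<open>cnj w ^ d = 1\<close>)
    qed
    then have "n dvd d" if "w ^ d = 1" for d using g that unfolding generates_def by blast
    moreover have "w \<in># A" unfolding A(1) six_def by simp
    then have "w ^ n = 1" using g unfolding generates_def by blast
    ultimately show ?thesis unfolding primitive_root_def by blast
  qed
  have p: "primitive_root n w" "primitive_root n w'"
    by (rule prim[OF assms(2,4,6)], rule prim[OF assms(3,5,7)])
  then obtain u where u: "w = w' ^ u"
    using primitive_root_power[OF assms(1) p(2), of w] unfolding primitive_root_def by blast
  have "(w' ^ u) ^ j = (w' ^ j) ^ u" for j by (simp add: mult.commute flip: power_mult)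
  then have "A = image_mset (\<lambda>w. w ^ u) B"
    unfolding assms(4,5) image_power_six u by simp
  then show ?thesis by blast
qed

text \<open>As k is even, signs do not affect classes: apart from 1 and -1, the elements have class
  V, V^2 or a conjugate of these. A root of X^2 + X + 1 in the trivial class forces V = 1, and then
  no nontrivial class is left.\<close>

lemma not_exceptional_degenerate:
  assumes n: "n = 7 * k" "even n" and B: "B = minus_one_six v \<or> B = opposite_six v" and v: "v * cnj v = 1"
    and roots: "\<forall>w\<in>#B. w ^ n = 1"
  shows "\<not> exceptional k A (image_mset (\<lambda>w. w ^ u) B)"
proof
  assume "exceptional k A (image_mset (\<lambda>w. w ^ u) B)"
  then obtain \<beta> \<gamma> where bg: "\<beta> \<in># B" "\<gamma> \<in># B" "(\<beta> ^ u) ^ k = 1" "(\<beta> ^ u) ^ 2 + \<beta> ^ u + 1 = 0" "(\<gamma> ^ u) ^ k \<noteq> 1"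
    unfolding exceptional_def by auto
  define V where "V = (v ^ u) ^ k"
  have "v \<in># B" using B by (auto simp: minus_one_six_def opposite_six_def six_def)
  then have "v ^ n = 1" using roots by blast
  then have V7: "V ^ 7 = 1" unfolding V_def n(1) by (metis mult.commute power_mult power_one)
  have k: "even k" using n by simp
  have "((-1) ^ u) ^ k = (((-1) ^ k) ^ u :: complex)"
    by (simp only: power_mult[symmetric] mult.commute[of u k])
  then have s: "((-1) ^ u) ^ k = (1::complex)" using k by simp
  have c: "(cnj v ^ u) ^ k = cnj V" unfolding V_def by simp
  have sq: "((w\<^sup>2) ^ u) ^ k = ((w ^ u) ^ k) ^ 2" for w :: complex by (simp add: mult_ac flip: power_mult)
  have neg: "((- w) ^ u) ^ k = (w ^ u) ^ k" for w :: complex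
    using s power_minus[of w u] by (simp add: power_mult_distrib)
  have cl: "w = -1 \<or> w = 1 \<or> (w ^ u) ^ k \<in> {V, cnj V, V\<^sup>2, (cnj V)\<^sup>2}" if "w \<in># B" for w
    using that B by (auto simp: minus_one_six_def opposite_six_def six_def neg c sq V_def[symmetric])
  have "\<beta> \<noteq> -1 \<and> \<beta> \<noteq> 1"
    using bg(4) by (cases "even u") (auto simp: power_minus_odd)
  then have "V = 1 \<or> cnj V = 1 \<or> V\<^sup>2 = 1 \<or> (cnj V)\<^sup>2 = 1" using cl[OF bg(1)] bg(3) by auto
  then have "V = 1 \<or> V\<^sup>2 = 1" by (metis complex_cnj_cnj complex_cnj_one complex_cnj_power)
  then have V1: "V = 1" using root_unity_coprime[OF V7, of 2] by auto
  have "(\<gamma> ^ u) ^ k = 1" using cl[OF bg(2)] V1 s by auto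
  with bg(5) show False by simp
qed

lemma count_image_mset_set:
  assumes "finite S"
  shows "count (image_mset f (mset_set S)) c = card {r \<in> S. f r = c}"
  using assms by (simp add: count_image_mset' eq_commute[of c] conj_commute)

definition psum :: "complex multiset \<Rightarrow> nat \<Rightarrow> complex" where
  "psum A r = (\<Sum>w\<in>#A. w ^ r)"

lemma psum_six: "unit_triple x y z \<Longrightarrow> 2 + psum (six x y z) r = (1 + x ^ r) * (1 + y ^ r) * (1 + z ^ r)"
  using two_plus_sum_six[OF tri_power, of x y z r]
  by (simp add: psum_def image_mset.compositionality comp_def flip: image_power_six)

lemma tri_minus_one_six: "w * cnj w = 1 \<Longrightarrow> unit_triple (-1) w (- cnj w)"
  by (simp add: unit_triple_def mult.commute)

lemma tri_opposite_six: "w * cnj w = 1 \<Longrightarrow> unit_triple w (- w) (- (cnj w)\<^sup>2)"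
proof -
  assume w: "w * cnj w = 1"
  have "(cnj w)\<^sup>2 * w\<^sup>2 = (w * cnj w) ^ 2" by (simp add: power_mult_distrib mult.commute)
  moreover have "w * (w * (cnj w)\<^sup>2) = (w * cnj w) ^ 2" by (simp add: power_mult_distrib power2_eq_square mult.assoc)
  ultimately show ?thesis using w by (simp add: unit_triple_def mult.assoc)
qed

text \<open>Count the occurrences of -2. With -1 in the triple it occurs at every odd r, at least n
  / 2 times; with an opposite pair only where 4 * r is n, 2 * n or 3 * n. This leaves n = 2, 4, 6,
  of which only 4 does not divide 30.\<close>

lemma minus_one_six_opposite_six_psum_neq:
  assumes n: "n > 0" "\<not> n dvd 30" and g1: "generates (minus_one_six w) n" "w * cnj w = 1"
    and g2: "generates (opposite_six v) n" "v * cnj v = 1"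
  shows "image_mset (psum (minus_one_six w)) (mset_set {1..n}) \<noteq> image_mset (psum (opposite_six v)) (mset_set {1..n})"
proof
  assume "image_mset (psum (minus_one_six w)) (mset_set {1..n}) = image_mset (psum (opposite_six v)) (mset_set {1..n})"
  then have eq: "card {r \<in> {1..n}. psum (minus_one_six w) r = -2} = card {r \<in> {1..n}. psum (opposite_six v) r = -2}"
    using count_image_mset_set[of "{1..n}" "psum (minus_one_six w)" "-2"] count_image_mset_set[of "{1..n}" "psum (opposite_six v)" "-2"]
    by simp
  obtain h where h: "n = 2 * h" using minus_one_six_even[OF g1(1)] by auto
  have psum_iff: "psum (six x y z) r = -2 \<longleftrightarrow> x ^ r = -1 \<or> y ^ r = -1 \<or> z ^ r = -1" if "unit_triple x y z" for x y z r
  proof -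
    have "psum (six x y z) r = -2 \<longleftrightarrow> 2 + psum (six x y z) r = 0" by (simp add: add_eq_0_iff)
    then show ?thesis unfolding psum_six[OF that] by (auto simp: add_eq_0_iff)
  qed
  have "(\<lambda>i. 2 * i + 1) ` {..<h} \<subseteq> {r \<in> {1..n}. psum (minus_one_six w) r = -2}"
    using h unfolding minus_one_six_def psum_iff[OF tri_minus_one_six[OF g1(2)]] by auto
  then have "card ((\<lambda>i. 2 * i + 1) ` {..<h}) \<le> card {r \<in> {1..n}. psum (minus_one_six w) r = -2}"
    by (intro card_mono) auto
  moreover have "card ((\<lambda>i. 2 * i + 1) ` {..<h}) = h" by (subst card_image) (auto intro!: inj_onI)
  ultimately have hle: "h \<le> card {r \<in> {1..n}. psum (opposite_six v) r = -2}" using eq by simp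
  obtain u where u: "u * cnj u = 1" "primitive_root n u" "opposite_six v = opposite_six u"
    using opposite_six_primitive[OF g2] by blast
  have S: "4 * r = n \<or> 4 * r = 2 * n \<or> 4 * r = 3 * n" and Sodd: "odd r \<Longrightarrow> n dvd 2 * r"
    if r: "r \<in> {1..n}" "psum (opposite_six v) r = -2" for r
  proof -
    have "psum (opposite_six u) r = -2" using r(2) u(3) by simp
    then have c: "u ^ r = -1 \<or> (- u) ^ r = -1 \<or> (- (cnj u)\<^sup>2) ^ r = -1"
      unfolding opposite_six_def psum_iff[OF tri_opposite_six[OF u(1)]] .
    have two: "u ^ (2 * r) = 1" if "u ^ r = -1 \<or> (- u) ^ r = -1"
    proof -
      have "s ^ (2 * r) = 1" if "s ^ r = -1" for s :: complex
        using that by (simp add: power_mult mult.commute[of 2])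
      from this[of u] this[of "- u"] that show ?thesis by auto
    qed
    have sq: "((- (cnj u)\<^sup>2) ^ r) ^ 2 = cnj (u ^ (4 * r))"
    proof -
      have "((- (cnj u)\<^sup>2) ^ r) ^ 2 = ((- (cnj u)\<^sup>2) ^ 2) ^ r"
        by (simp only: power_mult[symmetric] mult.commute[of r 2])
      also have "\<dots> = cnj u ^ (4 * r)" by (simp flip: power_mult)
      finally show ?thesis by simp
    qed
    from c have "u ^ (2 * r) = 1 \<or> u ^ (4 * r) = 1"
    proof (elim disjE)
      assume "u ^ r = -1"
      then show ?thesis using two by simp
    next
      assume "(- u) ^ r = -1"
      then show ?thesis using two by simp
    next
      assume "(- (cnj u)\<^sup>2) ^ r = -1"
      then have "cnj (u ^ (4 * r)) = 1" using sq by simp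
      then show ?thesis by (simp del: complex_cnj_power)
    qed
    then have "u ^ (4 * r) = 1"
    proof
      assume "u ^ (2 * r) = 1"
      moreover have "u ^ (4 * r) = (u ^ (2 * r)) ^ 2" by (simp add: mult_ac flip: power_mult)
      ultimately show ?thesis by simp
    qed
    then have "n dvd 4 * r" using u(2) by (simp add: primitive_root_def)
    then obtain j where j: "4 * r = n * j" by auto
    have "r \<noteq> n"
    proof
      assume "r = n"
      moreover have "\<forall>w\<in>#opposite_six u. w ^ n = 1" using g2(1) u(3) by (simp add: generates_def)
      ultimately show False using c by (auto simp: opposite_six_def six_def)
    qed
    then have "4 * r < 4 * n" "4 * r > 0" using r(1) by auto
    then have "n * j < n * 4" "n * j > n * 0" unfolding j by (simp_all add: mult.commute)
    then have "j < 4" "j > 0" by simp_all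
    then have "j = 1 \<or> j = 2 \<or> j = 3" by auto
    then show "4 * r = n \<or> 4 * r = 2 * n \<or> 4 * r = 3 * n" using j by auto
    assume "odd r"
    then have "u ^ (2 * r) = 1"
      using c
    proof (elim disjE)
      assume "u ^ r = -1"
      then show ?thesis using two by simp
    next
      assume "(- u) ^ r = -1"
      then show ?thesis using two by simp
    next
      assume "(- (cnj u)\<^sup>2) ^ r = -1"
      then have "((cnj u)\<^sup>2) ^ r = 1" using \<open>odd r\<close> by (simp add: power_minus_odd)
      then have "cnj (u ^ (2 * r)) = 1" by (simp flip: power_mult)
      then show ?thesis by (simp del: complex_cnj_power)
    qed
    then show "n dvd 2 * r" using u(2) by (simp add: primitive_root_def)
  qed
  show False
  proof (cases "n = 4")
    case True
    \<comment> \<open>An odd r would require 4 dvd 2 * r, so only r = 2 remains: one occurrence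
      against at least two.\<close>
    have "{r \<in> {1..n}. psum (opposite_six v) r = -2} \<subseteq> {2}"
    proof
      fix r assume "r \<in> {r \<in> {1..n}. psum (opposite_six v) r = -2}"
      then have r: "r \<in> {1..n}" "psum (opposite_six v) r = -2" by auto
      have "even r"
      proof (rule ccontr)
        assume "odd r"
        then have "4 dvd 2 * r" using Sodd[OF r] True by simp
        then show False using \<open>odd r\<close> by presburger
      qed
      then show "r \<in> {2}" using S[OF r] True by auto
    qed
    then have "card {r \<in> {1..n}. psum (opposite_six v) r = -2} \<le> card {2::nat}" by (intro card_mono) auto
    then show False using hle h True by simp
  next
    case False
    have "{r \<in> {1..n}. psum (opposite_six v) r = -2} \<subseteq> set [n div 4, n div 2, (3 * n) div 4]"
    proof
      fix r assume "r \<in> {r \<in> {1..n}. psum (opposite_six v) r = -2}"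
      then have "4 * r = n \<or> 4 * r = 2 * n \<or> 4 * r = 3 * n" using S by blast
      then show "r \<in> set [n div 4, n div 2, (3 * n) div 4]" by auto
    qed
    then have "card {r \<in> {1..n}. psum (opposite_six v) r = -2} \<le> card (set [n div 4, n div 2, (3 * n) div 4])"
      by (intro card_mono) auto
    also have "\<dots> \<le> 3" using card_length[of "[n div 4, n div 2, (3 * n) div 4]"] by simp
    finally have "h \<le> 3" using hle by simp
    then have "n = 2 \<or> n = 4 \<or> n = 6" using h n(1) by auto
    then show False using n(2) False by auto
  qed
qed

section \<open>The moduli dividing 30: orbit tables and walk counts\<close>

section \<open>Closed walks modulo 30\<close>

text \<open>The triple has exponents a, b, -(a + b) modulo 30; the summands 60 and 30 keep natural
  subtraction from truncating.\<close>

definition exponents :: "nat \<Rightarrow> nat \<Rightarrow> nat list" where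
  "exponents a b = [a, b, (60 - a - b) mod 30, (30 - a) mod 30, (30 - b) mod 30, (a + b) mod 30]"

definition walk_step :: "nat list \<Rightarrow> int list \<Rightarrow> int list" where
  "walk_step es v = fold (\<lambda>e. map2 (+) (drop (30 - e) v @ take (30 - e) v)) es
    [0,0,0,0,0,0,0,0,0,0,0,0,0,0,0,0,0,0,0,0,0,0,0,0,0,0,0,0,0,0]"

text \<open>A list of length 30 stands for an element of the group ring of \<open>\<int>/30\<close>, and one step of the walk
  is multiplication by the sum of the six given elements.\<close>

primrec closed_walks :: "nat \<Rightarrow> nat list \<Rightarrow> int list \<Rightarrow> int" where
  "closed_walks 0 es v = hd v"
| "closed_walks (Suc k) es v = closed_walks k es (walk_step es v)"

text \<open>The identity coefficient of the k-th power of the group ring element; 30 times it is the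
  k-th moment of the power sums over one period.\<close>

definition walk_number :: "nat \<Rightarrow> nat \<Rightarrow> nat \<Rightarrow> int" where
  "walk_number k a b = closed_walks k (exponents a b)
     [1,0,0,0,0,0,0,0,0,0,0,0,0,0,0,0,0,0,0,0,0,0,0,0,0,0,0,0,0,0]"

text \<open>One pair of exponents for each sextuple of 30th roots of unity, up to powers coprime to
  30.\<close>

definition class_reps :: "(nat \<times> nat) list" where
  "class_reps = [(0, 0), (0, 1), (0, 2), (0, 3), (0, 5), (0, 6), (0, 10), (0, 15), (1, 1), (1, 2), (1, 3),
     (1, 4), (1, 5), (1, 6), (1, 7), (1, 8), (1, 9), (1, 10), (1, 11), (1, 14), (2, 2),
     (2, 3), (2, 4), (2, 6), (2, 8), (2, 10), (3, 3), (3, 6), (3, 12), (5, 5), (5, 10),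
     (6, 6), (10, 10)]"

text \<open>An entry \<open>(a, b, c, d, u)\<close> says that multiplication by the unit \<open>u\<close> takes the exponents of
  \<open>(c, d)\<close> to those of \<open>(a, b)\<close>.\<close>

definition class_table :: "(nat \<times> nat \<times> nat \<times> nat \<times> nat) list" where
  "class_table =
    [(0, 0, 0, 0, 1), (0, 1, 0, 1, 1), (0, 2, 0, 2, 1), (0, 3, 0, 3, 1), (0, 4, 0, 2, 13),
     (0, 5, 0, 5, 1), (0, 6, 0, 6, 1), (0, 7, 0, 1, 7), (0, 8, 0, 2, 11), (0, 9, 0, 3, 7),
     (0, 10, 0, 10, 1), (0, 11, 0, 1, 11), (0, 12, 0, 6, 7), (0, 13, 0, 1, 13),
     (0, 14, 0, 2, 7), (0, 15, 0, 15, 1), (0, 16, 0, 2, 7), (0, 17, 0, 1, 13),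
     (0, 18, 0, 6, 7), (0, 19, 0, 1, 11), (0, 20, 0, 10, 1), (0, 21, 0, 3, 7),
     (0, 22, 0, 2, 11), (0, 23, 0, 1, 7), (0, 24, 0, 6, 1), (0, 25, 0, 5, 1),
     (0, 26, 0, 2, 13), (0, 27, 0, 3, 1), (0, 28, 0, 2, 1), (0, 29, 0, 1, 1), (1, 0, 0, 1, 1),
     (1, 1, 1, 1, 1), (1, 2, 1, 2, 1), (1, 3, 1, 3, 1), (1, 4, 1, 4, 1), (1, 5, 1, 5, 1),
     (1, 6, 1, 6, 1), (1, 7, 1, 7, 1), (1, 8, 1, 8, 1), (1, 9, 1, 9, 1), (1, 10, 1, 10, 1),
     (1, 11, 1, 11, 1), (1, 12, 1, 6, 13), (1, 13, 1, 7, 13), (1, 14, 1, 14, 1),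
     (1, 15, 1, 14, 1), (1, 16, 1, 7, 13), (1, 17, 1, 6, 13), (1, 18, 1, 11, 1),
     (1, 19, 1, 10, 1), (1, 20, 1, 9, 1), (1, 21, 1, 8, 1), (1, 22, 1, 7, 1),
     (1, 23, 1, 6, 1), (1, 24, 1, 5, 1), (1, 25, 1, 4, 1), (1, 26, 1, 3, 1), (1, 27, 1, 2, 1),
     (1, 28, 1, 1, 1), (1, 29, 0, 1, 1), (2, 0, 0, 2, 1), (2, 1, 1, 2, 1), (2, 2, 2, 2, 1),
     (2, 3, 2, 3, 1), (2, 4, 2, 4, 1), (2, 5, 1, 4, 7), (2, 6, 2, 6, 1), (2, 7, 1, 3, 7),
     (2, 8, 2, 8, 1), (2, 9, 1, 8, 11), (2, 10, 2, 10, 1), (2, 11, 1, 7, 11),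
     (2, 12, 2, 4, 7), (2, 13, 1, 14, 13), (2, 14, 2, 2, 7), (2, 15, 1, 14, 13),
     (2, 16, 2, 4, 7), (2, 17, 1, 7, 11), (2, 18, 2, 10, 1), (2, 19, 1, 8, 11),
     (2, 20, 2, 8, 1), (2, 21, 1, 3, 7), (2, 22, 2, 6, 1), (2, 23, 1, 4, 7), (2, 24, 2, 4, 1),
     (2, 25, 2, 3, 1), (2, 26, 2, 2, 1), (2, 27, 1, 2, 1), (2, 28, 0, 2, 1), (2, 29, 1, 1, 1),
     (3, 0, 0, 3, 1), (3, 1, 1, 3, 1), (3, 2, 2, 3, 1), (3, 3, 3, 3, 1), (3, 4, 1, 8, 7),
     (3, 5, 2, 3, 11), (3, 6, 3, 6, 1), (3, 7, 1, 9, 7), (3, 8, 1, 2, 11), (3, 9, 3, 6, 7),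
     (3, 10, 1, 9, 13), (3, 11, 1, 3, 11), (3, 12, 3, 12, 1), (3, 13, 1, 8, 13),
     (3, 14, 1, 8, 13), (3, 15, 3, 12, 1), (3, 16, 1, 3, 11), (3, 17, 1, 9, 13),
     (3, 18, 3, 6, 7), (3, 19, 1, 2, 11), (3, 20, 1, 9, 7), (3, 21, 3, 6, 1),
     (3, 22, 2, 3, 11), (3, 23, 1, 8, 7), (3, 24, 3, 3, 1), (3, 25, 2, 3, 1),
     (3, 26, 1, 3, 1), (3, 27, 0, 3, 1), (3, 28, 1, 2, 1), (3, 29, 1, 2, 1), (5, 0, 0, 5, 1),
     (5, 1, 1, 5, 1), (5, 2, 1, 4, 7), (5, 3, 2, 3, 11), (5, 4, 2, 3, 13), (5, 5, 5, 5, 1),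
     (5, 6, 1, 5, 11), (5, 7, 1, 5, 7), (5, 8, 1, 4, 13), (5, 9, 2, 3, 7), (5, 10, 5, 10, 1),
     (5, 11, 1, 4, 11), (5, 12, 1, 5, 13), (5, 13, 1, 5, 13), (5, 14, 1, 4, 11),
     (5, 15, 5, 10, 1), (5, 16, 2, 3, 7), (5, 17, 1, 4, 13), (5, 18, 1, 5, 7),
     (5, 19, 1, 5, 11), (5, 20, 5, 5, 1), (5, 21, 2, 3, 13), (5, 22, 2, 3, 11),
     (5, 23, 1, 4, 7), (5, 24, 1, 5, 1), (5, 25, 0, 5, 1), (5, 26, 1, 4, 1), (5, 27, 2, 3, 1),
     (5, 28, 2, 3, 1), (5, 29, 1, 4, 1), (6, 0, 0, 6, 1), (6, 1, 1, 6, 1), (6, 2, 2, 6, 1),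
     (6, 3, 3, 6, 1), (6, 4, 2, 10, 13), (6, 5, 1, 5, 11), (6, 6, 6, 6, 1), (6, 7, 1, 11, 7),
     (6, 8, 2, 4, 11), (6, 9, 3, 12, 7), (6, 10, 2, 10, 7), (6, 11, 1, 6, 11),
     (6, 12, 6, 6, 7), (6, 13, 1, 6, 11), (6, 14, 2, 10, 7), (6, 15, 3, 12, 7),
     (6, 16, 2, 4, 11), (6, 17, 1, 11, 7), (6, 18, 6, 6, 1), (6, 19, 1, 5, 11),
     (6, 20, 2, 10, 13), (6, 21, 3, 6, 1), (6, 22, 2, 6, 1), (6, 23, 1, 6, 1),
     (6, 24, 0, 6, 1), (6, 25, 1, 5, 1), (6, 26, 2, 4, 1), (6, 27, 3, 3, 1), (6, 28, 2, 4, 1),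
     (6, 29, 1, 5, 1), (10, 0, 0, 10, 1), (10, 1, 1, 10, 1), (10, 2, 2, 10, 1),
     (10, 3, 1, 9, 13), (10, 4, 2, 8, 7), (10, 5, 5, 10, 1), (10, 6, 2, 10, 7),
     (10, 7, 1, 10, 7), (10, 8, 2, 10, 11), (10, 9, 1, 9, 11), (10, 10, 10, 10, 1),
     (10, 11, 1, 9, 11), (10, 12, 2, 10, 11), (10, 13, 1, 10, 7), (10, 14, 2, 10, 7),
     (10, 15, 5, 10, 1), (10, 16, 2, 8, 7), (10, 17, 1, 9, 13), (10, 18, 2, 10, 1),
     (10, 19, 1, 10, 1), (10, 20, 0, 10, 1), (10, 21, 1, 9, 1), (10, 22, 2, 8, 1),
     (10, 23, 1, 9, 7), (10, 24, 2, 10, 13), (10, 25, 5, 5, 1), (10, 26, 2, 10, 13),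
     (10, 27, 1, 9, 7), (10, 28, 2, 8, 1), (10, 29, 1, 9, 1), (15, 0, 0, 15, 1),
     (15, 1, 1, 14, 1), (15, 2, 1, 14, 13), (15, 3, 3, 12, 1), (15, 4, 1, 14, 11),
     (15, 5, 5, 10, 1), (15, 6, 3, 12, 7), (15, 7, 1, 14, 7), (15, 8, 1, 14, 7),
     (15, 9, 3, 12, 7), (15, 10, 5, 10, 1), (15, 11, 1, 14, 11), (15, 12, 3, 12, 1),
     (15, 13, 1, 14, 13), (15, 14, 1, 14, 1), (15, 15, 0, 15, 1), (15, 16, 1, 14, 1),
     (15, 17, 1, 14, 13), (15, 18, 3, 12, 1), (15, 19, 1, 14, 11), (15, 20, 5, 10, 1),
     (15, 21, 3, 12, 7), (15, 22, 1, 14, 7), (15, 23, 1, 14, 7), (15, 24, 3, 12, 7),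
     (15, 25, 5, 10, 1), (15, 26, 1, 14, 11), (15, 27, 3, 12, 1), (15, 28, 1, 14, 13),
     (15, 29, 1, 14, 1)]"

text \<open>Walk numbers of length 6 in the order of \<open>class_reps\<close>; 46656 = 6 ^ 6
  belongs to the trivial triple.\<close>

definition class_walk_numbers :: "int list" where
  "class_walk_numbers =
    [46656, 9024, 9024, 9024, 9152, 9792, 15552, 23360, 5380, 3450, 2580, 2174, 2114, 2130,
     2700, 2110, 3102, 3102, 2140, 4544, 5380, 2222, 3550, 3220, 3366, 3354, 5500, 4740, 4928,
     8030, 7808, 9460, 16038]"

lemma class_table_correct:
  "list_all (\<lambda>(a, b, c, d, u). (c, d) \<in> set class_reps \<and> u \<in> set [1, 7, 11, 13, 17, 19, 23, 29] \<and>
    sort (exponents a b) = sort (map (\<lambda>e. u * e mod 30) (exponents c d))) class_table"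
  by code_simp

text \<open>The first exponent runs over representatives of the orbits of units on the residues
  modulo 30, one for each gcd with 30.\<close>

lemma class_table_complete:
  "map (\<lambda>(a, b, c, d, u). (a, b)) class_table = List.product [0, 1, 2, 3, 5, 6, 10, 15] [0..<30]"
  by code_simp

lemma units_30_orbits:
  "list_all (\<lambda>a. list_ex (\<lambda>u. u * a mod 30 \<in> set [0, 1, 2, 3, 5, 6, 10, 15]) [1, 7, 11, 13, 17, 19, 23, 29]) [0..<30]"
  by code_simp

lemma walk_number_6:
  "map (\<lambda>(a, b). walk_number (Suc (Suc (Suc (Suc (Suc (Suc 0)))))) a b) class_reps =
    class_walk_numbers"
  by code_simp

text \<open>Both pairs have walk number 3102 at length 6 and generate the full group, so a longer
  walk is needed.\<close>

lemma walk_number_10_neq: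
  "walk_number (Suc (Suc (Suc (Suc (Suc (Suc (Suc (Suc (Suc (Suc 0)))))))))) 1 9 \<noteq>
   walk_number (Suc (Suc (Suc (Suc (Suc (Suc (Suc (Suc (Suc (Suc 0)))))))))) 1 10"
  by code_simp

text \<open>Length 6 leaves three coincidences: 9024 for (0, 1), (0, 2), (0, 3), 5380 for (1, 1),
  (2, 2), and 3102 for (1, 9), (1, 10). The tests with 15 and 10 ask whether the order of the
  generated group divides these numbers and resolve the first two.\<close>

lemma class_walk_numbers_separate:
  "list_all (\<lambda>((a, b), w). list_all (\<lambda>((c, d), v). v = w \<longrightarrow> (a, b) = (c, d) \<or>
      (a * 15 mod 30 = 0 \<and> b * 15 mod 30 = 0) \<noteq> (c * 15 mod 30 = 0 \<and> d * 15 mod 30 = 0) \<or>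
      (a * 10 mod 30 = 0 \<and> b * 10 mod 30 = 0) \<noteq> (c * 10 mod 30 = 0 \<and> d * 10 mod 30 = 0) \<or>
      (a, b) = (1, 9) \<and> (c, d) = (1, 10) \<or> (a, b) = (1, 10) \<and> (c, d) = (1, 9))
    (zip class_reps class_walk_numbers)) (zip class_reps class_walk_numbers)"
  by code_simp

lemma class_reps_eqI:
  assumes "(a, b) \<in> set class_reps" "(c, d) \<in> set class_reps"
    and "\<And>k. walk_number k a b = walk_number k c d"
    and "\<And>m. a * m mod 30 = 0 \<and> b * m mod 30 = 0 \<longleftrightarrow> c * m mod 30 = 0 \<and> d * m mod 30 = 0"
  shows "(a, b) = (c, d)"
proof -
  define f where "f = (\<lambda>(a, b). walk_number (Suc (Suc (Suc (Suc (Suc (Suc 0)))))) a b)"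
  have z: "zip class_reps class_walk_numbers = map (\<lambda>p. (p, f p)) class_reps"
    unfolding walk_number_6[symmetric] f_def zip_map2 zip_same_conv_map by simp
  have m: "((a, b), f (a, b)) \<in> set (zip class_reps class_walk_numbers)"
    "((c, d), f (c, d)) \<in> set (zip class_reps class_walk_numbers)"
    unfolding z using assms(1,2) by (simp_all only: set_map) blast+
  have f: "f (c, d) = f (a, b)" using assms(3) by (simp add: f_def)
  note sep = bspec[OF class_walk_numbers_separate[unfolded list_all_iff] m(1), unfolded prod.case]
  from bspec[OF sep m(2), unfolded prod.case] f have "(a, b) = (c, d) \<or>
      (a * 15 mod 30 = 0 \<and> b * 15 mod 30 = 0) \<noteq> (c * 15 mod 30 = 0 \<and> d * 15 mod 30 = 0) \<or>
      (a * 10 mod 30 = 0 \<and> b * 10 mod 30 = 0) \<noteq> (c * 10 mod 30 = 0 \<and> d * 10 mod 30 = 0) \<or>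
      (a, b) = (1, 9) \<and> (c, d) = (1, 10) \<or> (a, b) = (1, 10) \<and> (c, d) = (1, 9)"
    by (rule mp)
  moreover have "\<not> ((a, b) = (1, 9) \<and> (c, d) = (1, 10))" "\<not> ((a, b) = (1, 10) \<and> (c, d) = (1, 9))"
    using assms(3)[of "Suc (Suc (Suc (Suc (Suc (Suc (Suc (Suc (Suc (Suc 0)))))))))"] walk_number_10_neq by auto
  ultimately show ?thesis using assms(4)[of 15] assms(4)[of 10] by blast
qed

section \<open>Sextuples of 30th roots of unity and exponents modulo 30\<close>

definition \<zeta> :: complex where "\<zeta> = cis (2 * pi / 30)"

lemma zeta_power: "\<zeta> ^ j = cis (2 * pi * real j / 30)"
  by (simp add: \<zeta>_def DeMoivre mult_ac)

lemma zeta_30: "\<zeta> ^ 30 = 1"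
  by (simp add: zeta_power)

lemma zeta_mod: "\<zeta> ^ (j mod 30) = \<zeta> ^ j"
proof -
  have "\<zeta> ^ j = \<zeta> ^ (30 * (j div 30) + j mod 30)" by simp
  also have "\<dots> = \<zeta> ^ (j mod 30)" by (simp only: power_add power_mult zeta_30 power_one mult_1)
  finally show ?thesis ..
qed

lemma zeta_surj: "z ^ 30 = 1 \<Longrightarrow> \<exists>j<30. z = \<zeta> ^ j"
proof -
  assume "z ^ 30 = 1"
  then obtain j where "z = \<zeta> ^ j" using root_unity_cis_power[of 30 z] by (auto simp: \<zeta>_def)
  then have "z = \<zeta> ^ (j mod 30)" by (simp add: zeta_mod)
  then show ?thesis by (intro exI[of _ "j mod 30"]) simp
qed

lemma zeta_inj: "i < 30 \<Longrightarrow> j < 30 \<Longrightarrow> \<zeta> ^ i = \<zeta> ^ j \<Longrightarrow> i = j"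
  using bij_betw_roots_unity[of 30] by (auto simp: bij_betw_def inj_on_def zeta_power)

lemma zeta_eq_1_iff: "\<zeta> ^ j = 1 \<longleftrightarrow> j mod 30 = 0"
  using zeta_inj[of "j mod 30" 0] zeta_mod[of j] by auto

lemma zeta_unit: "\<zeta> * cnj \<zeta> = 1"
  by (simp add: \<zeta>_def complex_mult_cnj cis_cnj flip: cis_mult) (simp add: cis_mult)

lemma cnj_zeta: "j \<le> 30 \<Longrightarrow> cnj (\<zeta> ^ j) = \<zeta> ^ (30 - j)"
proof -
  assume "j \<le> 30"
  then have "\<zeta> ^ j * \<zeta> ^ (30 - j) = 1" using zeta_30 by (simp flip: power_add)
  moreover have "\<zeta> ^ j * cnj (\<zeta> ^ j) = 1" using zeta_unit by (simp flip: power_mult_distrib)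
  ultimately show ?thesis by (metis inverse_unique)
qed

definition zmset :: "nat \<Rightarrow> nat \<Rightarrow> complex multiset" where
  "zmset a b = image_mset (\<lambda>e. \<zeta> ^ e) (mset (exponents a b))"

lemma zmset_eq_six:
  assumes "a < 30" "b < 30"
  shows "zmset a b = six (\<zeta> ^ a) (\<zeta> ^ b) (cnj (\<zeta> ^ a * \<zeta> ^ b))"
proof -
  have "\<zeta> ^ (60 - a - b) = cnj (\<zeta> ^ a) * cnj (\<zeta> ^ b)"
  proof -
    have "60 - a - b = (30 - a) + (30 - b)" using assms by simp
    then show ?thesis using assms by (simp only: power_add cnj_zeta less_imp_le)
  qed
  moreover have "\<zeta> ^ (30 - a) = cnj (\<zeta> ^ a)" "\<zeta> ^ (30 - b) = cnj (\<zeta> ^ b)"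
    using assms by (simp_all only: cnj_zeta less_imp_le)
  ultimately show ?thesis
    by (simp add: zmset_def exponents_def six_def zeta_mod power_add add_mset_commute)
qed

lemma six_third: "unit_triple x y z \<Longrightarrow> six x y z = six x y (cnj (x * y))"
  using tri_cnj_eq(3)[of x y z] by (metis complex_cnj_cnj)

lemma coprime_30:
  assumes "n \<in> {1, 7, 11, 13, 17, 19, 23, 29::nat}"
  shows "coprime n 30"
proof (cases "n = 1")
  case False
  then have "prime n" "\<not> n dvd 30" using assms by auto
  then show ?thesis by (rule prime_imp_coprime)
qed simp

lemma zmset_of_table:
  assumes "(a, b, c, d, u) \<in> set class_table"
  shows "(c, d) \<in> set class_reps" "coprime u 30" "zmset a b = image_mset (\<lambda>w. w ^ u) (zmset c d)"
proof -
  have h: "(c, d) \<in> set class_reps" "u \<in> set [1, 7, 11, 13, 17, 19, 23, 29]"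
    "sort (exponents a b) = sort (map (\<lambda>e. u * e mod 30) (exponents c d))"
    using bspec[OF class_table_correct[unfolded list_all_iff] assms, unfolded prod.case] by blast+
  show "(c, d) \<in> set class_reps" by (rule h)
  show "coprime u 30" using h(2) by (intro coprime_30) (simp only: list.set)
  have "mset (exponents a b) = mset (map (\<lambda>e. u * e mod 30) (exponents c d))"
    using h(3) by (metis mset_sort)
  then have "zmset a b = image_mset (\<lambda>e. \<zeta> ^ (u * e mod 30)) (mset (exponents c d))"
    by (simp add: zmset_def image_mset.compositionality comp_def)
  also have "\<dots> = image_mset (\<lambda>w. w ^ u) (zmset c d)"
    by (simp add: zmset_def image_mset.compositionality comp_def zeta_mod power_mult mult.commute[of u])
  finally show "zmset a b = image_mset (\<lambda>w. w ^ u) (zmset c d)" .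
qed

text \<open>One unit modulo 30 brings the exponent of x among the eight orbit representatives; the
  table supplies a second one, and the two maps are composed.\<close>

lemma six_30_rep:
  assumes t: "unit_triple x y z" and r: "x ^ 30 = 1" "y ^ 30 = 1"
  shows "\<exists>c d u. (c, d) \<in> set class_reps \<and> coprime u 30 \<and> six x y z = image_mset (\<lambda>w. w ^ u) (zmset c d)"
proof -
  obtain a b where ab: "a < 30" "b < 30" "x = \<zeta> ^ a" "y = \<zeta> ^ b" using r zeta_surj by metis
  have "list_ex (\<lambda>u. u * a mod 30 \<in> set [0, 1, 2, 3, 5, 6, 10, 15]) [1, 7, 11, 13, 17, 19, 23, 29]"
    by (rule bspec[OF units_30_orbits[unfolded list_all_iff]])
      (use ab(1) in \<open>simp only: set_upt atLeastLessThan_iff zero_le\<close>)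
  then obtain u where u: "u \<in> set [1, 7, 11, 13, 17, 19, 23, 29]" "u * a mod 30 \<in> set [0, 1, 2, 3, 5, 6, 10, 15]"
    unfolding list_ex_iff by blast
  have cop: "coprime u 30" using u(1) by (intro coprime_30) (simp only: list.set)
  define a' b' where "a' = u * a mod 30" and "b' = u * b mod 30"
  have "(a', b') \<in> set (List.product [0, 1, 2, 3, 5, 6, 10, 15] [0..<30])"
    using u(2) by (simp only: a'_def b'_def set_product set_upt mem_Times_iff fst_conv snd_conv) simp
  then have "(a', b') \<in> set (map (\<lambda>(a, b, c, d, u). (a, b)) class_table)"
    unfolding class_table_complete .
  then obtain c d v where tab: "(a', b', c, d, v) \<in> set class_table" by auto
  note z = zmset_of_table[OF tab]
  have pw: "x ^ u = \<zeta> ^ a'" "y ^ u = \<zeta> ^ b'"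
    unfolding ab a'_def b'_def zeta_mod by (simp_all add: mult.commute flip: power_mult)
  have "image_mset (\<lambda>w. w ^ u) (six x y z) = zmset a' b'"
  proof -
    have "image_mset (\<lambda>w. w ^ u) (six x y z) = six (x ^ u) (y ^ u) (cnj (x ^ u * y ^ u))"
      unfolding image_power_six by (rule six_third[OF tri_power[OF t]])
    then show ?thesis unfolding pw by (simp add: zmset_eq_six a'_def b'_def)
  qed
  then have A: "zmset a' b' = image_mset (\<lambda>w. w ^ u) (six x y z)" ..
  have "\<forall>w\<in>#six x y z. w ^ 30 = 1"
  proof -
    have "z ^ 30 = 1" using tri_class[OF t, of 30] r by simp
    then show ?thesis using r by (auto simp: six_def simp flip: complex_cnj_power)
  qed
  from power_inverse_mset[OF cop this A] obtain u' where
    u': "coprime u' 30" "six x y z = image_mset (\<lambda>w. w ^ u') (zmset a' b')" by blast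
  have "six x y z = image_mset (\<lambda>w. w ^ (v * u')) (zmset c d)"
    unfolding u'(2) z(3) by (simp add: image_mset.compositionality comp_def power_mult)
  moreover have "coprime (v * u') 30" using z(2) u'(1) by simp
  ultimately show ?thesis using z(1) by blast
qed

section \<open>Coefficient lists in the group ring and their values at characters\<close>

primrec peval :: "int list \<Rightarrow> complex \<Rightarrow> complex" where
  "peval [] x = 0"
| "peval (a # v) x = of_int a + x * peval v x"

lemma peval_append: "peval (v @ w) x = peval v x + x ^ length v * peval w x"
  by (induction v) (simp_all add: algebra_simps)

lemma peval_map2: "length v = length w \<Longrightarrow> peval (map2 (+) v w) x = peval v x + peval w x"
  by (induction v w rule: list_induct2) (simp_all add: algebra_simps)

text \<open>Because x ^ 30 = 1, coefficients pushed past the end of the list reappear at its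
  start.\<close>

lemma peval_rotate:
  assumes "x ^ 30 = 1" "length v = 30" "e \<le> 30"
  shows "peval (drop (30 - e) v @ take (30 - e) v) x = x ^ e * peval v x"
proof -
  let ?k = "30 - e"
  have "peval v x = peval (take ?k v @ drop ?k v) x" by simp
  also have "\<dots> = peval (take ?k v) x + x ^ ?k * peval (drop ?k v) x"
    using assms by (simp only: peval_append) simp
  finally have "x ^ e * peval v x = x ^ e * peval (take ?k v) x + (x ^ e * x ^ ?k) * peval (drop ?k v) x"
    by (simp add: distrib_left mult.assoc)
  also have "x ^ e * x ^ ?k = 1" using assms by (simp flip: power_add)
  finally show ?thesis using assms by (simp add: peval_append)
qed

lemma walk_step_fold:
  assumes "x ^ 30 = 1" "length v = 30" "\<forall>e\<in>set es. e \<le> 30" "length w = 30"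
  shows "length (fold (\<lambda>e. map2 (+) (drop (30 - e) v @ take (30 - e) v)) es w) = 30 \<and>
    peval (fold (\<lambda>e. map2 (+) (drop (30 - e) v @ take (30 - e) v)) es w) x =
      peval w x + (\<Sum>e\<leftarrow>es. x ^ e) * peval v x"
  using assms(3,4)
proof (induction es arbitrary: w)
  case Nil
  then show ?case by simp
next
  case (Cons e es)
  let ?w = "map2 (+) (drop (30 - e) v @ take (30 - e) v) w"
  have len: "length (drop (30 - e) v @ take (30 - e) v) = length w" using assms(2) Cons.prems by simp
  then have lw: "length ?w = 30" using Cons.prems assms(2) by simp
  have "peval ?w x = x ^ e * peval v x + peval w x"
    using peval_map2[OF len] peval_rotate[OF assms(1,2), of e] Cons.prems by simp
  moreover have "\<forall>e\<in>set es. e \<le> 30" using Cons.prems(1) by simp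
  note Cons.IH[OF this lw]
  ultimately show ?case by (simp add: algebra_simps)
qed

lemma walk_step:
  assumes "x ^ 30 = 1" "length v = 30" "\<forall>e\<in>set es. e \<le> 30"
  shows "length (walk_step es v) = 30" "peval (walk_step es v) x = (\<Sum>e\<leftarrow>es. x ^ e) * peval v x"
  using walk_step_fold[OF assms, of "[0,0,0,0,0,0,0,0,0,0,0,0,0,0,0,0,0,0,0,0,0,0,0,0,0,0,0,0,0,0]"]
  by (simp_all add: walk_step_def)

lemma peval_sum: "peval v x = (\<Sum>j<length v. of_int (v ! j) * x ^ j)"
  by (induction v) (simp_all add: sum.lessThan_Suc_shift sum_distrib_left mult_ac del: sum.lessThan_Suc)

text \<open>Summation over all characters isolates the coefficient of the identity.\<close>

lemma sum_peval_zeta: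
  assumes "length v = 30"
  shows "(\<Sum>r<30. peval v (\<zeta> ^ r)) = 30 * of_int (hd v)"
proof -
  have "(\<Sum>r<30. peval v (\<zeta> ^ r)) = (\<Sum>j<30. \<Sum>r<30. of_int (v ! j) * (\<zeta> ^ r) ^ j)"
    unfolding peval_sum assms by (rule sum.swap)
  also have "\<dots> = (\<Sum>j<30::nat. if j = 0 then of_int (v ! 0) * 30 else 0)"
  proof (intro sum.cong refl)
    fix j :: nat assume "j \<in> {..<30}"
    moreover have "(\<zeta> ^ j) ^ 30 = 1" using zeta_30 by (metis mult.commute power_mult power_one)
    moreover have "(\<Sum>r<30. of_int (v ! j) * (\<zeta> ^ r) ^ j) = of_int (v ! j) * (\<Sum>r<30. (\<zeta> ^ j) ^ r)"
      unfolding sum_distrib_left by (simp only: power_mult[symmetric] mult.commute[of j])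
    ultimately show "(\<Sum>r<30. of_int (v ! j) * (\<zeta> ^ r) ^ j) = (if j = 0 then of_int (v ! 0) * 30 else (0::complex))"
      using sum_powers_root_unity[of "\<zeta> ^ j" 30] by (simp add: zeta_eq_1_iff)
  qed
  also have "\<dots> = of_int (v ! 0) * 30" by (subst sum.delta) auto
  also have "v ! 0 = hd v" using assms by (intro hd_conv_nth[symmetric]) auto
  finally show ?thesis by simp
qed

text \<open>Arbitrary starting vectors and all i at once make the induction work: each walk step
  absorbs one factor of the i-th power.\<close>

lemma closed_walks_eq:
  assumes "\<forall>e\<in>set es. e \<le> 30" "\<forall>e\<in>set es'. e \<le> 30" "length v = 30" "length v' = 30"
    and "\<And>i. (\<Sum>r<30. (\<Sum>e\<leftarrow>es. (\<zeta> ^ r) ^ e) ^ i * peval v (\<zeta> ^ r)) =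
      (\<Sum>r<30. (\<Sum>e\<leftarrow>es'. (\<zeta> ^ r) ^ e) ^ i * peval v' (\<zeta> ^ r))"
  shows "closed_walks k es v = closed_walks k es' v'"
  using assms(3-5)
proof (induction k arbitrary: v v')
  case 0
  then show ?case using 0(3)[of 0] sum_peval_zeta by simp
next
  case (Suc k)
  have z: "(\<zeta> ^ r) ^ 30 = 1" for r using zeta_30 by (metis mult.commute power_mult power_one)
  note s = walk_step[OF z Suc.prems(1) assms(1)] and s' = walk_step[OF z Suc.prems(2) assms(2)]
  have eq: "(\<Sum>r<30. (\<Sum>e\<leftarrow>es. (\<zeta> ^ r) ^ e) ^ i * peval (walk_step es v) (\<zeta> ^ r)) =
      (\<Sum>r<30. (\<Sum>e\<leftarrow>es'. (\<zeta> ^ r) ^ e) ^ i * peval (walk_step es' v') (\<zeta> ^ r))" for i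
    using Suc.prems(3)[of "Suc i"] by (simp add: s s' mult_ac)
  then show ?case using Suc.IH[OF s(1) s'(1)] by simp
qed

section \<open>Moments, reduction to the common order, and assembly\<close>

section \<open>The main theorem\<close>

lemma psum_zmset: "psum (zmset a b) r = (\<Sum>e\<leftarrow>exponents a b. (\<zeta> ^ r) ^ e)"
  by (simp add: psum_def zmset_def image_mset.compositionality comp_def mult.commute
      flip: sum_mset_sum_list mset_map power_mult)

lemma walk_number_eq:
  assumes "a < 30" "b < 30" "c < 30" "d < 30"
    and "\<And>i. (\<Sum>r<30. psum (zmset a b) r ^ i) = (\<Sum>r<30. psum (zmset c d) r ^ i)"
  shows "walk_number k a b = walk_number k c d"
  unfolding walk_number_def
proof (rule closed_walks_eq)
  show "\<forall>e\<in>set (exponents a b). e \<le> 30" "\<forall>e\<in>set (exponents c d). e \<le> 30"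
    using assms(1-4) by (auto simp: exponents_def)
qed (use assms(5) in \<open>simp_all add: psum_zmset\<close>)

lemma class_reps_bounds: "(c, d) \<in> set class_reps \<Longrightarrow> c < 30 \<and> d < 30"
  by (auto simp: class_reps_def)

lemma image_mset_periodic:
  assumes "\<And>r. F (r + n) = F r"
  shows "image_mset F (mset_set {1..n * q}) = repeat_mset q (image_mset F (mset_set {1..n}))"
proof (induction q)
  case 0
  then show ?case by simp
next
  case (Suc q)
  have per: "F (r + n * q) = F r" for r
    using assms by (induction q) (simp_all add: add.assoc[symmetric] add.commute[of n])
  have un: "{1..n * Suc q} = {1..n * q} \<union> (\<lambda>r. r + n * q) ` {1..n}"
  proof -
    have "(\<lambda>r. r + n * q) ` {1..n} = {1 + n * q..n + n * q}" by (rule image_add_atLeastAtMost')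
    then show ?thesis by (auto simp: algebra_simps)
  qed
  have "mset_set {1..n * Suc q} = mset_set {1..n * q} + image_mset (\<lambda>r. r + n * q) (mset_set {1..n})"
    unfolding un by (subst mset_set_Union) (auto simp: image_mset_mset_set)
  then have "image_mset F (mset_set {1..n * Suc q}) =
      image_mset F (mset_set {1..n * q}) + image_mset F (mset_set {1..n})"
    using per by (simp add: image_mset.compositionality comp_def)
  then show ?case using Suc by simp
qed

lemma psum_periodic:
  assumes "\<forall>w\<in>#A. w ^ n = 1"
  shows "psum A (r + n) = psum A r"
proof -
  have "image_mset (\<lambda>w. w ^ (r + n)) A = image_mset (\<lambda>w. w ^ r) A"
    using assms by (intro image_mset_cong) (simp add: power_add)
  then show ?thesis by (simp add: psum_def)
qed

lemma moments_eq:
  assumes n: "n dvd 30" and roots: "\<forall>w\<in>#A. w ^ n = 1" "\<forall>w\<in>#B. w ^ n = 1"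
    and eq: "image_mset (psum A) (mset_set {1..n}) = image_mset (psum B) (mset_set {1..n})"
  shows "(\<Sum>r<30. psum A r ^ i) = (\<Sum>r<30. psum B r ^ i)"
proof -
  obtain q where q: "30 = n * q" using n by (auto simp: dvd_def)
  have eq30: "image_mset (psum A) (mset_set {1..30}) = image_mset (psum B) (mset_set {1..30})"
    unfolding q using image_mset_periodic[of "psum A" n q] image_mset_periodic[of "psum B" n q]
      psum_periodic[OF roots(1)] psum_periodic[OF roots(2)] eq by simp
  have "(\<Sum>r<30. psum A r ^ i) = (\<Sum>s\<in>#image_mset (psum A) (mset_set {1..30}). s ^ i)"
    if "\<forall>w\<in>#A. w ^ n = 1" for A
  proof -
    have "\<forall>w\<in>#A. w ^ 30 = 1" using that unfolding q power_mult by simp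
    \<comment> \<open>Index 30 gives the same value as index 0, which shifts the range {0..29} to
      {1..30}.\<close>
    then have p: "psum A (Suc 29) = psum A 0" using psum_periodic[of A 30 0] by simp
    have "(\<Sum>r<30. psum A r ^ i) = (\<Sum>r<Suc 29. psum A r ^ i)" by simp
    also have "\<dots> = psum A 0 ^ i + (\<Sum>r<29. psum A (Suc r) ^ i)" by (rule sum.lessThan_Suc_shift)
    also have "\<dots> = (\<Sum>r<Suc 29. psum A (Suc r) ^ i)"
      by (simp only: sum.lessThan_Suc p add.commute)
    also have "\<dots> = (\<Sum>r\<in>{1..30}. psum A r ^ i)"
      by (rule sum.reindex_bij_witness[of _ "\<lambda>r. r - 1" Suc]) auto
    also have "\<dots> = (\<Sum>s\<in>#image_mset (psum A) (mset_set {1..30}). s ^ i)"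
      by (simp add: sum_unfold_sum_mset image_mset.compositionality comp_def)
    finally show ?thesis .
  qed
  then show ?thesis using roots eq30 by simp
qed

text \<open>Multiplication by u permutes the residues modulo 30.\<close>

lemma moments_power:
  assumes "coprime u 30" "\<forall>w\<in>#A. w ^ 30 = 1"
  shows "(\<Sum>r<30. psum (image_mset (\<lambda>w. w ^ u) A) r ^ i) = (\<Sum>r<30. psum A r ^ i)"
proof -
  have "psum (image_mset (\<lambda>w. w ^ u) A) r = psum A (u * r mod 30)" for r
  proof -
    have "(w ^ u) ^ r = w ^ (u * r mod 30)" if "w \<in># A" for w
    proof -
      have "(w ^ u) ^ r = w ^ (30 * (u * r div 30) + u * r mod 30)" by (simp flip: power_mult)
      also have "\<dots> = w ^ (u * r mod 30)"
        using assms(2) that by (simp only: power_add power_mult) simp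
      finally show ?thesis .
    qed
    then show ?thesis by (simp add: psum_def image_mset.compositionality comp_def cong: image_mset_cong)
  qed
  then have "(\<Sum>r<30. psum (image_mset (\<lambda>w. w ^ u) A) r ^ i) = (\<Sum>r<30. psum A (u * r mod 30) ^ i)"
    by simp
  also have "\<dots> = (\<Sum>s<30. psum A s ^ i)"
  proof (rule sum.reindex_bij_betw)
    have "inj_on (\<lambda>r. u * r mod 30) {..<30}"
    proof (rule inj_onI)
      fix r s :: nat assume rs: "r \<in> {..<30}" "s \<in> {..<30}" "u * r mod 30 = u * s mod 30"
      then have "[u * r = u * s] (mod 30)" by (simp add: cong_def)
      then have "[r = s] (mod 30)" using assms(1) by (simp add: cong_mult_lcancel_nat)
      then show "r = s" using rs by (simp add: cong_def)
    qed
    moreover have "(\<lambda>r. u * r mod 30) ` {..<30} = {..<30}"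
      by (rule card_subset_eq) (auto simp: card_image calculation)
    ultimately show "bij_betw (\<lambda>r. u * r mod 30) {..<30} {..<30}" by (simp add: bij_betw_def)
  qed
  finally show ?thesis .
qed

lemma zmset_roots: "\<forall>w\<in>#zmset c d. w ^ 30 = 1"
proof -
  have "(\<zeta> ^ e) ^ 30 = (\<zeta> ^ 30) ^ e" for e by (simp only: power_mult[symmetric] mult.commute)
  then show ?thesis by (auto simp: zmset_def zeta_30)
qed

lemma six_power_eq_1_iff:
  "(\<forall>w\<in>#six x y z. w ^ r = 1) \<longleftrightarrow> x ^ r = 1 \<and> y ^ r = 1 \<and> z ^ r = 1"
  by (auto simp: six_def simp flip: complex_cnj_power)

lemma generates_iff_dvd:
  assumes "generates A n"
  shows "(\<forall>w\<in>#A. w ^ m = 1) \<longleftrightarrow> n dvd m"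
proof
  show "\<forall>w\<in>#A. w ^ m = 1" if h: "n dvd m"
  proof -
    obtain j where j: "m = n * j" using h unfolding dvd_def by blast
    show ?thesis using assms unfolding generates_def j power_mult by simp
  qed
qed (use assms in \<open>simp add: generates_def\<close>)

text \<open>A coprime power map is invertible, so A and \<open>zmset c d\<close> are killed by the
  same exponents. This feeds the order tests in \<open>class_reps_eqI\<close>.\<close>

lemma generates_zmset_power:
  assumes g: "generates A n" and A: "A = image_mset (\<lambda>w. w ^ u) (zmset c d)" and u: "coprime u 30"
    and cd: "c < 30" "d < 30"
  shows "c * m mod 30 = 0 \<and> d * m mod 30 = 0 \<longleftrightarrow> n dvd m"
proof -
  obtain v where v: "zmset c d = image_mset (\<lambda>w. w ^ v) A"
    using power_inverse_mset[OF u zmset_roots A] by blast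
  have pow: "\<forall>w\<in>#image_mset (\<lambda>w. w ^ v) M. w ^ m = 1" if "\<forall>w\<in>#M. w ^ m = (1::complex)" for M v
  proof -
    have "(w ^ v) ^ m = (w ^ m) ^ v" for w :: complex by (simp only: power_mult[symmetric] mult.commute)
    then show ?thesis using that by simp
  qed
  have "c * m mod 30 = 0 \<and> d * m mod 30 = 0 \<longleftrightarrow> (\<zeta> ^ c) ^ m = 1 \<and> (\<zeta> ^ d) ^ m = 1"
    by (simp only: zeta_eq_1_iff power_mult[symmetric])
  also have "\<dots> \<longleftrightarrow> (\<forall>w\<in>#zmset c d. w ^ m = 1)"
    unfolding zmset_eq_six[OF cd] six_power_eq_1_iff
    by (auto simp: power_mult_distrib simp flip: complex_cnj_power)
  also have "\<dots> \<longleftrightarrow> (\<forall>w\<in>#A. w ^ m = 1)"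
  proof
    assume "\<forall>w\<in>#zmset c d. w ^ m = 1"
    then show "\<forall>w\<in>#A. w ^ m = 1" unfolding A by (rule pow)
  next
    assume "\<forall>w\<in>#A. w ^ m = 1"
    then show "\<forall>w\<in>#zmset c d. w ^ m = 1" unfolding v by (rule pow)
  qed
  also have "\<dots> \<longleftrightarrow> n dvd m" by (rule generates_iff_dvd[OF g])
  finally show ?thesis .
qed

lemma power_equiv_small:
  assumes n: "n dvd 30" and t: "unit_triple x y z" "unit_triple x' y' z'"
    and g: "generates (six x y z) n" "generates (six x' y' z') n"
    and eq: "image_mset (psum (six x y z)) (mset_set {1..n}) = image_mset (psum (six x' y' z')) (mset_set {1..n})"
  shows "\<exists>u. six x y z = image_mset (\<lambda>w. w ^ u) (six x' y' z')"
proof -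
  have r: "\<forall>w\<in>#six x y z. w ^ n = 1" "\<forall>w\<in>#six x' y' z'. w ^ n = 1" using g by (auto simp: generates_def)
  have r30: "w ^ 30 = 1" if "w ^ n = 1" for w :: complex
  proof -
    obtain j where j: "30 = n * j" using n unfolding dvd_def by blast
    show ?thesis unfolding j power_mult that by simp
  qed
  have "x ^ 30 = 1" "y ^ 30 = 1" "x' ^ 30 = 1" "y' ^ 30 = 1" using r r30 by (auto simp: six_def)
  then obtain c d u c' d' u'
    where cd: "(c, d) \<in> set class_reps" "coprime u 30" "six x y z = image_mset (\<lambda>w. w ^ u) (zmset c d)"
      and cd': "(c', d') \<in> set class_reps" "coprime u' 30" "six x' y' z' = image_mset (\<lambda>w. w ^ u') (zmset c' d')"
    using six_30_rep[OF t(1)] six_30_rep[OF t(2)] by metis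
  have b: "c < 30" "d < 30" "c' < 30" "d' < 30"
    using class_reps_bounds[OF cd(1)] class_reps_bounds[OF cd'(1)] by auto
  have "(\<Sum>r<30. psum (zmset c d) r ^ i) = (\<Sum>r<30. psum (zmset c' d') r ^ i)" for i
    using moments_eq[OF n r eq, of i] moments_power[OF cd(2) zmset_roots, of c d i]
      moments_power[OF cd'(2) zmset_roots, of c' d' i] unfolding cd(3) cd'(3) by simp
  then have "walk_number k c d = walk_number k c' d'" for k by (rule walk_number_eq[OF b])
  moreover have "c * m mod 30 = 0 \<and> d * m mod 30 = 0 \<longleftrightarrow> c' * m mod 30 = 0 \<and> d' * m mod 30 = 0" for m
    using generates_zmset_power[OF g(1) cd(3,2) b(1,2), of m] generates_zmset_power[OF g(2) cd'(3,2) b(3,4), of m]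
    by simp
  ultimately have "(c, d) = (c', d')" by (rule class_reps_eqI[OF cd(1) cd'(1)])
  then have A: "six x y z = image_mset (\<lambda>w. w ^ u) (zmset c' d')" using cd(3) by simp
  obtain v where v: "zmset c' d' = image_mset (\<lambda>w. w ^ v) (six x' y' z')"
    using power_inverse_mset[OF cd'(2) zmset_roots cd'(3)] by blast
  have "six x y z = image_mset (\<lambda>w. w ^ (v * u)) (six x' y' z')"
    unfolding A v by (simp add: image_mset.compositionality comp_def power_mult)
  then show ?thesis by blast
qed

text \<open>The left value at r = 1 occurs on the right at some u, not yet known to be coprime to n;
  this is why \<open>six_eq_or_exceptional\<close> takes an arbitrary right triple of n-th roots of
  unity.\<close>

lemma six_eq_power_or_exceptional:
  assumes n: "n > 0" "\<not> n dvd 30" and t: "unit_triple x y z" "unit_triple x' y' z'" and gn: "generic x y z"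
    and g: "generates (six x y z) n" "generates (six x' y' z') n"
    and eq: "image_mset (psum (six x y z)) (mset_set {1..n}) = image_mset (psum (six x' y' z')) (mset_set {1..n})"
  shows "\<exists>u. six x y z = image_mset (\<lambda>w. w ^ u) (six x' y' z') \<or>
    7 dvd n \<and> exceptional (n div 7) (six x y z) (image_mset (\<lambda>w. w ^ u) (six x' y' z'))"
proof -
  have "psum (six x y z) 1 \<in># image_mset (psum (six x y z)) (mset_set {1..n})" using n(1) by simp
  then obtain u where u: "psum (six x y z) 1 = psum (six x' y' z') u" unfolding eq by auto
  have "six x y z = six (x' ^ u) (y' ^ u) (z' ^ u) \<or>
      7 dvd n \<and> exceptional (n div 7) (six x y z) (six (x' ^ u) (y' ^ u) (z' ^ u))"
  proof (rule six_eq_or_exceptional[OF n t(1) tri_power[OF t(2)] gn])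
    fix w assume w: "w \<in># six x y z + six (x' ^ u) (y' ^ u) (z' ^ u)"
    have "(v ^ u) ^ n = 1" if "v ^ n = 1" for v :: complex
      using that by (metis mult.commute power_mult power_one)
    then show "w ^ n = 1" using w g by (auto simp: generates_def simp flip: image_power_six)
  next
    show "n dvd d" if "x ^ d = 1" "y ^ d = 1" "z ^ d = 1" for d
      by (rule generates_six[OF t(1) g(1) that])
    show "(\<Sum>w\<in>#six x y z. w) = (\<Sum>w\<in>#six (x' ^ u) (y' ^ u) (z' ^ u). w)"
      using u by (simp add: psum_def image_mset.compositionality comp_def flip: image_power_six)
  qed
  then show ?thesis unfolding image_power_six by blast
qed

lemma power_equiv:
  assumes n: "n > 0" and t: "unit_triple x y z" "unit_triple x' y' z'"
    and g: "generates (six x y z) n" "generates (six x' y' z') n"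
    and eq: "image_mset (psum (six x y z)) (mset_set {1..n}) = image_mset (psum (six x' y' z')) (mset_set {1..n})"
  shows "\<exists>u. six x y z = image_mset (\<lambda>w. w ^ u) (six x' y' z')"
proof (cases "n dvd 30")
  case True
  then show ?thesis by (rule power_equiv_small[OF _ t g eq])
next
  case n30: False
  let ?A = "six x y z" and ?B = "six x' y' z'"
  have r: "\<forall>w\<in>#?A. w ^ n = 1" "\<forall>w\<in>#?B. w ^ n = 1" using g by (auto simp: generates_def)
  \<comment> \<open>Both sextuples generate the same group, so the exponent is coprime to n and the
    power map can be inverted.\<close>
  have flip: "\<exists>u. ?A = image_mset (\<lambda>w. w ^ u) ?B" if B: "?B = image_mset (\<lambda>w. w ^ v) ?A" for v
  proof -
    have "coprime v n" using coprime_of_power[of v ?A n] g(2) r(1) n B by simp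
    then show ?thesis using power_inverse_mset[OF _ r(1) B] by blast
  qed
  have no_exc: "\<not> exceptional (n div 7) M (image_mset (\<lambda>w. w ^ u) (six x y z))"
    if h: "7 dvd n" "unit_triple x y z" "\<not> generic x y z" "generates (six x y z) n" for M u x y z
  proof -
    obtain w where w: "w * cnj w = 1" "six x y z = minus_one_six w \<or> six x y z = opposite_six w"
      using not_generic_cases[OF h(2,3)] by blast
    have "even n" using w(2) h(4) minus_one_six_even[of w n] opposite_six_even[of w n] by auto
    moreover have "n = 7 * (n div 7)" using h(1) by simp
    moreover have "\<forall>v\<in>#six x y z. v ^ n = 1" using h(4) by (simp add: generates_def)
    ultimately show ?thesis by (intro not_exceptional_degenerate[OF _ _ w(2,1)])
  qed
  show ?thesis
  proof (cases "generic x y z")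
    case gA: True
    obtain u where u: "?A = image_mset (\<lambda>w. w ^ u) ?B \<or>
        7 dvd n \<and> exceptional (n div 7) ?A (image_mset (\<lambda>w. w ^ u) ?B)"
      using six_eq_power_or_exceptional[OF n n30 t gA g eq] by blast
    show ?thesis
    proof (cases "?A = image_mset (\<lambda>w. w ^ u) ?B")
      case True
      then show ?thesis by blast
    next
      case False
      then have ex: "7 dvd n" "exceptional (n div 7) ?A (image_mset (\<lambda>w. w ^ u) ?B)" using u by auto
      \<comment> \<open>A degenerate right sextuple admits no exceptional partner, so the roles can
        be exchanged; if the exception recurs, both sextuples lie in the family of
        \<open>exceptional_pair\<close>.\<close>
      then have gB: "generic x' y' z'" using no_exc t(2) g(2) by blast
      obtain v where v: "?B = image_mset (\<lambda>w. w ^ v) ?A \<or>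
          7 dvd n \<and> exceptional (n div 7) ?B (image_mset (\<lambda>w. w ^ v) ?A)"
        using six_eq_power_or_exceptional[OF n n30 t(2,1) gB g(2,1) eq[symmetric]] by blast
      show ?thesis
      proof (cases "?B = image_mset (\<lambda>w. w ^ v) ?A")
        case True
        then show ?thesis by (rule flip)
      next
        case False
        then have ex': "exceptional (n div 7) ?B (image_mset (\<lambda>w. w ^ v) ?A)" using v by auto
        obtain w w' where w: "?A = six w (w ^ 29) (w ^ 12)" "?B = six w' (w' ^ 29) (w' ^ 12)"
          using ex(2) ex' unfolding exceptional_def by blast
        have "w \<in># ?A" "w' \<in># ?B" unfolding w by (simp_all add: six_def)
        moreover have "s * cnj s = 1" if "s \<in># six x y z" "unit_triple x y z" for s x y z
          using that by (auto simp: six_def unit_triple_def mult.commute)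
        ultimately have "w * cnj w = 1" "w' * cnj w' = 1" using t by blast+
        then show ?thesis by (rule exceptional_pair[OF n g w])
      qed
    qed
  next
    case gA: False
    show ?thesis
    proof (cases "generic x' y' z'")
      case gB: True
      obtain v where v: "?B = image_mset (\<lambda>w. w ^ v) ?A \<or>
          7 dvd n \<and> exceptional (n div 7) ?B (image_mset (\<lambda>w. w ^ v) ?A)"
        using six_eq_power_or_exceptional[OF n n30 t(2,1) gB g(2,1) eq[symmetric]] by blast
      then have "?B = image_mset (\<lambda>w. w ^ v) ?A" using no_exc t(1) g(1) gA by blast
      then show ?thesis by (rule flip)
    next
      case gB: False
      obtain w where w: "w * cnj w = 1" "?A = minus_one_six w \<or> ?A = opposite_six w" using not_generic_cases[OF t(1) gA] by blast
      obtain w' where w': "w' * cnj w' = 1" "?B = minus_one_six w' \<or> ?B = opposite_six w'" using not_generic_cases[OF t(2) gB] by blast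
      from w(2) w'(2) show ?thesis
      proof (elim disjE)
        assume h: "?A = minus_one_six w" "?B = minus_one_six w'"
        show ?thesis using minus_one_six_equiv[OF n _ w(1) _ w'(1)] g unfolding h by blast
      next
        assume h: "?A = opposite_six w" "?B = opposite_six w'"
        show ?thesis using opposite_six_equiv[OF n _ w(1) _ w'(1)] g unfolding h by blast
      next
        assume h: "?A = minus_one_six w" "?B = opposite_six w'"
        show ?thesis using minus_one_six_opposite_six_psum_neq[OF n n30 _ w(1) _ w'(1)] g eq unfolding h by blast
      next
        assume h: "?A = opposite_six w" "?B = minus_one_six w'"
        show ?thesis using minus_one_six_opposite_six_psum_neq[OF n n30 _ w'(1) _ w(1)] g eq[symmetric] unfolding h by blast
      qed
    qed
  qed
qed

text \<open>The sum is twice a sum of three real parts, each at most 1 with equality only at the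
  value 1.\<close>

lemma psum_eq_6_iff:
  assumes "unit_triple x y z"
  shows "psum (six x y z) r = 6 \<longleftrightarrow> x ^ r = 1 \<and> y ^ r = 1 \<and> z ^ r = 1"
proof -
  have sum: "psum (six x y z) r = x ^ r + y ^ r + z ^ r + cnj (x ^ r) + cnj (y ^ r) + cnj (z ^ r)"
    by (simp add: psum_def six_def add_ac)
  have t: "unit_triple (x ^ r) (y ^ r) (z ^ r)" by (rule tri_power[OF assms])
  have norm: "cmod w = 1" if "w * cnj w = 1" for w
  proof -
    have "complex_of_real ((cmod w)\<^sup>2) = 1" using that complex_norm_square[of w] by simp
    then have "(cmod w)\<^sup>2 = 1\<^sup>2" by (simp only: of_real_eq_1_iff one_power2)
    then show ?thesis by (rule power2_eq_imp_eq) simp_all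
  qed
  have "cmod (x ^ r) = 1" "cmod (y ^ r) = 1" "cmod (z ^ r) = 1"
    using t by (simp_all only: unit_triple_def norm)
  then have le: "Re (x ^ r) \<le> 1" "Re (y ^ r) \<le> 1" "Re (z ^ r) \<le> 1"
    and one: "Re (x ^ r) = 1 \<longrightarrow> x ^ r = 1" "Re (y ^ r) = 1 \<longrightarrow> y ^ r = 1" "Re (z ^ r) = 1 \<longrightarrow> z ^ r = 1"
    using complex_Re_le_cmod[of "x ^ r"] complex_Re_le_cmod[of "y ^ r"] complex_Re_le_cmod[of "z ^ r"]
    by (auto simp only: cmod_def complex_eq_iff) (auto simp: real_sqrt_eq_1_iff)
  show ?thesis
  proof
    assume "psum (six x y z) r = 6"
    then have "Re (psum (six x y z) r) = 6" by simp
    then have "Re (x ^ r) + Re (y ^ r) + Re (z ^ r) = 3"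
      unfolding sum plus_complex.sel complex_cnj by (simp del: complex_cnj_power)
    then have "Re (x ^ r) = 1" "Re (y ^ r) = 1" "Re (z ^ r) = 1" using le by linarith+
    then show "x ^ r = 1 \<and> y ^ r = 1 \<and> z ^ r = 1" using one by blast
  next
    assume "x ^ r = 1 \<and> y ^ r = 1 \<and> z ^ r = 1"
    then show "psum (six x y z) r = 6" unfolding sum by (simp del: complex_cnj_power)
  qed
qed

lemma generates_exponent:
  fixes A :: "complex multiset"
  assumes "n > 0" "\<forall>w\<in>#A. w ^ n = 1"
  shows "\<exists>m>0. m dvd n \<and> generates A m"
proof -
  define P where "P d \<longleftrightarrow> d > 0 \<and> (\<forall>w\<in>#A. w ^ d = 1)" for d
  define m where "m = (LEAST d. P d)"
  have "P n" using assms by (simp add: P_def)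
  then have m: "P m" unfolding m_def by (rule LeastI)
  have dvd: "m dvd d" if "\<forall>w\<in>#A. w ^ d = 1" for d
  proof (rule ccontr)
    assume "\<not> m dvd d"
    then have pos: "d mod m > 0" by (simp add: mod_greater_zero_iff_not_dvd)
    have "w ^ (d mod m) = 1" if w: "w \<in># A" for w
    proof -
      have "w ^ d = w ^ (m * (d div m) + d mod m)" by simp
      also have "\<dots> = w ^ (d mod m)" using m w by (simp only: power_add power_mult) (simp add: P_def)
      finally show ?thesis using that \<open>\<forall>w\<in>#A. w ^ d = 1\<close> by simp
    qed
    then have "P (d mod m)" using pos by (simp add: P_def)
    then have "m \<le> d mod m" unfolding m_def by (rule Least_le)
    moreover have "d mod m < m" using m by (simp add: P_def)
    ultimately show False by simp
  qed
  have "generates A m" using m dvd by (simp add: generates_def P_def)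
  then show ?thesis using m dvd[OF assms(2)] by (auto simp: P_def)
qed

lemma card_multiples: "m > 0 \<Longrightarrow> card {r \<in> {1..m * q}. m dvd r} = q"
proof -
  assume m: "m > 0"
  have "{r \<in> {1..m * q}. m dvd r} = (\<lambda>i. m * i) ` {1..q}"
    using m by (auto simp: dvd_def)
  moreover have "inj_on (\<lambda>i. m * i) {1..q}" using m by (auto intro!: inj_onI)
  ultimately show ?thesis by (simp add: card_image)
qed

text \<open>With t the product of the primes of n that do not divide u, each prime of n divides
  exactly one of u and m * t, hence not their sum.\<close>

lemma coprime_lift:
  fixes u m n :: nat
  assumes "m dvd n" "n > 0" "coprime u m"
  shows "\<exists>v. coprime v n \<and> [v = u] (mod m)"
proof -
  define t where "t = \<Prod>{p \<in> prime_factors n. \<not> p dvd u}"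
  have fin: "finite {p \<in> prime_factors n. \<not> p dvd u}" by simp
  have "coprime (u + m * t) n"
  proof (rule ccontr)
    assume "\<not> coprime (u + m * t) n"
    then have "gcd (u + m * t) n \<noteq> 1" by (simp only: coprime_iff_gcd_eq_1 not_False_eq_True)
    from prime_factor_nat[OF this] obtain q where "prime q" "q dvd gcd (u + m * t) n" by auto
    then have q: "prime q" "q dvd u + m * t" "q dvd n" by auto
    have qf: "q \<in> prime_factors n" using q assms(2) by (simp add: in_prime_factors_iff)
    show False
    proof (cases "q dvd u")
      case True
      then have "q dvd m * t" using q(2) by (simp add: dvd_add_right_iff)
      then have "q dvd m \<or> q dvd t" using prime_dvd_mult_iff[OF q(1)] by simp
      then show False
      proof
        assume "q dvd m"
        then have "is_unit q" using True assms(3) by (meson coprime_common_divisor)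
        then show False using q(1) by simp
      next
        assume "q dvd t"
        then obtain p where p: "p \<in> {p \<in> prime_factors n. \<not> p dvd u}" "q dvd p"
          unfolding t_def using prime_dvd_prod_iff[OF fin q(1), of id] by auto
        then have "prime p" by (auto simp: in_prime_factors_iff)
        then have "q = p" using primes_dvd_imp_eq[OF q(1) _ p(2)] by simp
        then show False using True p(1) by simp
      qed
    next
      case False
      then have "q dvd t" unfolding t_def using qf fin by (intro dvd_prodI[of _ q id, simplified]) auto
      then have "q dvd m * t" by simp
      then show False using q(2) False by (simp add: dvd_add_left_iff)
    qed
  qed
  moreover have "[u + m * t = u] (mod m)" by (simp add: cong_def)
  ultimately show ?thesis by blast
qed

theorem theorem6p1:
  fixes n :: nat
    and \<alpha>1 \<alpha>2 \<alpha>3 \<beta>1 \<beta>2 \<beta>3 :: complex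
    and \<A> \<B> :: "complex multiset"
  assumes "n \<ge> 1"
    and "\<alpha>1 ^ n = 1" and "\<alpha>2 ^ n = 1" and "\<alpha>3 ^ n = 1"
    and "\<beta>1 ^ n = 1" and "\<beta>2 ^ n = 1" and "\<beta>3 ^ n = 1"
    and "\<alpha>1 * \<alpha>2 * \<alpha>3 = 1" and "\<beta>1 * \<beta>2 * \<beta>3 = 1"
    and "\<A> = {#\<alpha>1, \<alpha>2, \<alpha>3, cnj \<alpha>1, cnj \<alpha>2, cnj \<alpha>3#}"
    and "\<B> = {#\<beta>1, \<beta>2, \<beta>3, cnj \<beta>1, cnj \<beta>2, cnj \<beta>3#}"
    and "{# (\<Sum>\<phi>\<in>#\<A>. \<phi> ^ r). r \<in># mset_set {1..n} #} =
         {# (\<Sum>\<psi>\<in>#\<B>. \<psi> ^ r). r \<in># mset_set {1..n} #}"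
  shows "\<exists>u::int. coprime u (int n) \<and> \<A> = {# \<psi> powi u. \<psi> \<in># \<B> #}"
proof -
  have n: "n > 0" using assms(1) by simp
  have unit: "w * cnj w = 1" if "w ^ n = 1" for w
  proof -
    have "cmod w ^ n = 1" using that by (metis norm_one norm_power)
    then have "cmod w = 1" using power_eq_imp_eq_base[of "cmod w" n 1] n by simp
    then show ?thesis using complex_norm_square[of w] by simp
  qed
  have t: "unit_triple \<alpha>1 \<alpha>2 \<alpha>3" "unit_triple \<beta>1 \<beta>2 \<beta>3"
    using assms(2-9) unit by (simp_all add: unit_triple_def)
  have A: "\<A> = six \<alpha>1 \<alpha>2 \<alpha>3" and B: "\<B> = six \<beta>1 \<beta>2 \<beta>3" using assms(10,11) by (simp_all add: six_def)
  have r: "\<forall>w\<in>#\<A>. w ^ n = 1" "\<forall>w\<in>#\<B>. w ^ n = 1"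
    unfolding A B six_power_eq_1_iff six_power_eq_1_iff using assms(2-7) by auto
  have eq: "image_mset (psum \<A>) (mset_set {1..n}) = image_mset (psum \<B>) (mset_set {1..n})"
    using assms(12) by (simp add: psum_def[abs_def])
  obtain m where m: "m > 0" "m dvd n" "generates \<A> m" using generates_exponent[OF n r(1)] by blast
  obtain m' where m': "m' > 0" "m' dvd n" "generates \<B> m'" using generates_exponent[OF n r(2)] by blast
  obtain q where q: "n = m * q" using m(2) by auto
  obtain q' where q': "n = m' * q'" using m'(2) by auto
  have six_iff: "psum \<A> d = 6 \<longleftrightarrow> m dvd d" "psum \<B> d = 6 \<longleftrightarrow> m' dvd d" for d
    using psum_eq_6_iff[OF t(1), of d] generates_iff_dvd[OF m(3), of d]
      psum_eq_6_iff[OF t(2), of d] six_power_eq_1_iff[where r = d] generates_iff_dvd[OF m'(3), of d]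
    unfolding A B by auto
  \<comment> \<open>The value 6 occurs exactly at the multiples of m for one sextuple and of m' for
    the other, so counting it identifies the two orders.\<close>
  have "card {r \<in> {1..n}. m dvd r} = card {r \<in> {1..n}. m' dvd r}"
    using count_image_mset_set[of "{1..n}" "psum \<A>" 6] count_image_mset_set[of "{1..n}" "psum \<B>" 6] eq
    by (simp add: six_iff)
  then have "q = q'" using card_multiples[OF m(1), of q] card_multiples[OF m'(1), of q'] q q' by simp
  then have mm: "m' = m" using q q' n by auto
  have per: "psum \<A> (r + m) = psum \<A> r" "psum \<B> (r + m) = psum \<B> r" for r
    using m(3) m'(3) mm by (auto intro!: psum_periodic simp: generates_def)
  \<comment> \<open>Both sequences have period m, so all multiplicities over {1..n} are q times
    those over {1..m}.\<close>
  have "repeat_mset q (image_mset (psum \<A>) (mset_set {1..m})) = repeat_mset q (image_mset (psum \<B>) (mset_set {1..m}))"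
    using eq image_mset_periodic[of "psum \<A>" m q] image_mset_periodic[of "psum \<B>" m q] per q by simp
  then have "q * count (image_mset (psum \<A>) (mset_set {1..m})) s = q * count (image_mset (psum \<B>) (mset_set {1..m})) s" for s
    by (metis count_repeat_mset)
  then have eqm: "image_mset (psum \<A>) (mset_set {1..m}) = image_mset (psum \<B>) (mset_set {1..m})"
    using q n by (intro multiset_eqI) (metis mult_cancel1 mult_zero_right neq0_conv)
  have "\<exists>u. \<A> = image_mset (\<lambda>w. w ^ u) \<B>"
    using m(3) m'(3) eqm unfolding A B mm by (rule power_equiv[OF m(1) t])
  then obtain u where u: "\<A> = image_mset (\<lambda>w. w ^ u) \<B>" ..
  have rm: "\<forall>w\<in>#\<B>. w ^ m = 1" using m'(3) mm by (simp add: generates_def)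
  have "coprime u m" by (rule coprime_of_power[OF m(3)[unfolded u] rm m(1)])
  \<comment> \<open>So far the exponent is coprime to m only; changing it within its residue class
    modulo m makes it coprime to n without affecting the powers.\<close>
  then obtain v where v: "coprime v n" "[v = u] (mod m)" using coprime_lift[OF m(2) n] by blast
  have "w ^ v = w ^ u" if "w \<in># \<B>" for w
  proof -
    have red: "w ^ j = w ^ (j mod m)" for j
    proof -
      have "w ^ j = w ^ (m * (j div m) + j mod m)" by simp
      also have "\<dots> = w ^ (j mod m)" using rm that by (simp only: power_add power_mult) simp
      finally show ?thesis .
    qed
    show ?thesis using red[of v] red[of u] v(2) by (simp add: cong_def)
  qed
  then have "\<A> = {# \<psi> powi (int v). \<psi> \<in># \<B> #}" unfolding u by (intro image_mset_cong) simp
  moreover have "coprime (int v) (int n)" using v(1) by simp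
  ultimately show ?thesis by blast
qed

end
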